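(* Let $s>3/2$. Let $c\in C^\infty(\mathbb R)$ satisfy $0<c_1\le c(u)\le c_2$ and $|c'(u)|\le c_3$ for all $u\in\mathbb R$, for some constants $c_1,c_2,c_3\in(0,\infty)$, and let $\Phi$ satisfy $\sum_{k\ge1}\|\sigma_k\|_{H^{s+1}(\mathbb T)}^2<\infty$, where $\sigma_k=\Phi g_k$. Assume that $c'(u^\star)\ne0$ for some $u^\star\in\mathbb R$. Then for any $\gamma>1/3$ and any $\varepsilon>0$ there is an initial datum $u_0^\varepsilon\in C^\infty(\mathbb T)$ such that the regular solution $(u,\tau^* )$, defined up to the explosion time $\tau^*$, to $$\mathrm d u_t-c(u)\,(c(u)u_x)_x\,\mathrm dt=\Phi\,\mathrm dW,\qquad u(0,\cdot)=u_0^\varepsilon,\quad u_t(0,\cdot)=0,$$ satisfies $$\mathbb P(\tau^*\le\varepsilon^\gamma)\ge1-\varepsilon.$$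
   Context: $\mathbb T=\mathbb R/\mathbb Z$. $(\Omega,\mathcal F,\mathbb P,(\mathcal F_t)_{t\ge0})$ is a filtered probability space. $\mathfrak U$ is a Hilbert space with orthonormal basis $(g_k)_{k\ge1}$, and $\mathfrak U\hookrightarrow\mathfrak U_{-1}$ is a Hilbert–Schmidt injection into another Hilbert space. $W(t)=\sum_{k\ge1}g_k\beta_k(t)$ is a cylindrical Wiener process, with $(\beta_k)$ independent one-dimensional Wiener processes. $\Phi:\mathfrak U\to L^2(\mathbb T)$ is a linear map with $\sigma_k:=\Phi g_k\in C(\mathbb T)$ and $\sum_k\|\sigma_k\|^2_{W^{1,\infty}(\mathbb T)}<\infty$; $\Phi W(t)=\sum_k\sigma_k\beta_k(t)$. The subscript $t$ in $u_t$ denotes the time derivative. Under $\sum_k\|\sigma_k\|_{H^{s+1}}^2<\infty$ there is a set $\Omega_s$ of probability one such that for $\omega\in\Omega_s$ and all $T>0$, $\Phi W\in C([0,T],H^{s+1}(\mathbb T))$. Regular solution up to an explosion time, for data $(u_0,v_0)\in H^{s+1}(\mathbb T)\times H^s(\mathbb T)$ (where $u(0,\cdot)=u_0$, $u_t(0,\cdot)=v_0$): let $\tau$ be a stopping time with $\tau>0$ a.s. A process $(u(t))_{0\le t<\tau}$ with, a.s., $u\in C([0,\tau),H^{s+1}(\mathbb T))\cap C^1([0,\tau),H^s(\mathbb T))$ is a regular solution up to the explosion time $\tau$ if: (1) $u(0,\cdot)=u_0$ $\mathbb P$-a.s.; (2) for any stopping time $\tau'$ with $\tau'<\tau$ a.s.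 and all $x\in\mathbb T$, the process $(u(t\wedge\tau',x))_{t\ge0}$ is predictable and, for all $\omega\in\Omega_s$ with $\tau'(\omega)<\tau(\omega)$ (hence $\mathbb P$-a.s.), one has in $H^{s-1}(\mathbb T)$ the identity $u_t(\tau')=v_0+\int_0^{\tau'}c(u)(c(u)u_x)_x\,\mathrm ds+\Phi W(\tau')$; (3) $\tau=\sup_{n\ge1}\tau_n$, where $\tau_n=\inf\{t\in[0,\tau):\ \|(u_t(t),u_x(t))\|_{L^\infty(\mathbb T)}>n\}$, with the convention that the infimum equals $\tau$ if the condition never holds on $[0,\tau)$. Under the present assumptions such a solution exists and is unique, for any data in $H^{s+1}\times H^s$.
   Formalization: A regular solution is also required to satisfy the integral equation a.s. for all t in [0,τ); clause (2) alone gives this when τ is a limit of stopping times τ'<τ (as explosion times are), but fails to for e.g. an independent exponential τ, where the claim would be false. *)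

theory Defs
  imports "HOL-Probability.Probability"
begin

section \<open>Function spaces on the torus\<close>

text \<open>
  A function on \<open>\<real>/\<int>\<close> is a 1-periodic function on \<open>\<real>\<close>.  Elements of \<open>L\<^sup>2\<close> and of the
  Sobolev spaces are represented by functions; equality in these spaces is equality
  almost everywhere.
\<close>

definition periodic1 :: "(real \<Rightarrow> real) \<Rightarrow> bool" where
  "periodic1 f \<longleftrightarrow> (\<forall>x. f (x + 1) = f x)"

definition smooth :: "(real \<Rightarrow> real) \<Rightarrow> bool" where
  "smooth f \<longleftrightarrow> (\<forall>n x. (deriv ^^ n) f field_differentiable at x)"

definition torus_C :: "(real \<Rightarrow> real) \<Rightarrow> bool" where
  "torus_C f \<longleftrightarrow> periodic1 f \<and> continuous_on UNIV f"

definition torus_smooth :: "(real \<Rightarrow> real) \<Rightarrow> bool" where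
  "torus_smooth f \<longleftrightarrow> periodic1 f \<and> smooth f"

definition torus_L2 :: "(real \<Rightarrow> real) \<Rightarrow> bool" where
  "torus_L2 f \<longleftrightarrow> periodic1 f \<and> f \<in> borel_measurable borel \<and>
     set_integrable lborel {0..1} (\<lambda>x. (f x)\<^sup>2)"

definition fourier_coeff :: "(real \<Rightarrow> real) \<Rightarrow> int \<Rightarrow> complex" where
  "fourier_coeff f k =
     set_lebesgue_integral lborel {0..1} (\<lambda>x. f x *\<^sub>R cis (- 2 * pi * real_of_int k * x))"

definition sobolev_weight :: "real \<Rightarrow> (real \<Rightarrow> real) \<Rightarrow> int \<Rightarrow> real" where
  "sobolev_weight r f k = (1 + (real_of_int k)\<^sup>2) powr r * (cmod (fourier_coeff f k))\<^sup>2"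

text \<open>\<open>H\<^sup>r\<close> for \<open>r \<ge> 0\<close>; \<open>sobolev_norm\<close> is meaningful for members of \<open>H\<^sup>r\<close> only.\<close>

definition sobolev :: "real \<Rightarrow> (real \<Rightarrow> real) \<Rightarrow> bool" where
  "sobolev r f \<longleftrightarrow> torus_L2 f \<and> sobolev_weight r f summable_on UNIV"

definition sobolev_norm :: "real \<Rightarrow> (real \<Rightarrow> real) \<Rightarrow> real" where
  "sobolev_norm r f = sqrt (infsum (sobolev_weight r f) UNIV)"

text \<open>
  \<open>W\<^sup>1\<^sup>,\<^sup>\<infinity>\<close> consists of the (classes of) Lipschitz functions; their weak derivative is
  the derivative that exists almost everywhere.
\<close>

definition torus_W1inf :: "(real \<Rightarrow> real) \<Rightarrow> bool" where
  "torus_W1inf f \<longleftrightarrow> periodic1 f \<and> (\<exists>L. L-lipschitz_on UNIV f)"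

definition W1inf_norm :: "(real \<Rightarrow> real) \<Rightarrow> real" where
  "W1inf_norm f = real_of_ereal (esssup lborel (\<lambda>x. ereal \<bar>f x\<bar>))
                + real_of_ereal (esssup lborel (\<lambda>x. ereal \<bar>deriv f x\<bar>))"

section \<open>Paths with values in Sobolev spaces\<close>

definition sobolev_path_continuous ::
    "real \<Rightarrow> real set \<Rightarrow> (real \<Rightarrow> real \<Rightarrow> real) \<Rightarrow> bool" where
  "sobolev_path_continuous r I f \<longleftrightarrow>
     (\<forall>t\<in>I. sobolev r (f t) \<and>
        ((\<lambda>t'. sobolev_norm r (\<lambda>x. f t' x - f t x)) \<longlongrightarrow> 0) (at t within I))"

definition sobolev_path_deriv ::
    "real \<Rightarrow> real set \<Rightarrow> (real \<Rightarrow> real \<Rightarrow> real) \<Rightarrow> (real \<Rightarrow> real \<Rightarrow> real) \<Rightarrow> bool" where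
  "sobolev_path_deriv r I f f' \<longleftrightarrow>
     (\<forall>t\<in>I. sobolev r (f t) \<and> sobolev r (f' t) \<and>
        ((\<lambda>t'. sobolev_norm r (\<lambda>x. (f t' x - f t x) / (t' - t) - f' t x)) \<longlongrightarrow> 0) (at t within I))"

text \<open>
  The \<open>H\<^sup>r\<close>-valued integral over \<open>[0,t]\<close>: the library's gauge integral
  \<open>has_integral\<close> written for the norm of \<open>H\<^sup>r\<close>, which is not a type.
  For paths continuous in \<open>H\<^sup>r\<close> it agrees with the Bochner integral.
\<close>

definition has_sobolev_integral ::
    "real \<Rightarrow> (real \<Rightarrow> real \<Rightarrow> real) \<Rightarrow> (real \<Rightarrow> real) \<Rightarrow> real \<Rightarrow> bool" where
  "has_sobolev_integral r f I t \<longleftrightarrow>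
     (\<forall>a\<in>{0..t}. sobolev r (f a)) \<and> sobolev r I \<and>
     ((\<lambda>p. sobolev_norm r (\<lambda>x. (\<Sum>(a, K)\<in>p. measure lborel K * f a x) - I x)) \<longlongrightarrow> 0)
       (division_filter {0..t})"

section \<open>Stochastic setting\<close>

text \<open>
  Times in \<open>[0,\<infinity>]\<close> have type \<^typ>\<open>ennreal\<close>, so that the library's \<open>filtration\<close> and
  \<open>stopping_time\<close> cover random times that may be infinite.  The stopping time condition at
  \<open>\<infinity>\<close> is trivial, so \<open>F \<infinity>\<close> plays no role.
\<close>

definition filtered_prob_space :: "'a measure \<Rightarrow> (ennreal \<Rightarrow> 'a measure) \<Rightarrow> bool" where
  "filtered_prob_space M F \<longleftrightarrow>
     prob_space M \<and> filtration (space M) F \<and> (\<forall>t. sets (F t) \<subseteq> sets M)"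

definition wiener_process ::
    "'a measure \<Rightarrow> (ennreal \<Rightarrow> 'a measure) \<Rightarrow> (real \<Rightarrow> 'a \<Rightarrow> real) \<Rightarrow> bool" where
  "wiener_process M F B \<longleftrightarrow>
     (\<forall>t\<ge>0. B t \<in> borel_measurable (F (ennreal t))) \<and>
     (AE \<omega> in M. B 0 \<omega> = 0) \<and>
     (AE \<omega> in M. continuous_on {0..} (\<lambda>t. B t \<omega>)) \<and>
     (\<forall>a b. 0 \<le> a \<and> a < b \<longrightarrow>
        distributed M lborel (\<lambda>\<omega>. B b \<omega> - B a \<omega>) (normal_density 0 (sqrt (b - a))) \<and>
        prob_space.indep_set M (sets (F (ennreal a)))
          {(\<lambda>\<omega>. B b \<omega> - B a \<omega>) -` A \<inter> space M | A. A \<in> sets borel})"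

definition independent_processes ::
    "'a measure \<Rightarrow> (nat \<Rightarrow> real \<Rightarrow> 'a \<Rightarrow> real) \<Rightarrow> bool" where
  "independent_processes M \<beta> \<longleftrightarrow>
     prob_space.indep_sets M
       (\<lambda>k. sigma_sets (space M) {\<beta> k t -` A \<inter> space M | t A. 0 \<le> t \<and> A \<in> sets borel}) UNIV"

text \<open>The basis is indexed from \<open>0\<close>.\<close>

definition orthonormal_basis :: "(nat \<Rightarrow> 'u::{real_inner, complete_space}) \<Rightarrow> bool" where
  "orthonormal_basis g \<longleftrightarrow>
     (\<forall>j k. inner (g j) (g k) = (if j = k then 1 else 0)) \<and> closure (span (range g)) = UNIV"

definition hilbert_schmidt_injection ::
    "(nat \<Rightarrow> 'u::{real_inner, complete_space}) \<Rightarrow> ('u \<Rightarrow> 'v::{real_inner, complete_space}) \<Rightarrow> bool" where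
  "hilbert_schmidt_injection g J \<longleftrightarrow>
     bounded_linear J \<and> inj J \<and> summable (\<lambda>k. (norm (J (g k)))\<^sup>2)"

definition cylindrical_wiener ::
    "'a measure \<Rightarrow> (ennreal \<Rightarrow> 'a measure) \<Rightarrow> (nat \<Rightarrow> 'u::{real_inner, complete_space}) \<Rightarrow>
     ('u \<Rightarrow> 'v::{real_inner, complete_space}) \<Rightarrow> (nat \<Rightarrow> real \<Rightarrow> 'a \<Rightarrow> real) \<Rightarrow>
     (real \<Rightarrow> 'a \<Rightarrow> 'v) \<Rightarrow> bool" where
  "cylindrical_wiener M F g J \<beta> W \<longleftrightarrow>
     (\<forall>k. wiener_process M F (\<beta> k)) \<and> independent_processes M \<beta> \<and>
     (\<forall>t\<ge>0. AE \<omega> in M. (\<lambda>k. \<beta> k t \<omega> *\<^sub>R J (g k)) sums W t \<omega>)"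

definition linear_into_L2 :: "('u::real_vector \<Rightarrow> real \<Rightarrow> real) \<Rightarrow> bool" where
  "linear_into_L2 \<Phi> \<longleftrightarrow> (\<forall>h. torus_L2 (\<Phi> h)) \<and>
     (\<forall>a b h h'. AE x in lborel. \<Phi> (a *\<^sub>R h + b *\<^sub>R h') x = a * \<Phi> h x + b * \<Phi> h' x)"

definition noise ::
    "('u \<Rightarrow> real \<Rightarrow> real) \<Rightarrow> (nat \<Rightarrow> 'u) \<Rightarrow> (nat \<Rightarrow> real \<Rightarrow> 'a \<Rightarrow> real) \<Rightarrow>
     real \<Rightarrow> 'a \<Rightarrow> real \<Rightarrow> real" where
  "noise \<Phi> g \<beta> t \<omega> x = (\<Sum>k. \<Phi> (g k) x * \<beta> k t \<omega>)"

text \<open>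
  \<open>\<Omega>\<^sub>s\<close> is an event of probability one on which \<open>\<Phi>W(t) = \<Sum>\<^sub>k \<sigma>\<^sub>k \<beta>\<^sub>k(t)\<close> converges in
  \<open>H\<^sup>s\<^sup>+\<^sup>1\<close> for every \<open>t\<close> and \<open>\<Phi>W\<close> is continuous with values in \<open>H\<^sup>s\<^sup>+\<^sup>1\<close>.
\<close>

definition regular_noise_event ::
    "'a measure \<Rightarrow> ('u \<Rightarrow> real \<Rightarrow> real) \<Rightarrow> (nat \<Rightarrow> 'u) \<Rightarrow> (nat \<Rightarrow> real \<Rightarrow> 'a \<Rightarrow> real) \<Rightarrow>
     real \<Rightarrow> 'a set \<Rightarrow> bool" where
  "regular_noise_event M \<Phi> g \<beta> s \<Omega>s \<longleftrightarrow>
     \<Omega>s \<in> sets M \<and> measure M \<Omega>s = 1 \<and>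
     (\<forall>\<omega>\<in>\<Omega>s.
        (\<forall>t\<ge>0. (\<lambda>n. sobolev_norm (s + 1)
            (\<lambda>x. (\<Sum>k<n. \<Phi> (g k) x * \<beta> k t \<omega>) - noise \<Phi> g \<beta> t \<omega> x)) \<longlonglongrightarrow> 0) \<and>
        (\<forall>T>0. sobolev_path_continuous (s + 1) {0..T} (\<lambda>t. noise \<Phi> g \<beta> t \<omega>)))"

definition predictable_sigma ::
    "'a set \<Rightarrow> (ennreal \<Rightarrow> 'a measure) \<Rightarrow> (real \<times> 'a) measure" where
  "predictable_sigma \<Omega> F = sigma ({0..} \<times> \<Omega>)
     ({{0} \<times> A | A. A \<in> sets (F 0)} \<union>
      {{a<..b} \<times> A | a b A. 0 \<le> a \<and> a < b \<and> A \<in> sets (F (ennreal a))})"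

definition predictable ::
    "'a set \<Rightarrow> (ennreal \<Rightarrow> 'a measure) \<Rightarrow> (real \<Rightarrow> 'a \<Rightarrow> real) \<Rightarrow> bool" where
  "predictable \<Omega> F X \<longleftrightarrow> (\<lambda>(t, \<omega>). X t \<omega>) \<in> borel_measurable (predictable_sigma \<Omega> F)"

section \<open>Regular solutions\<close>

text \<open>
  \<open>c(v) (c(v) v\<^sub>x)\<^sub>x\<close> with classical derivatives: it is applied to \<open>v \<in> H\<^sup>s\<^sup>+\<^sup>1\<close> with
  \<open>s > 3/2\<close> given by its continuous representative, which is \<open>C\<^sup>2\<close>.
\<close>

definition wave_op :: "(real \<Rightarrow> real) \<Rightarrow> (real \<Rightarrow> real) \<Rightarrow> real \<Rightarrow> real" where
  "wave_op c v x = c (v x) * deriv (\<lambda>y. c (v y) * deriv v y) x"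

definition lifetime :: "ennreal \<Rightarrow> real set" where
  "lifetime T = {t. 0 \<le> t \<and> ennreal t < T}"

text \<open>
  Below, \<open>u\<close> is the process, only its values for \<open>t < \<tau>\<close> being relevant, and \<open>ut\<close> is its
  time derivative.
\<close>

definition equation_at ::
    "real \<Rightarrow> (real \<Rightarrow> real) \<Rightarrow> (real \<Rightarrow> real) \<Rightarrow> (real \<Rightarrow> 'a \<Rightarrow> real \<Rightarrow> real) \<Rightarrow>
     (real \<Rightarrow> 'a \<Rightarrow> real \<Rightarrow> real) \<Rightarrow> (real \<Rightarrow> 'a \<Rightarrow> real \<Rightarrow> real) \<Rightarrow> real \<Rightarrow> 'a \<Rightarrow> bool" where
  "equation_at s c v0 N u ut t \<omega> \<longleftrightarrow>
     (\<exists>I. has_sobolev_integral (s - 1) (\<lambda>r. wave_op c (u r \<omega>)) I t \<and>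
          (AE x in lborel. ut t \<omega> x = v0 x + I x + N t \<omega> x))"

definition exit_time ::
    "(real \<Rightarrow> 'a \<Rightarrow> real \<Rightarrow> real) \<Rightarrow> (real \<Rightarrow> 'a \<Rightarrow> real \<Rightarrow> real) \<Rightarrow> ('a \<Rightarrow> ennreal) \<Rightarrow>
     nat \<Rightarrow> 'a \<Rightarrow> ennreal" where
  "exit_time u ut \<tau> n \<omega> =
     (let S = {t \<in> lifetime (\<tau> \<omega>).
                 esssup lborel (\<lambda>x. ereal (norm (ut t \<omega> x, deriv (u t \<omega>) x))) > ereal (real n)}
      in if S = {} then \<tau> \<omega> else Inf (ennreal ` S))"

text \<open>
  The process \<open>u(t \<and> \<tau>')\<close> is defined only where \<open>\<tau>' < \<tau>\<close>, hence almost surely; its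
  predictability is understood up to indistinguishability.

  Applied to \<open>t \<and> \<tau>'\<close>, the identity at stopping times \<open>\<tau>' < \<tau>\<close> a.s. gives the equation on all
  of \<open>[0,\<tau>)\<close> as soon as \<open>\<tau>\<close> is the limit of such stopping times, as explosion times are.
  In a general filtration a stopping time \<open>\<tau>\<close> (say, an independent exponential clock) may
  have no stopping times \<open>0 < \<tau>' < \<tau>\<close> at all, so the equation on \<open>[0,\<tau>)\<close>
  is also required explicitly, in the last but one conjunct.
\<close>

definition regular_solution ::
    "'a measure \<Rightarrow> (ennreal \<Rightarrow> 'a measure) \<Rightarrow> 'a set \<Rightarrow> real \<Rightarrow> (real \<Rightarrow> real) \<Rightarrow>
     (real \<Rightarrow> 'a \<Rightarrow> real \<Rightarrow> real) \<Rightarrow> (real \<Rightarrow> real) \<Rightarrow> (real \<Rightarrow> real) \<Rightarrow>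
     (real \<Rightarrow> 'a \<Rightarrow> real \<Rightarrow> real) \<Rightarrow> (real \<Rightarrow> 'a \<Rightarrow> real \<Rightarrow> real) \<Rightarrow> ('a \<Rightarrow> ennreal) \<Rightarrow> bool" where
  "regular_solution M F \<Omega>s s c N u0 v0 u ut \<tau> \<longleftrightarrow>
     stopping_time F \<tau> \<and> (AE \<omega> in M. 0 < \<tau> \<omega>) \<and>
     (AE \<omega> in M.
        (\<forall>t\<in>lifetime (\<tau> \<omega>). torus_C (u t \<omega>)) \<and>
        sobolev_path_continuous (s + 1) (lifetime (\<tau> \<omega>)) (\<lambda>t. u t \<omega>) \<and>
        sobolev_path_deriv s (lifetime (\<tau> \<omega>)) (\<lambda>t. u t \<omega>) (\<lambda>t. ut t \<omega>) \<and>
        sobolev_path_continuous s (lifetime (\<tau> \<omega>)) (\<lambda>t. ut t \<omega>)) \<and>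
     (AE \<omega> in M. u 0 \<omega> = u0) \<and>
     (\<forall>\<tau>'. stopping_time F \<tau>' \<and> (AE \<omega> in M. \<tau>' \<omega> < \<tau> \<omega>) \<longrightarrow>
        (\<forall>x. \<exists>X. predictable (space M) F X \<and>
               (AE \<omega> in M. \<forall>t\<ge>0. X t \<omega> = u (enn2real (min (ennreal t) (\<tau>' \<omega>))) \<omega> x)) \<and>
        (\<forall>\<omega>\<in>\<Omega>s. \<tau>' \<omega> < \<tau> \<omega> \<longrightarrow> equation_at s c v0 N u ut (enn2real (\<tau>' \<omega>)) \<omega>)) \<and>
     (AE \<omega> in M. \<forall>t\<in>lifetime (\<tau> \<omega>). equation_at s c v0 N u ut t \<omega>) \<and>
     (AE \<omega> in M. \<tau> \<omega> = (SUP n\<in>{1..}. exit_time u ut \<tau> n \<omega>))"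

end

theory Submission
  imports Defs
begin

text \<open>
  For almost every fixed \<open>\<omega>\<close>, subtracting the noise path \<open>w = \<Phi>W\<close>, which is \<open>C\<^sup>1\<close> in \<open>x\<close>,
  turns the equation into a perturbed wave equation for \<open>u\<close> and \<open>y = u\<^sub>t - w\<close>, so the blow-up
  argument is deterministic.  With \<open>p = u\<^sub>x\<close>, follow the left-going characteristic
  \<open>X' = - c(u(t,X))\<close> and put \<open>r = y + c p\<close>, \<open>\<sigma> = y - c p\<close> along it.  Then
  \<open>r' = c'/(4c) (r\<^sup>2 - \<sigma>\<^sup>2)\<close> up to lower order terms, the energy bounds \<open>\<integral> \<sigma>\<^sup>2 dt\<close>, and this in
  turn keeps \<open>u(t,X)\<close> close to \<open>u\<^sup>\<star>\<close>, where \<open>c'\<close> has a sign.  Hence \<open>\<plusminus>r\<close> satisfies a Riccati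
  inequality and explodes before any prescribed time \<open>T\<close> as soon as the initial slope at one point
  is large enough, while the initial energy stays at most of order one.  The time \<open>T\<close> and the size
  of the slope are uniform on the event that \<open>w\<close> and \<open>w\<^sub>x\<close> are bounded by \<open>1\<close> on \<open>[0,T]\<close>, whose
  probability tends to \<open>1\<close> as \<open>T \<rightarrow> 0\<close>.
\<close>

section \<open>Fourier series of continuous periodic functions\<close>

text \<open>The noise is in general not differentiable in time, so neither is u_t; only the
  difference y is C^1 in time, and this makes differential equations along characteristics
  available. Two obstacles shape the estimates. The term -\<sigma>^2 in the Riccati equation can
  compete with r^2, and \<sigma> is transported along the other family of characteristics, so no
  pointwise bound on it is at hand; but its square is the energy flux through the curve X, hence
  integrable in time with a bound that does not see the slope of the datum. The sign of c' is known
  only near u*, and the same integral controls the drift of u(t,X), whose time derivative is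
  \<sigma> + w. A steep slope at one point costs arbitrarily little energy, because an L^2 norm does
  not see points. The order of choices matters: the small-noise event and its time window depend on
  the noise alone, T is fixed next, the slope is of order 1/T, and one datum with that slope serves
  all paths in the event. A path in it that outlives \<epsilon>^\<gamma> would be a classical
  solution on [0,T], which the Riccati argument rules out.\<close>

text \<open>The frequencies are enumerated by \<open>int_decode\<close>, so that Fourier series are series over \<open>nat\<close>.\<close>

definition freq :: "nat \<Rightarrow> real" where
  "freq n = 2 * pi * real_of_int (int_decode n)"

text \<open>Real parts are taken term by term, so the sum is real for any coefficient sequence and
  no conjugate symmetry has to be carried along.\<close>

definition fourier_sum :: "(nat \<Rightarrow> complex) \<Rightarrow> real \<Rightarrow> real" where
  "fourier_sum a x = (\<Sum>n. Re (a n * cis (freq n * x)))"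

definition deriv_coeff :: "(nat \<Rightarrow> complex) \<Rightarrow> nat \<Rightarrow> complex" where
  "deriv_coeff a n = \<i> * of_real (freq n) * a n"

definition fcoeff :: "(real \<Rightarrow> real) \<Rightarrow> nat \<Rightarrow> complex" where
  "fcoeff f n = fourier_coeff f (int_decode n)"

lemma summable_fourier_sum_terms:
  assumes "summable (\<lambda>n. cmod (a n))"
  shows "summable (\<lambda>n. Re (a n * cis (freq n * x)))"
proof (rule summable_comparison_test'[OF assms])
  show "norm (Re (a n * cis (freq n * x))) \<le> cmod (a n)" if "n \<ge> 0" for n
    using abs_Re_le_cmod[of "a n * cis (freq n * x)"] by (simp add: norm_mult)
qed

lemma abs_fourier_sum_le:
  assumes "summable (\<lambda>n. cmod (a n))"
  shows "\<bar>fourier_sum a x\<bar> \<le> (\<Sum>n. cmod (a n))"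
proof -
  have *: "\<bar>Re (a n * cis (freq n * x))\<bar> \<le> cmod (a n)" for n
    using abs_Re_le_cmod[of "a n * cis (freq n * x)"] by (simp add: norm_mult)
  have s: "summable (\<lambda>n. \<bar>Re (a n * cis (freq n * x))\<bar>)"
    by (rule summable_comparison_test'[OF assms]) (use * in auto)
  have "\<bar>fourier_sum a x\<bar> \<le> (\<Sum>n. \<bar>Re (a n * cis (freq n * x))\<bar>)"
    unfolding fourier_sum_def by (rule summable_rabs[OF s])
  also have "\<dots> \<le> (\<Sum>n. cmod (a n))"
    by (rule suminf_le[OF * s assms])
  finally show ?thesis .
qed

lemma fourier_sum_add:
  assumes "summable (\<lambda>n. cmod (a n))" "summable (\<lambda>n. cmod (b n))"
  shows "fourier_sum (\<lambda>n. a n + b n) x = fourier_sum a x + fourier_sum b x"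
  unfolding fourier_sum_def suminf_add[OF summable_fourier_sum_terms[OF assms(1)] summable_fourier_sum_terms[OF assms(2)]]
  by (simp add: ring_distribs)

lemma fourier_sum_diff:
  assumes "summable (\<lambda>n. cmod (a n))" "summable (\<lambda>n. cmod (b n))"
  shows "fourier_sum (\<lambda>n. a n - b n) x = fourier_sum a x - fourier_sum b x"
  unfolding fourier_sum_def suminf_diff[OF summable_fourier_sum_terms[OF assms(1)] summable_fourier_sum_terms[OF assms(2)]]
  by (simp add: ring_distribs)

lemma fourier_sum_scale:
  assumes "summable (\<lambda>n. cmod (a n))"
  shows "fourier_sum (\<lambda>n. of_real r * a n) x = r * fourier_sum a x"
  unfolding fourier_sum_def suminf_mult[OF summable_fourier_sum_terms[OF assms], symmetric]
  by (simp add: mult.assoc)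

lemma continuous_on_fourier_sum:
  assumes "summable (\<lambda>n. cmod (a n))"
  shows "continuous_on UNIV (fourier_sum a)"
proof -
  have "uniform_limit UNIV (\<lambda>n x. \<Sum>i<n. Re (a i * cis (freq i * x))) (fourier_sum a) sequentially"
    unfolding fourier_sum_def[abs_def]
  proof (rule Weierstrass_m_test[OF _ assms])
    show "norm (Re (a n * cis (freq n * x))) \<le> cmod (a n)" for n x
      using abs_Re_le_cmod[of "a n * cis (freq n * x)"] by (simp add: norm_mult)
  qed
  moreover have "continuous_on UNIV (\<lambda>x. \<Sum>i<n. Re (a i * cis (freq i * x)))" for n
    by (intro continuous_intros)
  ultimately show ?thesis
    by (intro uniform_limit_theorem[where F=sequentially]) auto
qed

lemma cis_freq_period: "cis (freq n * (x + 1)) = cis (freq n * x)"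
proof -
  have "cis (freq n * (x + 1)) = cis (freq n * x) * cis (2 * pi * real_of_int (int_decode n))"
    by (simp add: cis_mult freq_def algebra_simps)
  then show ?thesis by (simp add: cis_multiple_2pi)
qed

lemma fourier_sum_periodic: "fourier_sum a (x + 1) = fourier_sum a x"
  by (simp add: fourier_sum_def cis_freq_period)

lemma has_real_derivative_fourier_sum:
  assumes "summable (\<lambda>n. cmod (a n))" "summable (\<lambda>n. cmod (deriv_coeff a n))"
  shows "(fourier_sum a has_real_derivative fourier_sum (deriv_coeff a) x) (at x)"
proof -
  have "uniform_limit UNIV (\<lambda>n x. \<Sum>i<n. Re (deriv_coeff a i * cis (freq i * x))) (fourier_sum (deriv_coeff a)) sequentially"
    unfolding fourier_sum_def[abs_def]
  proof (rule Weierstrass_m_test[OF _ assms(2)])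
    show "norm (Re (deriv_coeff a n * cis (freq n * x))) \<le> cmod (deriv_coeff a n)" for n x
      using abs_Re_le_cmod[of "deriv_coeff a n * cis (freq n * x)"] by (simp add: norm_mult)
  qed
  then have u: "uniformly_convergent_on UNIV (\<lambda>n x. \<Sum>i<n. Re (deriv_coeff a i * cis (freq i * x)))"
    by (auto simp: uniformly_convergent_on_def)
  have d: "((\<lambda>x. Re (a n * cis (freq n * x))) has_field_derivative Re (deriv_coeff a n * cis (freq n * x)))
        (at x within UNIV)" for n x
    unfolding deriv_coeff_def by (auto intro!: derivative_eq_intros simp: algebra_simps)
  show ?thesis
    unfolding fourier_sum_def[abs_def]
    by (rule has_field_derivative_series'(2)[OF convex_UNIV d u UNIV_I summable_fourier_sum_terms[OF assms(1)]])
       simp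
qed

section \<open>Uniqueness of Fourier coefficients\<close>

lemma has_integral_cis:
  "((\<lambda>x. cis (2 * pi * real_of_int k * x)) has_integral (if k = 0 then 1 else 0)) {0..1}"
proof (cases "k = 0")
  case True
  then show ?thesis using has_integral_const_real[of "1::complex" 0 1] by simp
next
  case False
  define r where "r = 2 * pi * real_of_int k"
  have r: "r \<noteq> 0" using False by (simp add: r_def)
  have "((\<lambda>x. cis (r * x)) has_integral (cis (r * 1) / (\<i> * of_real r) - cis (r * 0) / (\<i> * of_real r))) {0..1}"
  proof (rule fundamental_theorem_of_calculus)
    show "((\<lambda>x. cis (r * x) / (\<i> * of_real r)) has_vector_derivative cis (r * x)) (at x within {0..1})" for x
      unfolding has_vector_derivative_def
      by (rule derivative_eq_intros refl | simp add: r)+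
         (use r in \<open>auto simp: fun_eq_iff scaleR_conv_of_real field_simps\<close>)
  qed simp
  moreover have "cis (r * 1) = 1" by (simp add: r_def cis_multiple_2pi)
  ultimately show ?thesis using False by (simp add: r_def)
qed

text \<open>Complex trigonometric polynomials, generated by monomials and sums so that orthogonality
  to every character extends to them by induction. Closure under products lets polynomials on the
  circle be rewritten in this form.\<close>

inductive trig_poly :: "(real \<Rightarrow> complex) \<Rightarrow> bool" where
  monom: "trig_poly (\<lambda>x. b * cis (2 * pi * real_of_int k * x))"
| add: "trig_poly f \<Longrightarrow> trig_poly h \<Longrightarrow> trig_poly (\<lambda>x. f x + h x)"

lemma trig_poly_mult:
  assumes "trig_poly f" "trig_poly h"
  shows "trig_poly (\<lambda>x. f x * h x)"
  using assms
proof (induction f)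
  case (monom b k)
  from monom show ?case
  proof (induction h)
    case (monom b' k')
    have "trig_poly (\<lambda>x. (b * b') * cis (2 * pi * real_of_int (k + k') * x))" by (rule trig_poly.monom)
    also have "(\<lambda>x. (b * b') * cis (2 * pi * real_of_int (k + k') * x)) =
      (\<lambda>x. (b * cis (2 * pi * real_of_int k * x)) * (b' * cis (2 * pi * real_of_int k' * x)))"
      by (auto simp: fun_eq_iff cis_mult[symmetric] algebra_simps)
    finally show ?case .
  next
    case (add f h)
    from trig_poly.add[OF add.IH] show ?case by (simp add: algebra_simps)
  qed
next
  case (add f h')
  from trig_poly.add[OF add.IH[OF add.prems]] show ?case by (simp add: algebra_simps)
qed

lemma trig_poly_real_polynomial:
  assumes "real_polynomial_function p"
  shows "trig_poly (\<lambda>x. of_real (p (cis (2 * pi * x))))"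
  using assms
proof induction
  case (linear f)
  then interpret bounded_linear f .
  \<comment> \<open>From cos = (e^{it} + e^{-it})/2 and sin = (e^{it} - e^{-it})/(2i), inserted into
    the real-linear \<open>f\<close>.\<close>
  let ?a = "(of_real (f 1) - \<i> * of_real (f \<i>)) / 2" and ?b = "(of_real (f 1) + \<i> * of_real (f \<i>)) / 2"
  have f: "f z = Re z * f 1 + Im z * f \<i>" for z
  proof -
    have "z = Re z *\<^sub>R 1 + Im z *\<^sub>R \<i>" by (simp add: complex_eq_iff)
    then show ?thesis by (metis add scale real_scaleR_def)
  qed
  have "trig_poly (\<lambda>x. ?a * cis (2 * pi * real_of_int 1 * x) + ?b * cis (2 * pi * real_of_int (-1) * x))"
    by (intro trig_poly.intros)
  also have "(\<lambda>x. ?a * cis (2 * pi * real_of_int 1 * x) + ?b * cis (2 * pi * real_of_int (-1) * x)) =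
      (\<lambda>x. of_real (f (cis (2 * pi * x))))"
    by (subst f) (auto simp: fun_eq_iff complex_eq_iff field_simps)
  finally show ?case .
next
  case (const c)
  have "trig_poly (\<lambda>x. of_real c * cis (2 * pi * real_of_int 0 * x))" by (rule trig_poly.monom)
  then show ?case by simp
next
  case (add f g)
  then show ?case by (simp add: trig_poly.add)
next
  case (mult f g)
  then show ?case by (simp add: trig_poly_mult)
qed

lemma has_integral_mult_trig_poly:
  assumes "trig_poly q"
    and "\<And>k. ((\<lambda>x. g x * cis (2 * pi * real_of_int k * x)) has_integral 0) {0..1}"
  shows "((\<lambda>x. g x * q x) has_integral 0) {0..1}"
  using assms(1)
proof induction
  case (monom b k)
  from has_integral_mult_right[OF assms(2)[of k], of b] show ?case by (simp add: algebra_simps)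
next
  case (add f h)
  from has_integral_add[OF add.IH] show ?case by (simp add: algebra_simps)
qed

text \<open>A continuous 1-periodic function descends to the unit circle because \<open>cis\<close> maps compact
  sets to closed sets.\<close>

lemma periodic_factor_circle:
  fixes G :: "real \<Rightarrow> real"
  assumes "continuous_on UNIV G" "G 0 = G 1"
  obtains H where "continuous_on (sphere 0 1) H" "\<And>x. x \<in> {0..1} \<Longrightarrow> H (cis (2 * pi * x)) = G x"
proof -
  define H where "H z = G (Arg2pi z / (2 * pi))" for z
  have H: "H (cis (2 * pi * x)) = G x" if "x \<in> {0..1}" for x
  proof (cases "x = 1")
    case True
    then show ?thesis using assms(2) Arg2pi_of_real[of 1] by (simp add: H_def)
  next
    case False
    have "Arg2pi (cis (2 * pi * x)) = 2 * pi * x"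
      using that False by (intro Arg2pi_unique[where r=1]) (auto simp: cis_conv_exp)
    then show ?thesis by (simp add: H_def)
  qed
  have sph: "z \<in> (\<lambda>x. cis (2 * pi * x)) ` {0..1}" if "z \<in> sphere 0 1" for z
  proof
    show "z = cis (2 * pi * (Arg2pi z / (2 * pi)))"
      using Arg2pi_eq[of z] that by (simp add: cis_conv_exp)
    show "Arg2pi z / (2 * pi) \<in> {0..1}" using Arg2pi[of z] by (auto simp: field_simps)
  qed
  have "continuous_on (sphere 0 1) H"
  proof (subst continuous_on_closed_vimage[OF closed_sphere], intro allI impI)
    fix B :: "real set" assume B: "closed B"
    have "H -` B \<inter> sphere 0 1 = (\<lambda>x. cis (2 * pi * x)) ` ({0..1} \<inter> G -` B)"
    proof (intro equalityI subsetI)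
      fix z assume z: "z \<in> H -` B \<inter> sphere 0 1"
      then obtain x where x: "x \<in> {0..1}" "z = cis (2 * pi * x)" using sph by blast
      then show "z \<in> (\<lambda>x. cis (2 * pi * x)) ` ({0..1} \<inter> G -` B)" using z H by auto
    next
      fix z assume "z \<in> (\<lambda>x. cis (2 * pi * x)) ` ({0..1} \<inter> G -` B)"
      then show "z \<in> H -` B \<inter> sphere 0 1" using H by auto
    qed
    moreover have "compact ({0..1::real} \<inter> G -` B)"
    proof (rule compact_Int_closed)
      show "closed (G -` B)" using assms(1) B continuous_on_closed_vimage[of UNIV G] by auto
    qed simp
    then have "compact ((\<lambda>x. cis (2 * pi * x)) ` ({0..1} \<inter> G -` B))"
      by (intro compact_continuous_image continuous_intros)
    ultimately show "closed (H -` B \<inter> sphere 0 1)" by (simp add: compact_imp_closed)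
  qed
  with H that show ?thesis by blast
qed

text \<open>Stone-Weierstrass on the circle gives a real trigonometric polynomial \<open>P\<close>
  within \<open>e\<close> of \<open>G\<close>, the real part of \<open>g\<close>. As
  \<open>P\<close> is real, the hypothesis makes the integral of \<open>G * P\<close> vanish, so the
  integral of \<open>G * G\<close> equals that of \<open>G * (G - P)\<close> and is at most
  \<open>e * N\<close>.\<close>

lemma zero_if_fourier_zero:
  fixes g :: "real \<Rightarrow> complex"
  assumes cont: "continuous_on UNIV g" and per: "g 0 = g 1"
    and zero: "\<And>k. ((\<lambda>x. g x * cis (2 * pi * real_of_int k * x)) has_integral 0) {0..1}"
    and x: "x \<in> {0..1}"
  shows "Re (g x) = 0"
proof -
  define G where "G x = Re (g x)" for x
  have cG: "continuous_on UNIV G" unfolding G_def using cont by (intro continuous_intros)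
  have cG': "continuous_on A G" for A using cG continuous_on_subset by blast
  obtain H where H: "continuous_on (sphere 0 1) H" "\<And>x. x \<in> {0..1} \<Longrightarrow> H (cis (2 * pi * x)) = G x"
    using periodic_factor_circle[OF cG] per by (auto simp: G_def)
  define N where "N = integral {0..1} (\<lambda>x. \<bar>G x\<bar>)"
  have N0: "N \<ge> 0" unfolding N_def by (intro integral_nonneg integrable_continuous_real continuous_intros cG') auto
  have iG: "(\<lambda>x. G x * G x) integrable_on {0..1}"
    by (intro integrable_continuous_real continuous_intros cG')
  have le: "integral {0..1} (\<lambda>x. G x * G x) \<le> e * N" if "e > 0" for e
  proof -
    obtain p where p: "real_polynomial_function p" "\<And>z. z \<in> sphere 0 1 \<Longrightarrow> \<bar>H z - p z\<bar> < e"
      using Stone_Weierstrass_real_polynomial_function[OF compact_sphere H(1) \<open>e > 0\<close>] by metis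
    define P where "P x = p (cis (2 * pi * x))" for x
    have "((\<lambda>x. Re (g x * of_real (P x))) has_integral Re 0) {0..1}"
      unfolding P_def
      by (intro has_integral_Re has_integral_mult_trig_poly[OF trig_poly_real_polynomial[OF p(1)] zero])
    then have 0: "((\<lambda>x. G x * P x) has_integral 0) {0..1}" by (simp add: G_def)
    have "((\<lambda>x. G x * G x - G x * P x) has_integral integral {0..1} (\<lambda>x. G x * G x) - 0) {0..1}"
      by (intro has_integral_diff 0 integrable_integral iG)
    moreover have "((\<lambda>x. e * \<bar>G x\<bar>) has_integral (e * N)) {0..1}" unfolding N_def
      by (intro has_integral_mult_right integrable_integral integrable_continuous_real continuous_intros cG')
    moreover have "G x * G x - G x * P x \<le> e * \<bar>G x\<bar>" if "x \<in> {0..1}" for x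
    proof -
      have "\<bar>G x - P x\<bar> < e" using p(2)[of "cis (2 * pi * x)"] H(2)[OF that] by (simp add: P_def)
      then have "\<bar>G x\<bar> * \<bar>G x - P x\<bar> \<le> \<bar>G x\<bar> * e" by (intro mult_left_mono) auto
      then show ?thesis by (simp add: right_diff_distrib[symmetric] abs_mult[symmetric] mult.commute)
    qed
    ultimately show ?thesis by (auto dest: has_integral_le)
  qed
  have "integral {0..1} (\<lambda>x. G x * G x) \<le> 0"
  proof (rule field_le_epsilon)
    fix e :: real assume "e > 0"
    then have "integral {0..1} (\<lambda>x. G x * G x) \<le> e / (N + 1) * N" using N0 by (intro le) auto
    also have "\<dots> \<le> e" using N0 \<open>e > 0\<close> by (simp add: field_simps)
    finally show "integral {0..1} (\<lambda>x. G x * G x) \<le> 0 + e" by simp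
  qed
  moreover have "integral {0..1} (\<lambda>x. G x * G x) \<ge> 0" by (intro integral_nonneg iG) auto
  ultimately have "((\<lambda>x. G x * G x) has_integral 0) (cbox 0 1)"
    using integrable_integral[OF iG] by simp
  then have "G x * G x = 0"
    by (rule has_integral_0_cbox_imp_0[rotated 2]) (use x in \<open>auto intro!: continuous_intros cG'\<close>)
  then show ?thesis by (simp add: G_def)
qed

lemma fourier_coeff_has_integral:
  assumes "continuous_on UNIV f"
  shows "((\<lambda>x. f x *\<^sub>R cis (- 2 * pi * real_of_int k * x)) has_integral fourier_coeff f k) {0..1}"
proof -
  have "set_integrable lborel {0..1} (\<lambda>x. f x *\<^sub>R cis (- 2 * pi * real_of_int k * x))"
    unfolding set_integrable_def
    by (intro borel_integrable_compact continuous_intros continuous_on_subset[OF assms]) auto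
  from set_borel_integral_eq_integral[OF this] show ?thesis
    unfolding fourier_coeff_def by (simp add: has_integral_integrable_integral)
qed

text \<open>The Fourier series converges uniformly, so its coefficients can be computed term by term
  and agree with those of \<open>f\<close>; the difference \<open>g\<close> has only zero
  coefficients, and its real part vanishes. The equality holds at every point, which identifies a
  continuous function with its Fourier representative.\<close>

lemma fourier_sum_fcoeff:
  assumes "torus_C f" "summable (\<lambda>n. cmod (fcoeff f n))"
  shows "f x = fourier_sum (fcoeff f) x"
proof -
  have cf: "continuous_on A f" for A using assms(1) continuous_on_subset by (auto simp: torus_C_def)
  have pf: "f (x + 1) = f x" for x using assms(1) by (auto simp: torus_C_def periodic1_def)
  define F where "F x = (\<Sum>n. fcoeff f n * cis (freq n * x))" for x
  have sF: "summable (\<lambda>n. fcoeff f n * cis (freq n * x))" for x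
    by (rule summable_norm_cancel) (simp add: norm_mult assms(2))
  have u: "uniform_limit UNIV (\<lambda>n x. \<Sum>i<n. fcoeff f i * cis (freq i * x)) F sequentially"
    unfolding F_def[abs_def] by (rule Weierstrass_m_test[OF _ assms(2)]) (simp add: norm_mult)
  have cF: "continuous_on UNIV F"
    by (rule uniform_limit_theorem[OF _ u]) (auto intro!: always_eventually continuous_intros)
  have ReF: "Re (F x) = fourier_sum (fcoeff f) x" for x
    unfolding F_def fourier_sum_def using bounded_linear.suminf[OF bounded_linear_Re sF] by simp
  define g where "g x = of_real (f x) - F x" for x
  have gper: "g (x + 1) = g x" for x by (simp add: g_def pf F_def cis_freq_period)
  have zero: "((\<lambda>x. g x * cis (2 * pi * real_of_int k * x)) has_integral 0) {0..1}" for k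
  proof -
    \<comment> \<open>Integrating against the exponential of frequency \<open>k\<close> picks out
      the coefficient at \<open>- k\<close>, because \<open>fourier_coeff\<close> carries the
      conjugate exponential.\<close>
    define m where "m = int_encode (- k)"
    have m: "int_decode m = - k" by (simp add: m_def)
    have "compact (F ` {0..1})" "compact ((\<lambda>x. cis (2 * pi * real_of_int k * x)) ` {0..1})"
      by (intro compact_continuous_image continuous_intros continuous_on_subset[OF cF] subset_UNIV compact_Icc)+
    then have "uniform_limit {0..1} (\<lambda>n x. (\<Sum>i<n. fcoeff f i * cis (freq i * x)) * cis (2 * pi * real_of_int k * x))
        (\<lambda>x. F x * cis (2 * pi * real_of_int k * x)) sequentially"
      by (intro uniform_lim_mult uniform_limit_on_subset[OF u] uniform_limit_const)
         (auto intro: compact_imp_bounded)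
    then obtain I J where IJ:
      "\<And>n. ((\<lambda>x. (\<Sum>i<n. fcoeff f i * cis (freq i * x)) * cis (2 * pi * real_of_int k * x)) has_integral I n) {0..1}"
      "((\<lambda>x. F x * cis (2 * pi * real_of_int k * x)) has_integral J) {0..1}" "I \<longlonglongrightarrow> J"
      by (rule uniform_limit_integral) (auto intro!: continuous_intros)
    \<comment> \<open>By orthogonality the integrals of the partial sums are constant once the index
      \<open>m\<close> is included.\<close>
    have In: "I n = fcoeff f m" if "n > m" for n
    proof -
      have "((\<lambda>x. \<Sum>i<n. fcoeff f i * cis (2 * pi * real_of_int (int_decode i + k) * x)) has_integral
          (\<Sum>i<n. fcoeff f i * (if int_decode i + k = 0 then 1 else 0))) {0..1}"
        by (intro has_integral_sum has_integral_mult_right has_integral_cis) auto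
      also have "(\<lambda>x. \<Sum>i<n. fcoeff f i * cis (2 * pi * real_of_int (int_decode i + k) * x)) =
         (\<lambda>x. (\<Sum>i<n. fcoeff f i * cis (freq i * x)) * cis (2 * pi * real_of_int k * x))"
        unfolding sum_distrib_right mult.assoc cis_mult freq_def
        by (rule ext, rule sum.cong[OF refl], rule arg_cong2[where f="(*)", OF refl],
            rule arg_cong[where f=cis]) (simp add: algebra_simps)
      also have "(\<Sum>i<n. fcoeff f i * (if int_decode i + k = 0 then 1 else 0)) =
          (\<Sum>i<n. if i = m then fcoeff f m else 0)"
      proof (intro sum.cong refl)
        fix i
        have "int_decode i + k = 0 \<longleftrightarrow> int_decode i = int_decode m" by (auto simp: m)
        then have "int_decode i + k = 0 \<longleftrightarrow> i = m" by (simp only: int_decode_eq)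
        then show "fcoeff f i * (if int_decode i + k = 0 then 1 else 0) = (if i = m then fcoeff f m else 0)"
          by simp
      qed
      also have "\<dots> = fcoeff f m" using that by simp
      finally show ?thesis using IJ(1) has_integral_unique by blast
    qed
    have "I \<longlonglongrightarrow> fcoeff f m"
      by (rule tendsto_eventually) (use In in \<open>auto simp: eventually_sequentially intro!: exI[of _ "Suc m"]\<close>)
    then have J: "J = fcoeff f m" using IJ(3) LIMSEQ_unique by blast
    have "((\<lambda>x. f x *\<^sub>R cis (- 2 * pi * real_of_int (- k) * x)) has_integral fcoeff f m) {0..1}"
      using fourier_coeff_has_integral[OF cf, of "- k"] by (simp add: fcoeff_def m)
    from has_integral_diff[OF this IJ(2)[unfolded J]] show ?thesis
      by (simp add: g_def left_diff_distrib scaleR_conv_of_real)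
  qed
  have g0: "Re (g x) = 0" if "x \<in> {0..1}" for x
    by (rule zero_if_fourier_zero[OF _ _ zero that])
       (use gper[of 0] in \<open>auto simp: g_def intro!: continuous_intros cf cF\<close>)
  have "Re (g x) = Re (g (frac x))"
  proof -
    have per: "g (y + real_of_int k) = g y" for y k
    proof (induction k rule: int_induct[where k=0])
      case (step1 i) then show ?case using gper[of "y + real_of_int i"] by (simp add: algebra_simps)
    next
      case (step2 i) then show ?case using gper[of "y + real_of_int i - 1"] by (simp add: algebra_simps)
    qed simp
    show ?thesis using per[of "frac x" "\<lfloor>x\<rfloor>"] by (simp add: frac_def)
  qed
  also have "\<dots> = 0" by (rule g0) (use frac_ge_0[of x] frac_lt_1[of x] in auto)
  finally show ?thesis by (simp add: g_def ReF)
qed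

section \<open>Sobolev embedding\<close>

text \<open>The squared Japanese bracket 1 + k^2 at the frequency with index \<open>n\<close>; the
  factor 2 pi of \<open>freq\<close> is left out, as in \<open>sobolev_weight\<close>.\<close>

definition bracket :: "nat \<Rightarrow> real" where
  "bracket n = 1 + (real_of_int (int_decode n))\<^sup>2"

lemma bracket_ge_1: "bracket n \<ge> 1" by (simp add: bracket_def)

lemma sobolev_weight_decode: "sobolev_weight r f (int_decode n) = bracket n powr r * (cmod (fcoeff f n))\<^sup>2"
  by (simp add: sobolev_weight_def bracket_def fcoeff_def)

lemma sobolev_iff:
  "sobolev r f \<longleftrightarrow> torus_L2 f \<and> summable (\<lambda>n. bracket n powr r * (cmod (fcoeff f n))\<^sup>2)"
proof -
  have "sobolev_weight r f summable_on UNIV \<longleftrightarrow> (\<lambda>n. sobolev_weight r f (int_decode n)) summable_on UNIV"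
    by (rule summable_on_reindex_bij_betw[OF bij_int_decode, symmetric])
  then show ?thesis
    unfolding sobolev_def sobolev_weight_decode by (subst (asm) summable_on_UNIV_nonneg_real_iff) auto
qed

lemma sobolev_norm_eq:
  assumes "sobolev r f"
  shows "sobolev_norm r f = sqrt (\<Sum>n. bracket n powr r * (cmod (fcoeff f n))\<^sup>2)"
proof -
  have "infsum (sobolev_weight r f) UNIV = (\<Sum>\<^sub>\<infinity>n. sobolev_weight r f (int_decode n))"
    by (rule infsum_reindex_bij_betw[OF bij_int_decode, symmetric])
  also have "\<dots> = (\<Sum>n. bracket n powr r * (cmod (fcoeff f n))\<^sup>2)"
    unfolding sobolev_weight_decode
    using assms unfolding sobolev_iff
    by (intro sums_unique has_sum_imp_sums has_sum_infsum) (simp add: summable_on_UNIV_nonneg_real_iff)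
  finally show ?thesis by (simp add: sobolev_norm_def)
qed

text \<open>\<open>int_decode\<close> alternates between the two signs, so the integer with index
  \<open>n\<close> has modulus at least n/2. This reduces sums over frequencies to p-series in the
  index.\<close>

lemma bracket_ge: "bracket n \<ge> (real n)\<^sup>2 / 4"
proof -
  have "int n \<le> 2 * \<bar>int_decode n\<bar>"
  proof -
    have "int (int_encode k) \<le> 2 * \<bar>k\<bar>" for k by (auto simp: int_encode_def sum_encode_def)
    from this[of "int_decode n"] show ?thesis by simp
  qed
  then have "real n \<le> 2 * \<bar>real_of_int (int_decode n)\<bar>" by linarith
  then have "(real n)\<^sup>2 \<le> (2 * \<bar>real_of_int (int_decode n)\<bar>)\<^sup>2" by (intro power_mono) auto
  then show ?thesis by (simp add: bracket_def power_mult_distrib)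
qed

lemma summable_bracket:
  assumes "q > 1 / 2"
  shows "summable (\<lambda>n. bracket n powr (- q))"
proof (rule summable_comparison_test'[where N=1])
  show "summable (\<lambda>n. 4 powr q * real n powr (- 2 * q))"
    using assms by (intro summable_mult) (simp add: summable_real_powr_iff)
  fix n :: nat assume n: "n \<ge> 1"
  have "bracket n powr (- q) \<le> ((real n)\<^sup>2 / 4) powr (- q)"
    using n assms bracket_ge[of n] by (intro powr_mono2') auto
  also have "\<dots> = 4 powr q * real n powr (- 2 * q)"
  proof -
    have n2: "real n powr 2 = (real n)\<^sup>2" using n by (simp add: powr_numeral)
    have "((real n)\<^sup>2 / 4) powr (- q) = (real n powr 2) powr (- q) / 4 powr (- q)"
      unfolding n2 by (rule powr_divide)
    also have "(real n powr 2) powr (- q) = real n powr (- 2 * q)" by (simp only: powr_powr mult_minus_left mult_minus_right)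
    also have "real n powr (- 2 * q) / 4 powr (- q) = 4 powr q * real n powr (- 2 * q)"
      by (simp only: powr_minus divide_inverse inverse_inverse_eq mult.commute)
    finally show ?thesis .
  qed
  finally show "norm (bracket n powr (- q)) \<le> 4 powr q * real n powr (- 2 * q)" by simp
qed

lemma Cauchy_Schwarz_suminf:
  fixes a b :: "nat \<Rightarrow> real"
  assumes "summable (\<lambda>n. (a n)\<^sup>2)" "summable (\<lambda>n. (b n)\<^sup>2)" "\<And>n. a n \<ge> 0" "\<And>n. b n \<ge> 0"
  shows "summable (\<lambda>n. a n * b n)"
    and "(\<Sum>n. a n * b n) \<le> sqrt (\<Sum>n. (a n)\<^sup>2) * sqrt (\<Sum>n. (b n)\<^sup>2)"
proof -
  have *: "(\<Sum>i<n. a i * b i) \<le> sqrt (\<Sum>n. (a n)\<^sup>2) * sqrt (\<Sum>n. (b n)\<^sup>2)" for n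
  proof -
    have "(\<Sum>i<n. a i * b i) = (\<Sum>i<n. \<bar>a i\<bar> * \<bar>b i\<bar>)" using assms(3,4) by simp
    also have "\<dots> \<le> L2_set a {..<n} * L2_set b {..<n}" by (rule L2_set_mult_ineq)
    also have "\<dots> \<le> sqrt (\<Sum>n. (a n)\<^sup>2) * sqrt (\<Sum>n. (b n)\<^sup>2)"
      unfolding L2_set_def using assms
      by (intro mult_mono real_sqrt_le_mono sum_le_suminf real_sqrt_ge_zero suminf_nonneg sum_nonneg) auto
    finally show ?thesis .
  qed
  show 1: "summable (\<lambda>n. a n * b n)"
    by (rule bounded_imp_summable[OF _ *[of "Suc n" for n, unfolded lessThan_Suc_atMost]])
       (use assms(3,4) in auto)
  show "(\<Sum>n. a n * b n) \<le> sqrt (\<Sum>n. (a n)\<^sup>2) * sqrt (\<Sum>n. (b n)\<^sup>2)"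
    by (rule suminf_le_const[OF 1 *])
qed

lemma cmod_deriv_coeff_pow: "cmod ((deriv_coeff ^^ j) a n) = \<bar>freq n\<bar> ^ j * cmod (a n)"
  by (induction j arbitrary: n) (simp_all add: deriv_coeff_def norm_mult)

lemma abs_freq_le: "\<bar>freq n\<bar> \<le> 2 * pi * sqrt (bracket n)"
proof -
  have "\<bar>real_of_int (int_decode n)\<bar> \<le> sqrt (bracket n)"
    by (rule real_le_rsqrt) (simp add: bracket_def)
  then show ?thesis by (simp add: freq_def abs_mult)
qed

text \<open>Cauchy-Schwarz after splitting the weight:
  \<open>bracket n powr ((real j - r) / 2)\<close> is square summable when r - j > 1/2, and the
  remaining factor is the weight of H^r. The conclusion is absolute summability of the
  differentiated series, stronger than continuity of the derivative, so later arguments can work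
  term by term.\<close>

lemma sobolev_embedding:
  assumes "r > real j + 1 / 2"
  shows "\<exists>C\<ge>0. \<forall>f. sobolev r f \<longrightarrow> summable (\<lambda>n. cmod ((deriv_coeff ^^ j) (fcoeff f) n)) \<and>
     (\<Sum>n. cmod ((deriv_coeff ^^ j) (fcoeff f) n)) \<le> C * sobolev_norm r f"
proof -
  define A where "A = (\<Sum>n. bracket n powr (- (r - real j)))"
  define C where "C = (2 * pi) ^ j * sqrt A"
  have sA: "summable (\<lambda>n. bracket n powr (- (r - real j)))" using assms by (intro summable_bracket) auto
  have "A \<ge> 0" unfolding A_def by (intro suminf_nonneg sA) auto
  then have "C \<ge> 0" by (simp add: C_def)
  moreover have "summable (\<lambda>n. cmod ((deriv_coeff ^^ j) (fcoeff f) n)) \<and>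
     (\<Sum>n. cmod ((deriv_coeff ^^ j) (fcoeff f) n)) \<le> C * sobolev_norm r f" if f: "sobolev r f" for f
  proof -
    define a where "a n = bracket n powr ((real j - r) / 2)" for n
    define b where "b n = bracket n powr (r / 2) * cmod (fcoeff f n)" for n
    have a2: "(a n)\<^sup>2 = bracket n powr (- (r - real j))" for n
    proof -
      have "(a n)\<^sup>2 = bracket n powr ((real j - r) / 2 + (real j - r) / 2)"
        by (simp only: a_def powr_add power2_eq_square)
      then show ?thesis by simp
    qed
    have b2: "(b n)\<^sup>2 = bracket n powr r * (cmod (fcoeff f n))\<^sup>2" for n
    proof -
      have "(bracket n powr (r / 2))\<^sup>2 = bracket n powr (r / 2 + r / 2)"
        by (simp only: powr_add power2_eq_square)
      then show ?thesis by (simp add: b_def power_mult_distrib)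
    qed
    have ab: "cmod ((deriv_coeff ^^ j) (fcoeff f) n) \<le> (2 * pi) ^ j * (a n * b n)" for n
    proof -
      have "\<bar>freq n\<bar> ^ j \<le> (2 * pi * sqrt (bracket n)) ^ j" by (intro power_mono abs_freq_le) auto
      also have "\<dots> = (2 * pi) ^ j * bracket n powr (real j / 2)"
        using bracket_ge_1[of n]
        by (simp add: power_mult_distrib powr_half_sqrt[symmetric] powr_realpow[symmetric] powr_powr)
      also have "bracket n powr (real j / 2) = a n * bracket n powr (r / 2)"
        by (simp add: a_def powr_add[symmetric] diff_divide_distrib)
      finally have "\<bar>freq n\<bar> ^ j * cmod (fcoeff f n) \<le> (2 * pi) ^ j * (a n * bracket n powr (r / 2)) * cmod (fcoeff f n)"
        by (intro mult_right_mono) auto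
      then show ?thesis by (simp add: cmod_deriv_coeff_pow b_def mult_ac)
    qed
    have CS: "summable (\<lambda>n. a n * b n)" "(\<Sum>n. a n * b n) \<le> sqrt (\<Sum>n. (a n)\<^sup>2) * sqrt (\<Sum>n. (b n)\<^sup>2)"
      using Cauchy_Schwarz_suminf[of a b] sA f by (simp_all add: a2 b2 sobolev_iff) (simp_all add: a_def b_def)
    have s: "summable (\<lambda>n. cmod ((deriv_coeff ^^ j) (fcoeff f) n))"
      by (rule summable_comparison_test'[OF summable_mult[OF CS(1), of "(2 * pi) ^ j"]]) (use ab in auto)
    have "(\<Sum>n. cmod ((deriv_coeff ^^ j) (fcoeff f) n)) \<le> (\<Sum>n. (2 * pi) ^ j * (a n * b n))"
      by (rule suminf_le[OF ab s summable_mult[OF CS(1)]])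
    also have "\<dots> = (2 * pi) ^ j * (\<Sum>n. a n * b n)" by (rule suminf_mult[OF CS(1)])
    also have "\<dots> \<le> (2 * pi) ^ j * (sqrt (\<Sum>n. (a n)\<^sup>2) * sqrt (\<Sum>n. (b n)\<^sup>2))"
      using CS(2) by (intro mult_left_mono) auto
    also have "\<dots> = C * sobolev_norm r f" by (simp add: C_def A_def a2 b2 sobolev_norm_eq[OF f])
    finally show ?thesis using s by simp
  qed
  ultimately show ?thesis by blast
qed

section \<open>Linear structure of the Sobolev spaces\<close>

lemma torus_L2_set_integrable:
  assumes "torus_L2 f"
  shows "set_integrable lborel {0..1} (\<lambda>x. f x *\<^sub>R cis (k * x))"
proof (rule set_integrable_bound)
  have [measurable]: "f \<in> borel_measurable borel" using assms by (simp add: torus_L2_def)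
  show "set_integrable lborel {0..1} (\<lambda>x. 1 + (f x)\<^sup>2)"
    using assms unfolding torus_L2_def
    by (intro set_integral_add(1)) (auto simp: set_integrable_def)
  show "set_borel_measurable lborel {0..1} (\<lambda>x. f x *\<^sub>R cis (k * x))"
    unfolding set_borel_measurable_def cis_conv_exp by measurable
  have "\<bar>f x\<bar> \<le> 1 + (f x)\<^sup>2" for x using sum_squares_bound[of "\<bar>f x\<bar>" 1] by simp
  then show "AE x in lborel. x \<in> {0..1} \<longrightarrow> norm (f x *\<^sub>R cis (k * x)) \<le> norm (1 + (f x)\<^sup>2)"
    by (simp add: abs_of_nonneg add_nonneg_nonneg)
qed

lemma torus_L2_lincomb:
  assumes "torus_L2 f" "torus_L2 h"
  shows "torus_L2 (\<lambda>x. a * f x + b * h x)"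
proof -
  have [measurable]: "f \<in> borel_measurable borel" "h \<in> borel_measurable borel"
    using assms by (simp_all add: torus_L2_def)
  have "set_integrable lborel {0..1} (\<lambda>x. (a * f x + b * h x)\<^sup>2)"
  proof (rule set_integrable_bound)
    show "set_integrable lborel {0..1} (\<lambda>x. 2 * a\<^sup>2 * (f x)\<^sup>2 + 2 * b\<^sup>2 * (h x)\<^sup>2)"
      using assms unfolding torus_L2_def by (intro set_integral_add(1) set_integrable_mult_right) auto
    show "set_borel_measurable lborel {0..1} (\<lambda>x. (a * f x + b * h x)\<^sup>2)"
      unfolding set_borel_measurable_def by measurable
    have "(a * f x + b * h x)\<^sup>2 \<le> 2 * a\<^sup>2 * (f x)\<^sup>2 + 2 * b\<^sup>2 * (h x)\<^sup>2" for x
      using sum_squares_bound[of "a * f x" "b * h x"] by (simp add: power2_sum power_mult_distrib)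
    then show "AE x in lborel. x \<in> {0..1} \<longrightarrow>
        norm ((a * f x + b * h x)\<^sup>2) \<le> norm (2 * a\<^sup>2 * (f x)\<^sup>2 + 2 * b\<^sup>2 * (h x)\<^sup>2)" by simp
  qed
  with assms show ?thesis by (auto simp: torus_L2_def periodic1_def)
qed

lemma fcoeff_lincomb:
  assumes "torus_L2 f" "torus_L2 h"
  shows "fcoeff (\<lambda>x. a * f x + b * h x) n = of_real a * fcoeff f n + of_real b * fcoeff h n"
proof -
  let ?e = "\<lambda>x. cis (- 2 * pi * real_of_int (int_decode n) * x)"
  have i: "set_integrable lborel {0..1} (\<lambda>x. f x *\<^sub>R ?e x)" "set_integrable lborel {0..1} (\<lambda>x. h x *\<^sub>R ?e x)"
    using torus_L2_set_integrable assms by blast+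
  have "fcoeff (\<lambda>x. a * f x + b * h x) n =
      set_lebesgue_integral lborel {0..1} (\<lambda>x. of_real a * (f x *\<^sub>R ?e x) + of_real b * (h x *\<^sub>R ?e x))"
    unfolding fcoeff_def fourier_coeff_def
    by (rule arg_cong[where f="set_lebesgue_integral _ _"])
       (auto simp: fun_eq_iff scaleR_conv_of_real algebra_simps)
  also have "\<dots> = of_real a * fcoeff f n + of_real b * fcoeff h n"
    unfolding fcoeff_def fourier_coeff_def
    using set_integral_add(2)[OF set_integrable_mult_right[of "of_real a", OF i(1)] set_integrable_mult_right[of "of_real b", OF i(2)]]
    by (simp only: set_integral_mult_right)
  finally show ?thesis .
qed

lemma fcoeff_cong_AE:
  assumes "torus_L2 f" "torus_L2 h" "AE x in lborel. f x = h x"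
  shows "fcoeff f = fcoeff h"
proof
  have [measurable]: "f \<in> borel_measurable borel" "h \<in> borel_measurable borel"
    using assms by (simp_all add: torus_L2_def)
  show "fcoeff f n = fcoeff h n" for n
    unfolding fcoeff_def fourier_coeff_def cis_conv_exp
    by (rule set_lebesgue_integral_cong_AE) (use assms(3) in auto)
qed

lemma torus_L2_zero: "torus_L2 (\<lambda>x. 0)"
  by (simp add: torus_L2_def periodic1_def set_integrable_def)

lemma fcoeff_zero: "fcoeff (\<lambda>x. 0) n = 0"
  by (simp add: fcoeff_def fourier_coeff_def)

lemma sobolev_zero: "sobolev r (\<lambda>x. 0)"
  by (simp add: sobolev_iff torus_L2_zero fcoeff_zero)

lemma sobolev_lincomb:
  assumes "sobolev r f" "sobolev r h"
  shows "sobolev r (\<lambda>x. a * f x + b * h x)"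
proof -
  have L2: "torus_L2 f" "torus_L2 h" using assms by (auto simp: sobolev_def)
  have "summable (\<lambda>n. bracket n powr r * (cmod (fcoeff (\<lambda>x. a * f x + b * h x) n))\<^sup>2)"
  proof (rule summable_comparison_test')
    show "summable (\<lambda>n. 2 * a\<^sup>2 * (bracket n powr r * (cmod (fcoeff f n))\<^sup>2)
        + 2 * b\<^sup>2 * (bracket n powr r * (cmod (fcoeff h n))\<^sup>2))"
      using assms by (intro summable_add summable_mult) (auto simp: sobolev_iff)
    fix n :: nat assume "n \<ge> 0"
    have "(cmod (fcoeff (\<lambda>x. a * f x + b * h x) n))\<^sup>2 \<le> (\<bar>a\<bar> * cmod (fcoeff f n) + \<bar>b\<bar> * cmod (fcoeff h n))\<^sup>2"
      unfolding fcoeff_lincomb[OF L2]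
      by (intro power_mono order_trans[OF norm_triangle_ineq]) (auto simp: norm_mult)
    also have "\<dots> \<le> 2 * a\<^sup>2 * (cmod (fcoeff f n))\<^sup>2 + 2 * b\<^sup>2 * (cmod (fcoeff h n))\<^sup>2"
      using sum_squares_bound[of "\<bar>a\<bar> * cmod (fcoeff f n)" "\<bar>b\<bar> * cmod (fcoeff h n)"]
      by (simp add: power2_sum power_mult_distrib)
    finally have "bracket n powr r * (cmod (fcoeff (\<lambda>x. a * f x + b * h x) n))\<^sup>2
        \<le> bracket n powr r * (2 * a\<^sup>2 * (cmod (fcoeff f n))\<^sup>2 + 2 * b\<^sup>2 * (cmod (fcoeff h n))\<^sup>2)"
      by (intro mult_left_mono) auto
    then show "norm (bracket n powr r * (cmod (fcoeff (\<lambda>x. a * f x + b * h x) n))\<^sup>2)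
       \<le> 2 * a\<^sup>2 * (bracket n powr r * (cmod (fcoeff f n))\<^sup>2) + 2 * b\<^sup>2 * (bracket n powr r * (cmod (fcoeff h n))\<^sup>2)"
      by (simp add: algebra_simps)
  qed
  with torus_L2_lincomb[OF L2] show ?thesis by (simp add: sobolev_iff)
qed

lemma deriv_coeff_pow_lincomb:
  "(deriv_coeff ^^ j) (\<lambda>n. of_real a * f n + of_real b * h n) = (\<lambda>n. of_real a * (deriv_coeff ^^ j) f n + of_real b * (deriv_coeff ^^ j) h n)"
  by (induction j) (simp_all add: deriv_coeff_def fun_eq_iff algebra_simps)

lemma lincomb_diff: "(\<lambda>x. f x - h x) = (\<lambda>x. 1 * f x + (- 1) * h x)" for f h :: "real \<Rightarrow> real"
  by simp

lemma sobolev_diff: "sobolev r f \<Longrightarrow> sobolev r h \<Longrightarrow> sobolev r (\<lambda>x. f x - h x)"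
  unfolding lincomb_diff by (rule sobolev_lincomb)

lemma sobolev_L2: "sobolev r f \<Longrightarrow> torus_L2 f" by (simp add: sobolev_def)

lemma fcoeff_diff: "torus_L2 f \<Longrightarrow> torus_L2 h \<Longrightarrow> fcoeff (\<lambda>x. f x - h x) = (\<lambda>n. fcoeff f n - fcoeff h n)"
  unfolding lincomb_diff by (rule ext, subst fcoeff_lincomb) auto

section \<open>Point evaluation of Sobolev functions, paths and integrals\<close>

text \<open>The \<open>j\<close>-th derivative of the continuous representative of \<open>f\<close>.\<close>

definition rep_deriv :: "nat \<Rightarrow> (real \<Rightarrow> real) \<Rightarrow> real \<Rightarrow> real" where
  "rep_deriv j f = fourier_sum ((deriv_coeff ^^ j) (fcoeff f))"

lemma summable_coeffs:
  assumes "sobolev r f" "r > real j + 1 / 2"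
  shows "summable (\<lambda>n. cmod ((deriv_coeff ^^ j) (fcoeff f) n))"
  using sobolev_embedding[OF assms(2)] assms(1) by blast

lemma rep_deriv_lincomb:
  assumes "sobolev r f" "sobolev r h" "r > real j + 1 / 2"
  shows "rep_deriv j (\<lambda>x. a * f x + b * h x) x = a * rep_deriv j f x + b * rep_deriv j h x"
proof -
  have s: "summable (\<lambda>n. cmod ((deriv_coeff ^^ j) (fcoeff f) n))" "summable (\<lambda>n. cmod ((deriv_coeff ^^ j) (fcoeff h) n))"
    using summable_coeffs assms by blast+
  have s': "summable (\<lambda>n. cmod (of_real k * (deriv_coeff ^^ j) (fcoeff g) n))"
    if "summable (\<lambda>n. cmod ((deriv_coeff ^^ j) (fcoeff g) n))" for k :: real and g
    using summable_mult[OF that, of "\<bar>k\<bar>"] by (simp add: norm_mult)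
  have "fcoeff (\<lambda>x. a * f x + b * h x) = (\<lambda>n. of_real a * fcoeff f n + of_real b * fcoeff h n)"
    using fcoeff_lincomb[OF sobolev_L2[OF assms(1)] sobolev_L2[OF assms(2)]] by blast
  then show ?thesis
    unfolding rep_deriv_def using s
    by (simp add: deriv_coeff_pow_lincomb fourier_sum_add[OF s'[OF s(1)] s'[OF s(2)]] fourier_sum_scale)
qed

lemma rep_deriv_diff:
  assumes "sobolev r f" "sobolev r h" "r > real j + 1 / 2"
  shows "rep_deriv j (\<lambda>x. f x - h x) x = rep_deriv j f x - rep_deriv j h x"
  unfolding lincomb_diff by (subst rep_deriv_lincomb[OF assms]) simp

lemma rep_deriv_zero: "rep_deriv j (\<lambda>x. 0) x = 0"
proof -
  have "(deriv_coeff ^^ j) (\<lambda>n. 0) = (\<lambda>n. 0)" by (induction j) (simp_all add: deriv_coeff_def fun_eq_iff)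
  then show ?thesis by (simp add: rep_deriv_def fourier_sum_def fcoeff_zero[abs_def])
qed

text \<open>Point evaluation of the j-th derivative is a bounded functional on H^r, uniformly in the
  point; the passages from norm limits to pointwise limits below rest on this.\<close>

lemma rep_deriv_bound:
  assumes "r > real j + 1 / 2"
  shows "\<exists>C. \<forall>f x. sobolev r f \<longrightarrow> \<bar>rep_deriv j f x\<bar> \<le> C * sobolev_norm r f"
proof -
  obtain C where C: "C \<ge> 0" "\<And>f. sobolev r f \<Longrightarrow> summable (\<lambda>n. cmod ((deriv_coeff ^^ j) (fcoeff f) n)) \<and>
     (\<Sum>n. cmod ((deriv_coeff ^^ j) (fcoeff f) n)) \<le> C * sobolev_norm r f"
    using sobolev_embedding[OF assms] by blast
  have "\<bar>rep_deriv j f x\<bar> \<le> C * sobolev_norm r f" if "sobolev r f" for f x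
    using abs_fourier_sum_le[of "(deriv_coeff ^^ j) (fcoeff f)" x] C(2)[OF that] by (auto simp: rep_deriv_def)
  then show ?thesis by blast
qed

lemma rep_deriv_has_derivative:
  assumes "sobolev r f" "r > real (Suc j) + 1 / 2"
  shows "(rep_deriv j f has_real_derivative rep_deriv (Suc j) f x) (at x)"
  using summable_coeffs[OF assms(1), of j] summable_coeffs[OF assms] assms(2)
  by (auto simp: rep_deriv_def intro!: has_real_derivative_fourier_sum)

lemma continuous_on_rep_deriv:
  assumes "sobolev r f" "r > real j + 1 / 2"
  shows "continuous_on UNIV (rep_deriv j f)"
  unfolding rep_deriv_def by (rule continuous_on_fourier_sum[OF summable_coeffs[OF assms]])

lemma rep_deriv_periodic: "rep_deriv j f (x + 1) = rep_deriv j f x"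
  by (simp add: rep_deriv_def fourier_sum_periodic)

lemma rep_deriv_eq:
  assumes "torus_C f" "sobolev r f" "r > 1 / 2"
  shows "f = rep_deriv 0 f"
  using fourier_sum_fcoeff[OF assms(1)] summable_coeffs[OF assms(2), of 0] assms(3) by (auto simp: rep_deriv_def fun_eq_iff)

lemma sobolev_sum:
  assumes "finite p" "\<And>i. i \<in> p \<Longrightarrow> sobolev r (f i)"
  shows "sobolev r (\<lambda>x. \<Sum>i\<in>p. a i * f i x)"
  using assms
proof (induction p)
  case (insert i p)
  then have "sobolev r (\<lambda>x. a i * f i x + 1 * (\<Sum>i\<in>p. a i * f i x))" by (intro sobolev_lincomb) auto
  with insert.hyps show ?case by simp
qed (simp add: sobolev_zero)

lemma rep_deriv_sum:
  assumes "finite p" "\<And>i. i \<in> p \<Longrightarrow> sobolev r (f i)" "r > real j + 1 / 2"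
  shows "rep_deriv j (\<lambda>x. \<Sum>i\<in>p. a i * f i x) x = (\<Sum>i\<in>p. a i * rep_deriv j (f i) x)"
  using assms(1,2)
proof (induction p)
  case (insert i p)
  have "rep_deriv j (\<lambda>x. a i * f i x + 1 * (\<Sum>i\<in>p. a i * f i x)) x = a i * rep_deriv j (f i) x + 1 * rep_deriv j (\<lambda>x. \<Sum>i\<in>p. a i * f i x) x"
    using insert by (intro rep_deriv_lincomb[OF _ sobolev_sum assms(3)]) auto
  with insert show ?case by simp
qed (simp add: rep_deriv_zero)

text \<open>The increment splits into a change of time at the moving point, bounded uniformly in x
  by the Sobolev norm, and a change of point at the fixed time, where the derivative is
  continuous.\<close>

lemma path_continuous_rep_deriv:
  assumes "sobolev_path_continuous r I f" "r > real j + 1 / 2"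
  shows "continuous_on (I \<times> UNIV) (\<lambda>(t, x). rep_deriv j (f t) x)"
  unfolding continuous_on_def
proof
  fix v assume v: "v \<in> I \<times> (UNIV :: real set)"
  obtain t x where tx: "v = (t, x)" "t \<in> I" using v by auto
  obtain C where "\<forall>f x. sobolev r f \<longrightarrow> \<bar>rep_deriv j f x\<bar> \<le> C * sobolev_norm r f"
    using rep_deriv_bound[OF assms(2)] by (elim exE)
  then have C: "\<bar>rep_deriv j f x\<bar> \<le> C * sobolev_norm r f" if "sobolev r f" for f x
    using that by blast
  have f: "sobolev r (f t)" "((\<lambda>t'. sobolev_norm r (\<lambda>x. f t' x - f t x)) \<longlongrightarrow> 0) (at t within I)" if "t \<in> I" for t
    using assms(1) that by (auto simp: sobolev_path_continuous_def)
  \<comment> \<open>Points (t, x') with x' different from x approach (t, x) as well, so the limit in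
    time is restated as continuity, with value 0 at t itself.\<close>
  have n0: "sobolev_norm r (\<lambda>x. f t x - f t x) = 0"
    by (simp add: sobolev_norm_eq[OF sobolev_zero] fcoeff_zero)
  have 1: "((\<lambda>z. sobolev_norm r (\<lambda>x. f (fst z) x - f t x)) \<longlongrightarrow> 0) (at (t, x) within I \<times> UNIV)"
  proof -
    have "continuous (at (fst (t, x)) within fst ` (I \<times> (UNIV :: real set)))
        (\<lambda>t'. sobolev_norm r (\<lambda>x. f t' x - f t x))"
      using f(2)[OF tx(2)] n0 by (simp add: continuous_within)
    from continuous_within_compose2[OF _ this] have
      "continuous (at (t, x) within I \<times> UNIV) (\<lambda>z. sobolev_norm r (\<lambda>x. f (fst z) x - f t x))"
      by (simp add: continuous_fst continuous_ident)
    then show ?thesis using n0 by (simp add: continuous_within)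
  qed
  have "((\<lambda>z. C * sobolev_norm r (\<lambda>x. f (fst z) x - f t x)) \<longlongrightarrow> 0) (at (t, x) within I \<times> UNIV)"
    using tendsto_mult_left[OF 1, of C] by simp
  then have 2: "((\<lambda>z. rep_deriv j (f (fst z)) (snd z) - rep_deriv j (f t) (snd z)) \<longlongrightarrow> 0) (at (t, x) within I \<times> UNIV)"
  proof (rule Lim_null_comparison[rotated])
    show "\<forall>\<^sub>F z in at (t, x) within I \<times> UNIV. norm (rep_deriv j (f (fst z)) (snd z) - rep_deriv j (f t) (snd z))
        \<le> C * sobolev_norm r (\<lambda>x. f (fst z) x - f t x)"
      unfolding eventually_at_filter
    proof (intro always_eventually allI impI)
      fix z assume "z \<in> I \<times> (UNIV :: real set)"
      then have z: "fst z \<in> I" by auto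
      show "norm (rep_deriv j (f (fst z)) (snd z) - rep_deriv j (f t) (snd z)) \<le> C * sobolev_norm r (\<lambda>x. f (fst z) x - f t x)"
        using C[OF sobolev_diff[OF f(1)[OF z] f(1)[OF tx(2)]], of "snd z"]
        by (simp add: rep_deriv_diff[OF f(1)[OF z] f(1)[OF tx(2)] assms(2)])
    qed
  qed
  have "isCont (rep_deriv j (f t)) x"
    using continuous_on_rep_deriv[OF f(1)[OF tx(2)] assms(2)] by (simp add: continuous_on_eq_continuous_at)
  then have 3: "((\<lambda>z. rep_deriv j (f t) (snd z)) \<longlongrightarrow> rep_deriv j (f t) x) (at (t, x) within I \<times> UNIV)"
    by (rule isCont_tendsto_compose) (auto intro!: tendsto_eq_intros)
  show "((\<lambda>(t, x). rep_deriv j (f t) x) \<longlongrightarrow> (case v of (t, x) \<Rightarrow> rep_deriv j (f t) x)) (at v within I \<times> UNIV)"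
    using tendsto_add[OF 2 3] by (simp add: tx split_def)
qed

text \<open>Evaluation is linear, so the difference quotient of the evaluated path is the evaluated
  difference quotient, and its error is bounded by the Sobolev norm of the error.\<close>

lemma path_derivative_rep_deriv:
  assumes "sobolev_path_deriv r I f f'" "r > real j + 1 / 2" "t \<in> I"
  shows "((\<lambda>t. rep_deriv j (f t) x) has_real_derivative rep_deriv j (f' t) x) (at t within I)"
proof -
  obtain C where "\<forall>f x. sobolev r f \<longrightarrow> \<bar>rep_deriv j f x\<bar> \<le> C * sobolev_norm r f"
    using rep_deriv_bound[OF assms(2)] by (elim exE)
  then have C: "\<bar>rep_deriv j f x\<bar> \<le> C * sobolev_norm r f" if "sobolev r f" for f x
    using that by blast
  have f: "sobolev r (f t)" "sobolev r (f' t)" if "t \<in> I" for t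
    using assms(1) that by (auto simp: sobolev_path_deriv_def)
  have "((\<lambda>t'. sobolev_norm r (\<lambda>x. (f t' x - f t x) / (t' - t) - f' t x)) \<longlongrightarrow> 0) (at t within I)"
    using assms(1,3) by (auto simp: sobolev_path_deriv_def)
  from tendsto_mult_left[OF this, of C]
  have "((\<lambda>t'. C * sobolev_norm r (\<lambda>x. (f t' x - f t x) / (t' - t) - f' t x)) \<longlongrightarrow> 0) (at t within I)" by simp
  then have "((\<lambda>t'. (rep_deriv j (f t') x - rep_deriv j (f t) x) / (t' - t) - rep_deriv j (f' t) x) \<longlongrightarrow> 0) (at t within I)"
  proof (rule Lim_null_comparison[rotated])
    show "\<forall>\<^sub>F t' in at t within I. norm ((rep_deriv j (f t') x - rep_deriv j (f t) x) / (t' - t) - rep_deriv j (f' t) x)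
        \<le> C * sobolev_norm r (\<lambda>x. (f t' x - f t x) / (t' - t) - f' t x)"
      unfolding eventually_at_filter
    proof (intro always_eventually allI impI)
      fix t' assume t': "t' \<in> I"
      define k where "k = 1 / (t' - t)"
      have d: "sobolev r (\<lambda>x. f t' x - f t x)" by (intro sobolev_diff f t' assms(3))
      have eq: "(\<lambda>x. (f t' x - f t x) / (t' - t) - f' t x) = (\<lambda>x. k * (f t' x - f t x) + (- 1) * f' t x)"
        by (simp add: k_def)
      have "rep_deriv j (\<lambda>x. (f t' x - f t x) / (t' - t) - f' t x) x
          = k * (rep_deriv j (f t') x - rep_deriv j (f t) x) + (- 1) * rep_deriv j (f' t) x"
        unfolding eq
        by (simp only: rep_deriv_lincomb[OF d f(2)[OF assms(3)] assms(2)]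
              rep_deriv_diff[OF f(1)[OF t'] f(1)[OF assms(3)] assms(2)])
      moreover have "\<bar>rep_deriv j (\<lambda>x. (f t' x - f t x) / (t' - t) - f' t x) x\<bar> \<le>
          C * sobolev_norm r (\<lambda>x. (f t' x - f t x) / (t' - t) - f' t x)"
        unfolding eq by (intro C sobolev_lincomb d f assms(3))
      ultimately show "norm ((rep_deriv j (f t') x - rep_deriv j (f t) x) / (t' - t) - rep_deriv j (f' t) x)
        \<le> C * sobolev_norm r (\<lambda>x. (f t' x - f t x) / (t' - t) - f' t x)" by (simp add: k_def)
    qed
  qed
  from tendsto_add[OF this tendsto_const[of "rep_deriv j (f' t) x"]]
  show ?thesis by (simp add: has_field_derivative_iff)
qed

text \<open>A tagged Riemann sum is a finite linear combination, so evaluation commutes with it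
  exactly; boundedness of the evaluation carries this to the limit along
  \<open>division_filter\<close>.\<close>

lemma sobolev_integral_rep_deriv:
  assumes "has_sobolev_integral r f J t" "r > real j + 1 / 2"
  shows "((\<lambda>a. rep_deriv j (f a) x) has_integral rep_deriv j J x) {0..t}"
proof -
  obtain C where "\<forall>f x. sobolev r f \<longrightarrow> \<bar>rep_deriv j f x\<bar> \<le> C * sobolev_norm r f"
    using rep_deriv_bound[OF assms(2)] by (elim exE)
  then have C: "\<bar>rep_deriv j f x\<bar> \<le> C * sobolev_norm r f" if "sobolev r f" for f x
    using that by blast
  have f: "sobolev r (f a)" if "a \<in> {0..t}" for a
    using assms(1) that by (auto simp: has_sobolev_integral_def)
  have J: "sobolev r J" using assms(1) by (auto simp: has_sobolev_integral_def)
  have "((\<lambda>p. sobolev_norm r (\<lambda>x. (\<Sum>(a, K)\<in>p. measure lborel K * f a x) - J x)) \<longlongrightarrow> 0) (division_filter {0..t})"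
    using assms(1) by (auto simp: has_sobolev_integral_def)
  from tendsto_mult_left[OF this, of C]
  have "((\<lambda>p. C * sobolev_norm r (\<lambda>x. (\<Sum>(a, K)\<in>p. measure lborel K * f a x) - J x)) \<longlongrightarrow> 0) (division_filter {0..t})"
    by simp
  then have "((\<lambda>p. (\<Sum>(a, K)\<in>p. measure lborel K * rep_deriv j (f a) x) - rep_deriv j J x) \<longlongrightarrow> 0) (division_filter {0..t})"
  proof (rule Lim_null_comparison[rotated])
    show "\<forall>\<^sub>F p in division_filter {0..t}. norm ((\<Sum>(a, K)\<in>p. measure lborel K * rep_deriv j (f a) x) - rep_deriv j J x)
        \<le> C * sobolev_norm r (\<lambda>x. (\<Sum>(a, K)\<in>p. measure lborel K * f a x) - J x)"
      using eventually_division_filter_tagged_division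
    proof eventually_elim
      fix p assume p: "p tagged_division_of {0..t}"
      have fin: "finite p" using p by blast
      have tag: "sobolev r (f (fst i))" if "i \<in> p" for i
        using tag_in_interval[OF p, of "fst i" "snd i"] that by (intro f) auto
      have "rep_deriv j (\<lambda>x. (\<Sum>i\<in>p. measure lborel (snd i) * f (fst i) x) - J x) x =
          (\<Sum>i\<in>p. measure lborel (snd i) * rep_deriv j (f (fst i)) x) - rep_deriv j J x"
        by (simp only: rep_deriv_diff[OF sobolev_sum[OF fin tag] J assms(2)] rep_deriv_sum[OF fin tag assms(2)])
      moreover have "sobolev r (\<lambda>x. (\<Sum>i\<in>p. measure lborel (snd i) * f (fst i) x) - J x)"
        by (intro sobolev_diff sobolev_sum fin tag J)
      from C[OF this, of x] have "\<bar>rep_deriv j (\<lambda>x. (\<Sum>i\<in>p. measure lborel (snd i) * f (fst i) x) - J x) x\<bar>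
          \<le> C * sobolev_norm r (\<lambda>x. (\<Sum>i\<in>p. measure lborel (snd i) * f (fst i) x) - J x)" .
      ultimately
      show "norm ((\<Sum>(a, K)\<in>p. measure lborel K * rep_deriv j (f a) x) - rep_deriv j J x)
        \<le> C * sobolev_norm r (\<lambda>x. (\<Sum>(a, K)\<in>p. measure lborel K * f a x) - J x)"
        by (simp add: split_def)
    qed
  qed
  from tendsto_add[OF this tendsto_const[of "rep_deriv j J x"]]
  have "((\<lambda>p. \<Sum>(a, K)\<in>p. measure lborel K * rep_deriv j (f a) x) \<longlongrightarrow> rep_deriv j J x) (division_filter {0..t})" by simp
  then show ?thesis unfolding cbox_interval[symmetric] has_integral_cbox by simp
qed

section \<open>Riccati blow-up along characteristics\<close>

text \<open>The monotonicity principle behind the Gronwall and Riccati estimates below: each is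
  phrased as a nonnegative derivative of one auxiliary function, one-sided at the ends of
  \<open>{0..T}\<close>.\<close>

lemma has_real_derivative_nonneg_le:
  fixes f :: "real \<Rightarrow> real"
  assumes "\<And>s. s \<in> {0..T} \<Longrightarrow> (f has_real_derivative f' s) (at s within {0..T})"
    and "\<And>s. s \<in> {0..T} \<Longrightarrow> f' s \<ge> 0" and "t \<in> {0..T}"
  shows "f 0 \<le> f t"
proof -
  have "\<exists>x\<in>{0..t}. f t - f 0 = f' x * (t - 0)"
  proof (rule mvt_very_simple)
    show "0 \<le> t" using assms(3) by simp
    show "(f has_derivative (*) (f' x)) (at x within {0..t})" if "0 \<le> x" "x \<le> t" for x
      using assms(1)[of x] assms(3) that
      by (auto simp: has_field_derivative_def intro: has_derivative_subset)
  qed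
  then obtain x where "x \<in> {0..t}" "f t - f 0 = f' x * t" by auto
  with assms(2)[of x] assms(3) show ?thesis by (auto simp: zero_le_mult_iff algebra_simps)
qed

text \<open>Weighting by \<open>exp (- K t)\<close> makes the Picard operator a contraction on all of \<open>[0, T]\<close>.\<close>

lemma picard_lindelof:
  fixes f :: "real \<Rightarrow> real \<Rightarrow> real"
  assumes T: "T \<ge> 0"
    and cont: "continuous_on ({0..T} \<times> UNIV) (\<lambda>(t, x). f t x)"
    and lip: "\<And>t x x'. t \<in> {0..T} \<Longrightarrow> \<bar>f t x - f t x'\<bar> \<le> L * \<bar>x - x'\<bar>"
    and bnd: "\<And>t x. t \<in> {0..T} \<Longrightarrow> \<bar>f t x\<bar> \<le> B"
  obtains X where "X 0 = x0"
    and "\<And>t. t \<in> {0..T} \<Longrightarrow> (X has_real_derivative f t (X t)) (at t within {0..T})"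
proof -
  have L: "L \<ge> 0" using lip[of 0 0 1] T by auto
  have B: "B \<ge> 0" using bnd[of 0 0] T by auto
  \<comment> \<open>The contraction constant will be \<open>L / K\<close>, which is at most 1/2; the
    summand 1 keeps \<open>K\<close> positive when \<open>L = 0\<close>.\<close>
  define K where "K = 2 * L + 1"
  have K: "K > 0" using L by (simp add: K_def)
  \<comment> \<open>Clamping time to \<open>{0..T}\<close> turns paths into bounded continuous
    functions on the whole line, the complete space in which the fixed point is sought.\<close>
  define cl where "cl t = max 0 (min T t)" for t
  have cl: "cl t \<in> {0..T}" for t using T by (auto simp: cl_def)
  have clT: "cl t = t" if "t \<in> {0..T}" for t using that by (auto simp: cl_def)
  have ccl: "continuous_on A cl" for A unfolding cl_def by (intro continuous_intros)
  \<comment> \<open>The unknown \<open>Y\<close> is the weighted path exp(- K s) X(s), hence the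
    factor that undoes the weight.\<close>
  define g where "g Y s = f s (exp (K * s) * Y s)" for Y :: "real \<Rightarrow> real" and s
  have cg: "continuous_on {0..T} (g Y)" if "continuous_on UNIV Y" for Y
  proof -
    have "continuous_on {0..T} ((\<lambda>(t, x). f t x) \<circ> (\<lambda>s. (s, exp (K * s) * Y s)))"
      by (intro continuous_on_compose continuous_intros continuous_on_subset[OF that]
          continuous_on_subset[OF cont]) auto
    then show ?thesis by (simp add: g_def[abs_def] o_def)
  qed
  define P where "P Y t = exp (- K * cl t) * (x0 + integral {0..cl t} (g Y))" for Y t
  have ig: "g Y integrable_on {0..t}" if "continuous_on UNIV Y" "t \<in> {0..T}" for Y t
    by (intro integrable_continuous_real continuous_on_subset[OF cg[OF that(1)]]) (use that in auto)
  have cP: "continuous_on UNIV (P Y)" if Y: "continuous_on UNIV Y" for Y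
  proof -
    have 1: "continuous_on {0..T} (\<lambda>x. integral {0..x} (g Y))"
      using ig[OF Y, of T] T by (intro indefinite_integral_continuous_1) auto
    have "continuous_on UNIV (\<lambda>t. integral {0..cl t} (g Y))"
      by (rule continuous_on_compose2[OF 1 ccl]) (use cl in auto)
    then show ?thesis unfolding P_def by (intro continuous_intros ccl)
  qed
  have bP: "\<bar>P Y t\<bar> \<le> \<bar>x0\<bar> + B * T" if Y: "continuous_on UNIV Y" for Y t
  proof -
    have "\<bar>integral {0..cl t} (g Y)\<bar> \<le> B * (cl t - 0)"
      unfolding real_norm_def[symmetric]
      by (rule integral_bound) (use cl[of t] bnd in \<open>auto simp: g_def intro!: continuous_on_subset[OF cg[OF Y, unfolded g_def]]\<close>)
    also have "\<dots> \<le> B * T" using cl[of t] B by (intro mult_left_mono) auto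
    finally have *: "\<bar>x0 + integral {0..cl t} (g Y)\<bar> \<le> \<bar>x0\<bar> + B * T" by linarith
    have "exp (- K * cl t) \<le> 1" using cl[of t] K by simp
    then have "\<bar>P Y t\<bar> \<le> 1 * \<bar>x0 + integral {0..cl t} (g Y)\<bar>"
      unfolding P_def abs_mult by (intro mult_right_mono) auto
    with * show ?thesis by simp
  qed
  define Q where "Q Y = Bcontfun (P (apply_bcontfun Y))" for Y :: "real \<Rightarrow>\<^sub>C real"
  have cY: "continuous_on UNIV (apply_bcontfun Y)" for Y :: "real \<Rightarrow>\<^sub>C real"
    using apply_bcontfun[of Y] by (auto simp: bcontfun_def)
  have Q: "apply_bcontfun (Q Y) = P (apply_bcontfun Y)" for Y
    unfolding Q_def
    by (rule Bcontfun_inverse)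
       (auto simp: bcontfun_def bounded_iff intro!: cP[OF cY] exI[of _ "\<bar>x0\<bar> + B * T"] bP[OF cY])
  have "\<exists>!Y. Q Y = Y"
  proof (rule banach_fix_type[where c="1/2"])
    show "\<forall>Y Z. dist (Q Y) (Q Z) \<le> 1 / 2 * dist Y Z"
    proof (intro allI dist_bound)
      fix Y Z :: "real \<Rightarrow>\<^sub>C real" and t
      let ?t = "cl t" and ?d = "dist Y Z"
      have ht: "?t \<in> {0..T}" by (rule cl)
      have "((\<lambda>s. L * ?d * exp (K * s)) has_integral (L * ?d / K * exp (K * ?t) - L * ?d / K * exp (K * 0))) {0..?t}"
        by (rule fundamental_theorem_of_calculus)
           (use ht K in \<open>auto intro!: derivative_eq_intros simp: has_real_derivative_iff_has_vector_derivative[symmetric]\<close>)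
      moreover have "((\<lambda>s. g Y s - g Z s) has_integral (integral {0..?t} (g Y) - integral {0..?t} (g Z))) {0..?t}"
        by (intro has_integral_diff integrable_integral ig cY ht)
      moreover have "norm (g Y s - g Z s) \<le> L * ?d * exp (K * s)" if "s \<in> {0..?t}" for s
      proof -
        have "norm (g Y s - g Z s) \<le> L * \<bar>exp (K * s) * apply_bcontfun Y s - exp (K * s) * apply_bcontfun Z s\<bar>"
          unfolding g_def real_norm_def by (rule lip) (use ht that in auto)
        also have "\<dots> = L * (exp (K * s) * dist (apply_bcontfun Y s) (apply_bcontfun Z s))"
          by (simp add: right_diff_distrib[symmetric] abs_mult dist_real_def)
        also have "\<dots> \<le> L * (exp (K * s) * ?d)"
          by (intro mult_left_mono dist_bounded L) auto
        finally show ?thesis by (simp add: algebra_simps)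
      qed
      ultimately have "norm (integral {0..?t} (g Y) - integral {0..?t} (g Z)) \<le>
          L * ?d / K * exp (K * ?t) - L * ?d / K * exp (K * 0)"
        by (metis (no_types, lifting) has_integral_iff integral_norm_bound_integral)
      also have "\<dots> \<le> L * ?d / K * exp (K * ?t)" using L K by simp
      finally have "exp (- K * ?t) * norm (integral {0..?t} (g Y) - integral {0..?t} (g Z)) \<le>
         exp (- K * ?t) * (L * ?d / K * exp (K * ?t))"
        by (intro mult_left_mono) auto
      also have "\<dots> = L * ?d / K" by (simp add: exp_minus field_simps)
      also have "\<dots> \<le> 1 / 2 * ?d"
      proof -
        have "L * ?d * 2 \<le> K * ?d" unfolding K_def using L by (simp add: algebra_simps)
        then show ?thesis using K by (simp add: field_simps)
      qed
      finally show "dist (apply_bcontfun (Q Y) t) (apply_bcontfun (Q Z) t) \<le> 1 / 2 * ?d"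
        unfolding Q P_def dist_real_def by (simp add: right_diff_distrib[symmetric] abs_mult)
    qed
  qed auto
  then obtain Y where "Q Y = Y" by auto
  then have Y: "apply_bcontfun Y t = P (apply_bcontfun Y) t" for t using Q by metis
  define X where "X t = x0 + integral {0..t} (g (apply_bcontfun Y))" for t
  have XY: "exp (K * t) * apply_bcontfun Y t = X t" if "t \<in> {0..T}" for t
    using clT[OF that] by (subst Y) (simp add: P_def X_def exp_minus)
  show ?thesis
  proof (rule that[of X])
    show "X 0 = x0" by (simp add: X_def)
    fix t assume t: "t \<in> {0..T}"
    have "((\<lambda>t. integral {0..t} (g (apply_bcontfun Y))) has_real_derivative g (apply_bcontfun Y) t) (at t within {0..T})"
      by (rule integral_has_real_derivative[OF cg[OF cY] t])
    then show "(X has_real_derivative f t (X t)) (at t within {0..T})"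
      unfolding X_def[abs_def] using XY[OF t]
      by (auto intro!: derivative_eq_intros simp: g_def X_def)
  qed
qed

text \<open>A time derivative at the point together with a continuous space derivative gives joint
  differentiability there, hence the chain rule along a curve, also one-sidedly at the ends of a
  time interval.\<close>

lemma has_real_derivative_along:
  fixes g :: "real \<Rightarrow> real \<Rightarrow> real"
  assumes "((\<lambda>s. g s (Y t)) has_real_derivative gt) (at t within S)"
    and "\<And>s x. s \<in> S \<Longrightarrow> (g s has_real_derivative gx s x) (at x)"
    and "continuous_on (S \<times> UNIV) (\<lambda>(s, x). gx s x)"
    and "(Y has_real_derivative Y') (at t within S)" and t: "t \<in> S"
  shows "((\<lambda>s. g s (Y s)) has_real_derivative gt + gx t (Y t) * Y') (at t within S)"
proof -
  have "((\<lambda>(s, x). g s x) has_derivative (\<lambda>(a, b). gt * a + blinfun_apply (blinfun_mult_right (gx t (Y t))) b))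
      (at (t, Y t) within S \<times> UNIV)"
  proof (rule has_derivative_partialsI[where fy="\<lambda>s x. blinfun_mult_right (gx s x)"])
    show "((\<lambda>s. g s (Y t)) has_derivative (*) gt) (at t within S)"
      using assms(1) by (simp add: has_field_derivative_def)
    show "(g s has_derivative blinfun_apply (blinfun_mult_right (gx s x))) (at x within UNIV)" if "s \<in> S" for s x
      using assms(2)[OF that, of x] by (simp add: has_field_derivative_def)
    have "((\<lambda>(s, x). gx s x) \<longlongrightarrow> gx t (Y t)) (at (t, Y t) within S \<times> UNIV)"
      using assms(3) t by (auto simp: continuous_on_def)
    then have "((\<lambda>z. blinfun_mult_right ((\<lambda>(s, x). gx s x) z)) \<longlongrightarrow> blinfun_mult_right (gx t (Y t)))
        (at (t, Y t) within S \<times> UNIV)"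
      by (rule bounded_linear.tendsto[OF bounded_linear_blinfun_mult_right])
    then show "continuous (at (t, Y t) within S \<times> UNIV) (\<lambda>(s, x). blinfun_mult_right (gx s x))"
      by (simp add: continuous_within split_def)
  qed auto
  then have 1: "((\<lambda>(s, x). g s x) has_derivative (\<lambda>(a, b). gt * a + gx t (Y t) * b))
      (at (t, Y t) within S \<times> UNIV)" by simp
  have 2: "((\<lambda>s. (s, Y s)) has_derivative (\<lambda>h. (h, Y' * h))) (at t within S)"
    using assms(4) by (auto intro!: derivative_eq_intros simp: has_field_derivative_def)
  have "((\<lambda>s. (\<lambda>(s, x). g s x) (s, Y s)) has_derivative (\<lambda>h. (\<lambda>(a, b). gt * a + gx t (Y t) * b) (h, Y' * h)))
      (at t within S)"
    by (rule has_derivative_in_compose[OF 2 has_derivative_subset[OF 1]]) auto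
  moreover have "(\<lambda>h. (\<lambda>(a, b). gt * a + gx t (Y t) * b) (h, Y' * h)) = (*) (gt + gx t (Y t) * Y')"
    by (auto simp: fun_eq_iff algebra_simps)
  ultimately show ?thesis by (simp add: has_field_derivative_def)
qed

lemma continuous_on_slice:
  assumes "continuous_on (S \<times> UNIV) (\<lambda>(t, x). g t x)" "t \<in> S"
  shows "continuous_on A (\<lambda>x. g t x)"
proof -
  have "continuous_on A ((\<lambda>(t, x). g t x) \<circ> (\<lambda>x. (t, x)))"
    by (intro continuous_on_compose continuous_intros continuous_on_subset[OF assms(1)]) (use assms(2) in auto)
  then show ?thesis by (simp add: o_def)
qed

text \<open>\<open>r\<close> dominates \<open>q = b + a \<integral> r\<^sup>2\<close>, and \<open>1 / q\<close> decreases at rate \<open>a\<close>.\<close>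

lemma riccati_blow_up:
  fixes r sg :: "real \<Rightarrow> real"
  assumes T: "T > 0" and a: "a > 0" and k: "k \<ge> 0" "k' \<ge> 0" and b: "b > 0" "a * b * T > 1"
    and csg: "continuous_on {0..T} sg"
    and r: "\<And>t. t \<in> {0..T} \<Longrightarrow> (r has_real_derivative r' t) (at t within {0..T})"
    and r': "\<And>t. t \<in> {0..T} \<Longrightarrow> r' t \<ge> a * (r t)\<^sup>2 - k * (sg t)\<^sup>2 - k'"
    and S: "integral {0..T} (\<lambda>s. (sg s)\<^sup>2) \<le> S0"
    and r0: "r 0 \<ge> b + k * S0 + k' * T"
  shows False
proof -
  have cr: "continuous_on {0..T} r" using r by (rule DERIV_continuous_on)
  define I where "I t = integral {0..t} (\<lambda>s. (sg s)\<^sup>2)" for t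
  define J where "J t = integral {0..t} (\<lambda>s. (r s)\<^sup>2)" for t
  have I: "(I has_real_derivative (sg t)\<^sup>2) (at t within {0..T})" if "t \<in> {0..T}" for t
    unfolding I_def[abs_def] using csg that by (intro integral_has_real_derivative continuous_intros)
  have J: "(J has_real_derivative (r t)\<^sup>2) (at t within {0..T})" if "t \<in> {0..T}" for t
    unfolding J_def[abs_def] using cr that by (intro integral_has_real_derivative continuous_intros)
  have I0: "I 0 = 0" "J 0 = 0" by (simp_all add: I_def J_def)
  have IT: "I t \<le> S0" if "t \<in> {0..T}" for t
  proof -
    have "I t \<le> I T" unfolding I_def
      by (rule integral_subset_le)
         (use that csg in \<open>auto intro!: integrable_continuous_real continuous_intros elim: continuous_on_subset\<close>)
    with S show ?thesis by (simp add: I_def)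
  qed
  have J0: "J t \<ge> 0" if "t \<in> {0..T}" for t unfolding J_def
    using that cr by (intro integral_nonneg integrable_continuous_real continuous_intros) (auto elim: continuous_on_subset)
  define q where "q t = b + a * J t" for t
  have q0: "q t > 0" if "t \<in> {0..T}" for t using J0[OF that] a b by (simp add: q_def add_pos_nonneg)
  \<comment> \<open>The integrated Riccati inequality: the reserve \<open>k * S0 + k' * T\<close>
    contained in \<open>r 0\<close> pays for all losses, however they are distributed in
    time.\<close>
  have rq: "r t \<ge> q t" if t: "t \<in> {0..T}" for t
  proof -
    have "r 0 - a * J 0 + k * I 0 + k' * 0 \<le> r t - a * J t + k * I t + k' * t"
      by (rule has_real_derivative_nonneg_le[where T=T and f="\<lambda>t. r t - a * J t + k * I t + k' * t" 
            and f'="\<lambda>t. r' t - a * (r t)\<^sup>2 + k * (sg t)\<^sup>2 + k'"])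
         (use t r' in \<open>force intro!: derivative_eq_intros r I J simp: algebra_simps\<close>)+
    moreover have "k * I t \<le> k * S0" using IT[OF t] k by (intro mult_left_mono) auto
    moreover have "k' * t \<le> k' * T" using k t by (intro mult_left_mono) auto
    ultimately show ?thesis using r0 by (simp add: q_def I0)
  qed
  \<comment> \<open>Since (1/q)' = - a r^2 / q^2 \<le> - a, the positive quantity 1/q would end at
    time \<open>T\<close> below \<open>inverse b - a * T\<close>, which is negative.\<close>
  have "- inverse (q 0) - a * 0 \<le> - inverse (q T) - a * T"
  proof (rule has_real_derivative_nonneg_le[where T=T and f="\<lambda>t. - inverse (q t) - a * t" 
            and f'="\<lambda>t. a * (r t)\<^sup>2 / (q t)\<^sup>2 - a"])
    fix s assume s: "s \<in> {0..T}"
    have q: "(q has_real_derivative a * (r s)\<^sup>2) (at s within {0..T})"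
      unfolding q_def[abs_def] by (auto intro!: derivative_eq_intros J s)
    have "((\<lambda>t. - inverse (q t) - a * t) has_real_derivative
        - (- (inverse (q s) * (a * (r s)\<^sup>2) * inverse (q s))) - a) (at s within {0..T})"
      using q0[OF s] by (intro DERIV_diff DERIV_minus DERIV_inverse' q DERIV_cmult_Id) auto
    then show "((\<lambda>t. - inverse (q t) - a * t) has_real_derivative a * (r s)\<^sup>2 / (q s)\<^sup>2 - a) (at s within {0..T})"
      by (simp add: divide_inverse power2_eq_square mult_ac)
    have "(q s)\<^sup>2 \<le> (r s)\<^sup>2" using rq[OF s] q0[OF s] by (intro power_mono) auto
    then have "a * (q s)\<^sup>2 \<le> a * (r s)\<^sup>2" using a by (intro mult_left_mono) auto
    then show "a * (r s)\<^sup>2 / (q s)\<^sup>2 - a \<ge> 0" using q0[OF s] by (simp add: field_simps)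
  qed (use T in auto)
  then have "inverse (q T) \<le> inverse b - a * T" by (simp add: q_def I0)
  moreover have "inverse b < a * T" using b by (simp add: field_simps)
  ultimately have "inverse (q T) < 0" by linarith
  with q0[of T] T show False by simp
qed

text \<open>With \<open>d\<close> for \<plusminus>c'(u), \<open>r\<close> for y + c p, and
  \<open>v\<close>, \<open>v'\<close> for the noise and its x-derivative, the right side is the
  derivative of \<plusminus>(y + c p) along the characteristic. The coefficient of r^2 is at least m
  / (4 c2); half of it is spent by Young's inequality on the term linear in \<open>r\<close>, while
  the term linear in \<sigma> goes into \<sigma>^2 + 1.\<close>

lemma riccati_coefficients:
  fixes c1 c2 c3 C d m v v' r \<sigma> e :: real
  assumes "c1 > 0" "c1 \<le> C" "C \<le> c2" "m > 0" "m \<le> d" "d \<le> c3" "\<bar>v\<bar> \<le> 1" "\<bar>v'\<bar> \<le> 1" "\<bar>e\<bar> = 1"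
  defines "q \<equiv> c3 / (2 * c1)"
  shows "m / (8 * c2) * r\<^sup>2 - 3 * q / 2 * \<sigma>\<^sup>2 - (2 * q\<^sup>2 * c2 / m + q + c2)
    \<le> d * (r\<^sup>2 - \<sigma>\<^sup>2) / (4 * C) + d * v * (r - \<sigma>) / (2 * C) + e * C * v'"
proof -
  have C: "C > 0" "c2 > 0" and d: "d > 0" "c3 > 0" using assms by auto
  then have q: "q > 0" using assms by (simp add: q_def)
  have dC: "d / (2 * C) \<le> q" unfolding q_def using assms C d by (intro frac_le) auto
  have "m / (4 * c2) \<le> d / (4 * C)" using assms C d by (intro frac_le) auto
  then have 1: "m / (4 * c2) * r\<^sup>2 \<le> d / (4 * C) * r\<^sup>2" by (intro mult_right_mono) auto
  have 2: "d / (4 * C) * \<sigma>\<^sup>2 \<le> q / 2 * \<sigma>\<^sup>2" using dC by (intro mult_right_mono) (auto simp: field_simps)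
  have B3: "\<bar>d / (2 * C) * v * (r - \<sigma>)\<bar> \<le> q * 1 * (\<bar>r\<bar> + \<bar>\<sigma>\<bar>)"
    unfolding abs_mult using dC C d assms q by (intro mult_mono) auto
  have 3: "d / (2 * C) * v * (r - \<sigma>) \<ge> - (q * \<bar>r\<bar>) - q * \<bar>\<sigma>\<bar>"
    using abs_le_D2[OF B3] unfolding distrib_left mult_1_right by argo
  have 4: "q * \<bar>r\<bar> \<le> m / (8 * c2) * r\<^sup>2 + 2 * q\<^sup>2 * c2 / m"
  proof -
    \<comment> \<open>Young's inequality as a completed square, balanced so that exactly m / (8 c2)
      of r^2 is used.\<close>
    have "0 \<le> (m * \<bar>r\<bar> - 4 * c2 * q)\<^sup>2" by simp
    also have "\<dots> = m\<^sup>2 * r\<^sup>2 + 16 * c2\<^sup>2 * q\<^sup>2 - 8 * c2 * m * (q * \<bar>r\<bar>)"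
      by (simp add: power2_diff power_mult_distrib algebra_simps)
    also have "m\<^sup>2 * r\<^sup>2 + 16 * c2\<^sup>2 * q\<^sup>2 = 8 * c2 * m * (m / (8 * c2) * r\<^sup>2 + 2 * q\<^sup>2 * c2 / m)"
      using C assms(4) by (simp add: field_simps power2_eq_square)
    finally have "8 * c2 * m * (q * \<bar>r\<bar>) \<le> 8 * c2 * m * (m / (8 * c2) * r\<^sup>2 + 2 * q\<^sup>2 * c2 / m)"
      by simp
    then show ?thesis using C assms(4) by (subst (asm) mult_le_cancel_left_pos) auto
  qed
  have "\<bar>\<sigma>\<bar> \<le> \<sigma>\<^sup>2 + 1" using sum_squares_bound[of "\<bar>\<sigma>\<bar>" 1] by simp
  then have 5: "q * \<bar>\<sigma>\<bar> \<le> q * \<sigma>\<^sup>2 + q" using q mult_left_mono[of "\<bar>\<sigma>\<bar>" "\<sigma>\<^sup>2 + 1" q] by (simp add: algebra_simps)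
  have "\<bar>e * C * v'\<bar> \<le> 1 * c2 * 1" unfolding abs_mult using assms C by (intro mult_mono) auto
  then have 6: "e * C * v' \<ge> - c2" by (simp add: abs_le_iff)
  have "d * (r\<^sup>2 - \<sigma>\<^sup>2) / (4 * C) = d / (4 * C) * r\<^sup>2 - d / (4 * C) * \<sigma>\<^sup>2"
    and "d * v * (r - \<sigma>) / (2 * C) = d / (2 * C) * v * (r - \<sigma>)"
    and "m / (4 * c2) * r\<^sup>2 = m / (8 * c2) * r\<^sup>2 + m / (8 * c2) * r\<^sup>2"
    and "3 * q / 2 * \<sigma>\<^sup>2 = q / 2 * \<sigma>\<^sup>2 + q * \<sigma>\<^sup>2"
    by (simp_all add: add_divide_distrib diff_divide_distrib algebra_simps)
  then show ?thesis using 1 2 3 4 5 6 by argo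
qed

text \<open>Here \<open>p = u\<^sub>x\<close>, \<open>y = u\<^sub>t - w\<close>, and \<open>w\<close> is the noise path.\<close>

locale wave_path =
  fixes c c' :: "real \<Rightarrow> real" and c1 c2 c3 T :: real and u p y w px yx wx :: "real \<Rightarrow> real \<Rightarrow> real"
  assumes T: "0 < T" "T \<le> 1" and c1: "c1 > 0" and c3: "c3 > 0"
    and c: "\<And>z. c1 \<le> c z" "\<And>z. c z \<le> c2"
    and dc: "\<And>z. (c has_real_derivative c' z) (at z)"
    and cc': "continuous_on UNIV c'" and c': "\<And>z. \<bar>c' z\<bar> \<le> c3"
    and cu: "continuous_on ({0..T} \<times> UNIV) (\<lambda>(t, x). u t x)"
    and cp: "continuous_on ({0..T} \<times> UNIV) (\<lambda>(t, x). p t x)"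
    and cy: "continuous_on ({0..T} \<times> UNIV) (\<lambda>(t, x). y t x)"
    and cw: "continuous_on ({0..T} \<times> UNIV) (\<lambda>(t, x). w t x)"
    and cpx: "continuous_on ({0..T} \<times> UNIV) (\<lambda>(t, x). px t x)"
    and cyx: "continuous_on ({0..T} \<times> UNIV) (\<lambda>(t, x). yx t x)"
    and cwx: "continuous_on ({0..T} \<times> UNIV) (\<lambda>(t, x). wx t x)"
    and u_x: "\<And>t x. t \<in> {0..T} \<Longrightarrow> (u t has_real_derivative p t x) (at x)"
    and p_x: "\<And>t x. t \<in> {0..T} \<Longrightarrow> (p t has_real_derivative px t x) (at x)"
    and y_x: "\<And>t x. t \<in> {0..T} \<Longrightarrow> (y t has_real_derivative yx t x) (at x)"
    and u_t: "\<And>t x. t \<in> {0..T} \<Longrightarrow>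
        ((\<lambda>s. u s x) has_real_derivative y t x + w t x) (at t within {0..T})"
    and p_t: "\<And>t x. t \<in> {0..T} \<Longrightarrow>
        ((\<lambda>s. p s x) has_real_derivative yx t x + wx t x) (at t within {0..T})"
    and y_t: "\<And>t x. t \<in> {0..T} \<Longrightarrow>
        ((\<lambda>s. y s x) has_real_derivative (c (u t x))\<^sup>2 * px t x + c (u t x) * c' (u t x) * (p t x)\<^sup>2)
          (at t within {0..T})"
    and per: "\<And>t x. t \<in> {0..T} \<Longrightarrow> u t (x + 1) = u t x" "\<And>t x. t \<in> {0..T} \<Longrightarrow> p t (x + 1) = p t x"
      "\<And>t x. t \<in> {0..T} \<Longrightarrow> y t (x + 1) = y t x"
    and w: "\<And>t x. t \<in> {0..T} \<Longrightarrow> \<bar>w t x\<bar> \<le> 1" "\<And>t x. t \<in> {0..T} \<Longrightarrow> \<bar>wx t x\<bar> \<le> 1"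
begin

lemma c_pos: "c z > 0" using c(1)[of z] c1 by linarith

text \<open>Periodicity reduces the claim to the compact set \<open>{0..T} \<times> {0..1}\<close>.
  The bound is qualitative: it supplies the Lipschitz constant of the characteristic field and
  enters no quantitative estimate.\<close>

lemma p_bounded: "\<exists>B. \<forall>t\<in>{0..T}. \<forall>x. \<bar>p t x\<bar> \<le> B"
proof -
  have "compact ((\<lambda>(t, x). p t x) ` ({0..T} \<times> {0..1}))"
    by (intro compact_continuous_image compact_Times continuous_on_subset[OF cp]) auto
  then obtain B where B: "\<And>t x. t \<in> {0..T} \<Longrightarrow> x \<in> {0..1} \<Longrightarrow> \<bar>p t x\<bar> \<le> B"
    by (fastforce dest: compact_imp_bounded simp: bounded_iff)
  have pk: "p t (x + real_of_int k) = p t x" if "t \<in> {0..T}" for t x k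
  proof (induction k rule: int_induct[where k=0])
    case (step1 i) then show ?case using per(2)[OF that, of "x + real_of_int i"] by (simp add: algebra_simps)
  next
    case (step2 i) then show ?case using per(2)[OF that, of "x + real_of_int i - 1"] by (simp add: algebra_simps)
  qed simp
  have "\<bar>p t x\<bar> \<le> B" if "t \<in> {0..T}" for t x
    using B[OF that, of "frac x"] pk[OF that, of "frac x" "\<lfloor>x\<rfloor>"] frac_ge_0[of x] frac_lt_1[of x]
    by (simp add: frac_def)
  then show ?thesis by blast
qed

text \<open>The field - c(u(t,x)) is bounded and globally Lipschitz in x, so its solution lives on
  all of [0,T]. It starts at 0, the point where the datum will be steep.\<close>

lemma characteristic_exists:
  obtains X where "X 0 = 0"
    and "\<And>t. t \<in> {0..T} \<Longrightarrow> (X has_real_derivative - c (u t (X t))) (at t within {0..T})"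
proof -
  obtain B where B: "\<And>t x. t \<in> {0..T} \<Longrightarrow> \<bar>p t x\<bar> \<le> B" using p_bounded by blast
  have ccu: "continuous_on UNIV c" using dc by (auto intro: DERIV_continuous_on DERIV_subset)
  show ?thesis
  proof (rule picard_lindelof[of T "\<lambda>t x. - c (u t x)" "c3 * B" c2 0])
    show "continuous_on ({0..T} \<times> UNIV) (\<lambda>(t, x). - c (u t x))"
      using continuous_on_compose2[OF ccu cu] by (auto simp: split_def intro!: continuous_intros)
    show "\<bar>- c (u t x)\<bar> \<le> c2" for t x using c(2)[of "u t x"] c_pos[of "u t x"] by auto
    show "\<bar>- c (u t x) - - c (u t x')\<bar> \<le> c3 * B * \<bar>x - x'\<bar>" if t: "t \<in> {0..T}" for t x x'
    proof -
      have "norm (c (u t x) - c (u t x')) \<le> c3 * B * norm (x - x')"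
      proof (rule field_differentiable_bound[where S=UNIV])
        show "((\<lambda>x. c (u t x)) has_field_derivative c' (u t z) * p t z) (at z within UNIV)" for z
          using DERIV_chain2[OF dc u_x[OF t]] by simp
        show "norm (c' (u t z) * p t z) \<le> c3 * B" for z
          using c'[of "u t z"] B[OF t, of z] by (auto simp: abs_mult intro!: mult_mono)
      qed auto
      then show ?thesis by simp
    qed
  qed (use T that in auto)
qed

section \<open>Local energy balance\<close>

definition energy :: "real \<Rightarrow> real \<Rightarrow> real" where
  "energy t x = ((y t x)\<^sup>2 + (c (u t x) * p t x)\<^sup>2) / 2"

definition energy_x :: "real \<Rightarrow> real \<Rightarrow> real" where
  "energy_x t x = y t x * yx t x
     + c (u t x) * p t x * (c' (u t x) * (p t x)\<^sup>2 + c (u t x) * px t x)"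

text \<open>The evolution equations for \<open>u\<close>, \<open>p\<close> and \<open>y\<close> are
  already substituted here.\<close>

definition energy_t :: "real \<Rightarrow> real \<Rightarrow> real" where
  "energy_t t x = y t x * ((c (u t x))\<^sup>2 * px t x + c (u t x) * c' (u t x) * (p t x)\<^sup>2)
     + c (u t x) * p t x * (c' (u t x) * (y t x + w t x) * p t x + c (u t x) * (yx t x + wx t x))"

definition flux :: "real \<Rightarrow> real \<Rightarrow> real" where
  "flux t x = (c (u t x))\<^sup>2 * y t x * p t x"

definition flux_x :: "real \<Rightarrow> real \<Rightarrow> real" where
  "flux_x t x = 2 * c (u t x) * c' (u t x) * p t x * y t x * p t x
     + (c (u t x))\<^sup>2 * (yx t x * p t x + y t x * px t x)"

text \<open>Everything the noise contributes to the energy balance; it vanishes together with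
  \<open>w\<close> and \<open>wx\<close>.\<close>

definition src :: "real \<Rightarrow> real \<Rightarrow> real" where
  "src t x = c (u t x) * c' (u t x) * w t x * (p t x)\<^sup>2 + (c (u t x))\<^sup>2 * p t x * wx t x"

text \<open>The terms with \<open>px\<close> and \<open>yx\<close> and the cubic terms in y and p
  combine to an exact x-derivative; what is left carries a factor \<open>w\<close> or
  \<open>wx\<close>.\<close>

lemma energy_t_eq: "energy_t t x = flux_x t x + src t x"
  by (simp add: energy_t_def flux_x_def src_def power2_eq_square algebra_simps)

lemma energy_has_x_derivative:
  assumes "t \<in> {0..T}" shows "(energy t has_real_derivative energy_x t x) (at x)"
  unfolding energy_def[abs_def] energy_x_def
  by (rule derivative_eq_intros u_x p_x y_x assms DERIV_chain2[OF dc] refl)+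
     (simp add: divide_simps, simp add: power2_eq_square algebra_simps)

lemma flux_has_x_derivative:
  assumes "t \<in> {0..T}" shows "(flux t has_real_derivative flux_x t x) (at x)"
  unfolding flux_def[abs_def] flux_x_def
  by (rule derivative_eq_intros u_x p_x y_x assms DERIV_chain2[OF dc] refl)+
     (simp add: power2_eq_square algebra_simps)

lemma energy_has_t_derivative:
  assumes "t \<in> {0..T}" shows "((\<lambda>s. energy s x) has_real_derivative energy_t t x) (at t within {0..T})"
  unfolding energy_def[abs_def] energy_t_def
  by (rule derivative_eq_intros u_t p_t y_t assms DERIV_chain2[OF dc] refl)+
     (simp add: divide_simps, simp add: power2_eq_square algebra_simps)

lemma energy_nonneg: "energy t x \<ge> 0" by (simp add: energy_def)

text \<open>Finite propagation speed in infinitesimal form: the flux is c times the product of y and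
  c p, and this product is at most the energy in modulus.\<close>

lemma abs_flux_le: "\<bar>flux t x\<bar> \<le> c2 * energy t x"
proof -
  have "\<bar>flux t x\<bar> = c (u t x) * (\<bar>y t x\<bar> * \<bar>c (u t x) * p t x\<bar>)"
    using c_pos[of "u t x"] by (simp add: flux_def abs_mult power2_eq_square)
  also have "\<dots> \<le> c (u t x) * energy t x"
    using sum_squares_bound[of "\<bar>y t x\<bar>" "\<bar>c (u t x) * p t x\<bar>"] c_pos[of "u t x"]
    by (intro mult_left_mono) (auto simp: energy_def)
  also have "\<dots> \<le> c2 * energy t x" by (intro mult_right_mono c energy_nonneg)
  finally show ?thesis .
qed

text \<open>The noise multiplies terms quadratic and linear in \<open>p\<close>, both dominated by
  the energy plus a constant. Hence a linear Gronwall estimate suffices, with a rate depending on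
  c1, c2, c3 alone.\<close>

lemma abs_src_le:
  assumes "t \<in> {0..T}" shows "\<bar>src t x\<bar> \<le> (2 * c3 / c1 + c2) * energy t x + c2"
proof -
  define C P where "C = c (u t x)" and "P = C * p t x"
  have C: "C > 0" "C \<le> c2" "c1 \<le> C" using c_pos c by (auto simp: C_def)
  have P2: "P\<^sup>2 \<le> 2 * energy t x" by (simp add: energy_def P_def C_def)
  have 1: "\<bar>C * c' (u t x) * w t x * (p t x)\<^sup>2\<bar> \<le> c3 / c1 * (2 * energy t x)"
  proof -
    have "C * c' (u t x) * w t x * (p t x)\<^sup>2 = (c' (u t x) / C * w t x) * P\<^sup>2"
      using C by (simp add: P_def power2_eq_square field_simps)
    moreover have "\<bar>c' (u t x) / C * w t x\<bar> \<le> c3 / c1 * 1"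
      unfolding abs_mult abs_divide using C c' w(1)[OF assms] c1 c3
      by (intro mult_mono frac_le) (auto intro: order_trans[OF abs_ge_zero])
    ultimately have "\<bar>C * c' (u t x) * w t x * (p t x)\<^sup>2\<bar> = \<bar>c' (u t x) / C * w t x\<bar> * P\<^sup>2"
      by (simp only: abs_mult abs_power2)
    also have "\<dots> \<le> c3 / c1 * (2 * energy t x)"
      using \<open>\<bar>c' (u t x) / C * w t x\<bar> \<le> c3 / c1 * 1\<close> P2 c1 c3 by (intro mult_mono) auto
    finally show ?thesis .
  qed
  have 2: "\<bar>C\<^sup>2 * p t x * wx t x\<bar> \<le> c2 * (1 + energy t x)"
  proof -
    have "\<bar>P\<bar> \<le> 1 + energy t x"
      using P2 sum_squares_bound[of "\<bar>P\<bar>" 1] by simp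
    then have "\<bar>P\<bar> * \<bar>wx t x\<bar> \<le> (1 + energy t x) * 1"
      using w(2)[OF assms] energy_nonneg by (intro mult_mono) auto
    then have "C * (\<bar>P\<bar> * \<bar>wx t x\<bar>) \<le> c2 * (1 + energy t x)"
      using C energy_nonneg[of t x] by (intro mult_mono) auto
    moreover have "\<bar>C\<^sup>2 * p t x * wx t x\<bar> = C * (\<bar>P\<bar> * \<bar>wx t x\<bar>)"
      using C by (simp add: P_def abs_mult power2_eq_square)
    ultimately show ?thesis by simp
  qed
  have "\<bar>src t x\<bar> \<le> \<bar>C * c' (u t x) * w t x * (p t x)\<^sup>2\<bar> + \<bar>C\<^sup>2 * p t x * wx t x\<bar>"
    unfolding src_def C_def by (rule abs_triangle_ineq)
  with 1 2 show ?thesis by (simp add: algebra_simps)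
qed

lemma energy_per: "t \<in> {0..T} \<Longrightarrow> energy t (x + 1) = energy t x"
  and flux_per: "t \<in> {0..T} \<Longrightarrow> flux t (x + 1) = flux t x"
  by (simp_all add: energy_def flux_def per)

section \<open>Energy in the frame of the characteristic\<close>

lemma continuous_on_shift:
  assumes "continuous_on ({0..T} \<times> UNIV) (\<lambda>(t, x). g t x)" "continuous_on {0..T} X"
  shows "continuous_on ({0..T} \<times> A) (\<lambda>(t, z). g t (X t + z :: real))"
proof -
  have "continuous_on ({0..T} \<times> A) ((\<lambda>(t, x). g t x) \<circ> (\<lambda>v. (fst v, X (fst v) + snd v)))"
    by (intro continuous_on_compose continuous_intros continuous_on_subset[OF assms(1)]
        continuous_on_compose2[OF assms(2)]) auto
  then show ?thesis by (simp add: o_def split_def)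
qed

lemma continuous_on_along:
  assumes "continuous_on ({0..T} \<times> UNIV) (\<lambda>(t, x). g t x)" "continuous_on {0..T} X"
  shows "continuous_on {0..T} (\<lambda>t. g t (X t :: real))"
proof -
  have "continuous_on {0..T} ((\<lambda>(t, x). g t x) \<circ> (\<lambda>t. (t, X t)))"
    by (intro continuous_on_compose continuous_intros continuous_on_subset[OF assms(1)] assms(2)) auto
  then show ?thesis by (simp add: o_def)
qed

lemma ccu: "continuous_on A (\<lambda>v. c (h v))" if "continuous_on A h"
  by (rule continuous_on_compose2[OF _ that, of UNIV]) (use dc in \<open>auto intro: DERIV_continuous_on DERIV_subset\<close>)

lemma ccu': "continuous_on A (\<lambda>v. c' (h v))" if "continuous_on A h"
  by (rule continuous_on_compose2[OF cc' that]) auto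

lemmas cont_fields = cu[unfolded split_def] cp[unfolded split_def] cy[unfolded split_def] cw[unfolded split_def]
  cpx[unfolded split_def] cyx[unfolded split_def] cwx[unfolded split_def]

lemma cont_energy:
  "continuous_on ({0..T} \<times> UNIV) (\<lambda>(t, x). energy t x)"
  "continuous_on ({0..T} \<times> UNIV) (\<lambda>(t, x). energy_x t x)"
  "continuous_on ({0..T} \<times> UNIV) (\<lambda>(t, x). energy_t t x)"
  "continuous_on ({0..T} \<times> UNIV) (\<lambda>(t, x). flux t x)"
  "continuous_on ({0..T} \<times> UNIV) (\<lambda>(t, x). src t x)"
  unfolding split_def energy_def energy_x_def energy_t_def flux_def src_def
  by (intro continuous_intros ccu ccu' cont_fields; simp)+

text \<open>Gronwall rate of the weighted energy: \<open>2 * c2\<close> pays for differentiating the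
  weight, the rest is the rate in \<open>abs_src_le\<close>, and the whole also exceeds the constant
  \<open>2 * c2\<close> left by the source. It depends only on c1, c2 and c3, so it can be fixed
  before \<open>T\<close> and the datum.\<close>

definition growth :: real where "growth = 2 * c2 + 2 * c3 / c1 + c2"

lemma c2: "c2 > 0" using c(2)[of 0] c_pos[of 0] by linarith

lemma growth_nonneg: "growth \<ge> 0" using c1 c3 c2 by (simp add: growth_def)

text \<open>The weight \<open>1 + z\<close> on the moving period \<open>[X, X + 1]\<close> makes the boundary terms produce the
  dissipation \<open>- (c/2) (y - c p)\<^sup>2\<close> at \<open>X\<close>, so that one Gronwall estimate controls both the energy
  and the time integral of \<open>(y - c p)\<^sup>2\<close> along the characteristic.\<close>

lemma weighted_energy:
  assumes X: "\<And>t. t \<in> {0..T} \<Longrightarrow> (X has_real_derivative - c (u t (X t))) (at t within {0..T})"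
  defines "E \<equiv> \<lambda>t. integral {0..1} (\<lambda>z. (1 + z) * energy t (X t + z))"
  obtains E' where "\<And>t. t \<in> {0..T} \<Longrightarrow> (E has_real_derivative E' t) (at t within {0..T})"
    and "\<And>t. t \<in> {0..T} \<Longrightarrow>
      E' t \<le> - (c1 / 2) * (y t (X t) - c (u t (X t)) * p t (X t))\<^sup>2 + growth * (E t + 1)"
proof -
  have cX: "continuous_on {0..T} X" using X by (rule DERIV_continuous_on)
  have cS: "continuous_on ({0..T} \<times> A) (\<lambda>(t, z). g t (X t + z))"
    if "continuous_on ({0..T} \<times> UNIV) (\<lambda>(t, x). g t x)" for g :: "real \<Rightarrow> real \<Rightarrow> real" and A
    using continuous_on_shift[OF that cX] .
  have cZ: "continuous_on A (\<lambda>z. g t (X t + z))"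
    if "continuous_on ({0..T} \<times> UNIV) (\<lambda>(t, x). g t x)" "t \<in> {0..T}" for g :: "real \<Rightarrow> real \<Rightarrow> real" and A t
    using continuous_on_slice[OF cS[OF that(1)] that(2)] .
  define k where "k t = c (u t (X t))" for t
  have ck: "continuous_on {0..T} k" unfolding k_def by (rule ccu[OF continuous_on_along[OF cu cX]])
  define D where "D t z = (1 + z) * (energy_t t (X t + z) + energy_x t (X t + z) * - k t)" for t z
  have D: "((\<lambda>s. (1 + z) * energy s (X s + z)) has_real_derivative D t z) (at t within {0..T})"
    if t: "t \<in> {0..T}" for t z
    unfolding D_def k_def
    by (intro DERIV_cmult has_real_derivative_along[where gx=energy_x and Y="\<lambda>s. X s + z"]
         energy_has_t_derivative[OF t] energy_has_x_derivative cont_energy t)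
       (auto intro!: derivative_eq_intros X t)
  have cD: "continuous_on ({0..T} \<times> cbox 0 1) (\<lambda>(t, z). D t z)"
    using cS[OF cont_energy(3), of "{0..1}"] cS[OF cont_energy(2), of "{0..1}"] unfolding D_def split_def
    by (auto intro!: continuous_intros continuous_on_compose2[OF ck])
  have iE: "(\<lambda>z. (1 + z) * energy t (X t + z)) integrable_on cbox 0 1" if "t \<in> {0..T}" for t
    using cZ[OF cont_energy(1) that, of "{0..1}"] by (auto intro!: integrable_continuous_real continuous_intros)
  define E' where "E' t = integral {0..1} (D t)" for t
  show ?thesis
  proof (rule that[of E'])
    fix t assume t: "t \<in> {0..T}"
    show "(E has_real_derivative E' t) (at t within {0..T})"
    proof -
      have "((\<lambda>t. integral (cbox 0 1) (\<lambda>z. (1 + z) * energy t (X t + z))) has_real_derivative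
          integral (cbox 0 1) (D t)) (at t within {0..T})"
        by (rule leibniz_rule_field_derivative[where f="\<lambda>t z. (1 + z) * energy t (X t + z)"
              and fx="\<lambda>t z. D t z"]) (rule D iE cD t convex_real_interval | assumption)+
      then show ?thesis by (simp only: E_def E'_def cbox_interval)
    qed
    \<comment> \<open>In coordinates moving with \<open>X\<close> the energy obeys a balance law
      with flux \<open>m\<close>: the frame has velocity - k, hence the extra
      \<open>- k t * energy\<close>.\<close>
    define m where "m z = flux t (X t + z) - k t * energy t (X t + z)" for z
    define m' where "m' z = flux_x t (X t + z) - k t * energy_x t (X t + z)" for z
    have m: "(m has_real_derivative m' z) (at z)" for z
      unfolding m_def[abs_def] m'_def
      using DERIV_chain2[OF flux_has_x_derivative[OF t] DERIV_add[OF DERIV_const DERIV_ident], of "X t" z UNIV]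
        DERIV_chain2[OF energy_has_x_derivative[OF t] DERIV_add[OF DERIV_const DERIV_ident], of "X t" z UNIV]
      by (intro DERIV_diff DERIV_cmult) simp_all
    have cm: "continuous_on A m" for A using m by (auto intro: DERIV_continuous_on DERIV_subset)
    \<comment> \<open>Integration by parts against the weight: with m(1) = m(0) by periodicity, the
      boundary terms 2 m(1) - m(0) collapse to m(0).\<close>
    have "((\<lambda>z. (1 + z) * m' z + m z) has_integral ((1 + 1) * m 1 - (1 + 0) * m 0)) {0..1}"
      by (rule fundamental_theorem_of_calculus)
         (auto intro!: derivative_eq_intros DERIV_subset[OF m]
            simp: has_real_derivative_iff_has_vector_derivative[symmetric])
    moreover have "m 1 = m 0" using energy_per[OF t, of "X t"] flux_per[OF t, of "X t"] by (simp add: m_def)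
    \<comment> \<open>Flux minus c times energy is a negative square. Without the weight, m(1) and
      m(0) would cancel and this gain would be lost.\<close>
    moreover have m0: "m 0 = - (k t / 2) * (y t (X t) - c (u t (X t)) * p t (X t))\<^sup>2"
      by (simp add: m_def k_def flux_def energy_def power2_eq_square field_simps)
    ultimately have i1: "((\<lambda>z. (1 + z) * m' z + m z) has_integral m 0) {0..1}" by simp
    have i2: "((\<lambda>z. - m z + (1 + z) * src t (X t + z)) has_integral
        integral {0..1} (\<lambda>z. - m z + (1 + z) * src t (X t + z))) {0..1}"
      by (intro integrable_integral integrable_continuous_real continuous_intros cm cZ cont_energy t)
    have "(D t has_integral (m 0 + integral {0..1} (\<lambda>z. - m z + (1 + z) * src t (X t + z)))) {0..1}"
      using has_integral_add[OF i1 i2]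
      by (rule has_integral_eq[rotated]) (simp add: D_def m'_def energy_t_eq algebra_simps)
    then have E'eq: "E' t = m 0 + integral {0..1} (\<lambda>z. - m z + (1 + z) * src t (X t + z))"
      unfolding E'_def by (rule integral_unique)
    have i3: "((\<lambda>z. growth * ((1 + z) * energy t (X t + z)) + growth * 1) has_integral (growth * E t + growth * 1)) {0..1}"
    proof (rule has_integral_add)
      show "((\<lambda>z. growth * ((1 + z) * energy t (X t + z))) has_integral growth * E t) {0..1}"
        unfolding E_def using iE[OF t] by (intro has_integral_mult_right integrable_integral) simp
      show "((\<lambda>z. growth * 1) has_integral growth * 1) {0..1::real}"
        using has_integral_const_real[of "growth * 1" 0 1] by simp
    qed
    have "- m z + (1 + z) * src t (X t + z) \<le> growth * ((1 + z) * energy t (X t + z)) + growth * 1"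
      if z: "z \<in> {0..1}" for z
    proof -
      let ?e = "energy t (X t + z)"
      have e: "?e \<ge> 0" by (rule energy_nonneg)
      have "k t * ?e \<le> c2 * ?e" unfolding k_def by (intro mult_right_mono c e)
      then have "- m z \<le> 2 * c2 * ?e"
        using abs_flux_le[of t "X t + z"] unfolding m_def by linarith
      also have "\<dots> \<le> (1 + z) * (2 * c2 * ?e)"
        using mult_right_mono[of 1 "1 + z" "2 * c2 * ?e"] z c2 e by simp
      finally have 1: "- m z \<le> (1 + z) * (2 * c2 * ?e)" .
      have "(1 + z) * src t (X t + z) \<le> (1 + z) * ((2 * c3 / c1 + c2) * ?e + c2)"
        using abs_src_le[OF t, of "X t + z"] z by (intro mult_left_mono) auto
      also have "\<dots> = (1 + z) * ((2 * c3 / c1 + c2) * ?e) + (1 + z) * c2" by (simp add: algebra_simps)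
      also have "(1 + z) * c2 \<le> growth"
      proof -
        have "(1 + z) * c2 \<le> 2 * c2" using z c2 by (intro mult_right_mono) auto
        also have "\<dots> \<le> growth" using c1 c3 c2 by (simp add: growth_def)
        finally show ?thesis .
      qed
      finally have 2: "(1 + z) * src t (X t + z) \<le> (1 + z) * ((2 * c3 / c1 + c2) * ?e) + growth" by simp
      have "(1 + z) * (2 * c2 * ?e) + (1 + z) * ((2 * c3 / c1 + c2) * ?e) = growth * ((1 + z) * ?e)"
        by (simp add: growth_def add_divide_distrib algebra_simps)
      with 1 2 show ?thesis by linarith
    qed
    then have "integral {0..1} (\<lambda>z. - m z + (1 + z) * src t (X t + z)) \<le> growth * E t + growth * 1"
      by (rule has_integral_le[OF i2 i3])
    moreover have "m 0 \<le> - (c1 / 2) * (y t (X t) - c (u t (X t)) * p t (X t))\<^sup>2"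
      unfolding m0 using c(1)[of "u t (X t)"] by (intro mult_right_mono) (auto simp: k_def)
    ultimately show "E' t \<le> - (c1 / 2) * (y t (X t) - c (u t (X t)) * p t (X t))\<^sup>2 + growth * (E t + 1)"
      unfolding E'eq by (simp add: algebra_simps)
  qed
qed

text \<open>The quantity \<sigma> = y - c p belongs to the other family of characteristics, so its
  square integrated along X measures energy crossing X, which is limited by the initial energy up to
  growth. Since T \<le> 1, the Gronwall factor exp(- growth t) is at least exp(- growth), and the
  bound is free of T.\<close>

lemma transversal_bound:
  assumes X: "\<And>t. t \<in> {0..T} \<Longrightarrow> (X has_real_derivative - c (u t (X t))) (at t within {0..T})"
    and y0: "\<And>x. y 0 x = 0" and p0: "integral {0..1} (\<lambda>z. (p 0 (X 0 + z))\<^sup>2) \<le> 1"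
  shows "integral {0..T} (\<lambda>t. (y t (X t) - c (u t (X t)) * p t (X t))\<^sup>2) \<le> 2 / c1 * exp growth * (c2\<^sup>2 + 1)"
proof -
  define E where "E t = integral {0..1} (\<lambda>z. (1 + z) * energy t (X t + z))" for t
  define sg where "sg t = y t (X t) - c (u t (X t)) * p t (X t)" for t
  obtain E' where E: "\<And>t. t \<in> {0..T} \<Longrightarrow> (E has_real_derivative E' t) (at t within {0..T})"
    and E': "\<And>t. t \<in> {0..T} \<Longrightarrow> E' t \<le> - (c1 / 2) * (sg t)\<^sup>2 + growth * (E t + 1)"
  proof (rule weighted_energy[OF X])
    fix E' assume "\<And>t. t \<in> {0..T} \<Longrightarrow>
        ((\<lambda>t. integral {0..1} (\<lambda>z. (1 + z) * energy t (X t + z))) has_real_derivative E' t) (at t within {0..T})"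
      "\<And>t. t \<in> {0..T} \<Longrightarrow> E' t \<le> - (c1 / 2) * (y t (X t) - c (u t (X t)) * p t (X t))\<^sup>2
        + growth * (integral {0..1} (\<lambda>z. (1 + z) * energy t (X t + z)) + 1)"
    then show thesis by (intro that[of E']) (auto simp: E_def[abs_def] sg_def)
  qed
  have cX: "continuous_on {0..T} X" using X by (rule DERIV_continuous_on)
  have csg: "continuous_on {0..T} sg"
    unfolding sg_def
    using continuous_on_along[OF cu cX] continuous_on_along[OF cy cX] continuous_on_along[OF cp cX]
    by (intro continuous_on_diff continuous_on_mult ccu)
  define I where "I t = integral {0..t} (\<lambda>s. (sg s)\<^sup>2)" for t
  have I: "(I has_real_derivative (sg t)\<^sup>2) (at t within {0..T})" if "t \<in> {0..T}" for t
    unfolding I_def[abs_def] using csg that by (intro integral_has_real_derivative continuous_intros)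
  let ?G = growth
  have "- (exp (- ?G * 0) * (E 0 + 1)) - c1 / 2 * exp (- ?G) * I 0
      \<le> - (exp (- ?G * T) * (E T + 1)) - c1 / 2 * exp (- ?G) * I T"
  proof (rule has_real_derivative_nonneg_le[where T=T
        and f="\<lambda>t. - (exp (- ?G * t) * (E t + 1)) - c1 / 2 * exp (- ?G) * I t"
        and f'="\<lambda>t. - (exp (- ?G * t) * (E' t - ?G * (E t + 1))) - c1 / 2 * exp (- ?G) * (sg t)\<^sup>2"])
    fix t assume t: "t \<in> {0..T}"
    show "((\<lambda>t. - (exp (- ?G * t) * (E t + 1)) - c1 / 2 * exp (- ?G) * I t) has_real_derivative
      - (exp (- ?G * t) * (E' t - ?G * (E t + 1))) - c1 / 2 * exp (- ?G) * (sg t)\<^sup>2) (at t within {0..T})"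
      using t by (auto intro!: derivative_eq_intros E I simp: algebra_simps)
    have "exp (- ?G) \<le> exp (- ?G * t)" using t T growth_nonneg by (simp add: mult_left_le)
    then have "c1 / 2 * (sg t)\<^sup>2 * exp (- ?G) \<le> c1 / 2 * (sg t)\<^sup>2 * exp (- ?G * t)"
      using c1 by (intro mult_left_mono) auto
    also have "\<dots> \<le> (?G * (E t + 1) - E' t) * exp (- ?G * t)"
      using E'[OF t] by (intro mult_right_mono) auto
    finally show "0 \<le> - (exp (- ?G * t) * (E' t - ?G * (E t + 1))) - c1 / 2 * exp (- ?G) * (sg t)\<^sup>2"
      by (simp add: algebra_simps)
  qed (use T in auto)
  moreover have "E T \<ge> 0"
  proof -
    have "continuous_on {0..1} (\<lambda>z. energy T (X T + z))"
      using T by (intro continuous_on_slice[OF continuous_on_shift[OF cont_energy(1) cX]]) auto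
    then show ?thesis unfolding E_def
      by (intro integral_nonneg integrable_continuous_real continuous_intros) (auto simp: energy_nonneg)
  qed
  then have "exp (- ?G * T) * (E T + 1) \<ge> 0" by simp
  ultimately have "c1 / 2 * exp (- ?G) * I T \<le> E 0 + 1" by (simp add: I_def)
  \<comment> \<open>The weight is at most 2 and cancels the 1/2 in the energy; \<open>y\<close>
    vanishes initially.\<close>
  moreover have "E 0 \<le> c2\<^sup>2"
  proof -
    have c0: "continuous_on {0..1} (\<lambda>z. p 0 (X 0 + z))" "continuous_on {0..1} (\<lambda>z. energy 0 (X 0 + z))"
      using T by (intro continuous_on_slice[OF continuous_on_shift[OF cp cX]]
          continuous_on_slice[OF continuous_on_shift[OF cont_energy(1) cX]]; simp)+
    have "E 0 \<le> integral {0..1} (\<lambda>z. c2\<^sup>2 * (p 0 (X 0 + z))\<^sup>2)" unfolding E_def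
    proof (intro integral_le integrable_continuous_real continuous_intros c0)
      fix z :: real assume z: "z \<in> {0..1}"
      have "(1 + z) * energy 0 (X 0 + z) \<le> 2 * energy 0 (X 0 + z)" using z energy_nonneg by (intro mult_right_mono) auto
      also have "\<dots> = (c (u 0 (X 0 + z)))\<^sup>2 * (p 0 (X 0 + z))\<^sup>2" by (simp add: energy_def y0 power_mult_distrib)
      also have "\<dots> \<le> c2\<^sup>2 * (p 0 (X 0 + z))\<^sup>2"
        using c c_pos by (intro mult_right_mono power_mono) (auto intro: less_imp_le)
      finally show "(1 + z) * energy 0 (X 0 + z) \<le> c2\<^sup>2 * (p 0 (X 0 + z))\<^sup>2" .
    qed
    also have "\<dots> \<le> c2\<^sup>2" using p0 by (simp add: mult_left_le)
    finally show ?thesis .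
  qed
  ultimately have "c1 / 2 * exp (- ?G) * I T \<le> c2\<^sup>2 + 1" by linarith
  then show ?thesis using c1 by (simp add: I_def sg_def exp_minus field_simps)
qed

text \<open>The bound \<open>S0\<close> on the integral of \<sigma>^2 holds wherever u(t,X) travels,
  so closeness to \<open>ustar\<close> follows from it directly, with no bootstrap. The tolerance
  \<eta> is split in three: \<theta> S0 and T / (4 \<theta>) for \<sigma>, and T for the
  noise.\<close>

lemma blow_up:
  fixes ustar m \<eta> \<theta> b e :: real
  assumes e: "\<bar>e\<bar> = 1" and m: "m > 0" and near: "\<And>z. \<bar>z - ustar\<bar> \<le> \<eta> \<Longrightarrow> m \<le> e * c' z"
    and y0: "\<And>x. y 0 x = 0" and p0: "integral {0..1} (\<lambda>z. (p 0 z)\<^sup>2) \<le> 1" and u0: "u 0 0 = ustar"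
  defines "S0 \<equiv> 2 / c1 * exp growth * (c2\<^sup>2 + 1)" and "q \<equiv> c3 / (2 * c1)"
  assumes \<theta>: "\<theta> > 0" "\<theta> * S0 \<le> \<eta> / 3" "T / (4 * \<theta>) \<le> \<eta> / 3" "T \<le> \<eta> / 3"
    and b: "b > 0" "m / (8 * c2) * b * T > 1"
    and large: "c1 * (e * p 0 0) \<ge> b + 3 * q / 2 * S0 + (2 * q\<^sup>2 * c2 / m + q + c2) * T"
  shows False
proof -
  obtain X where X0: "X 0 = 0"
    and X: "\<And>t. t \<in> {0..T} \<Longrightarrow> (X has_real_derivative - c (u t (X t))) (at t within {0..T})"
    using characteristic_exists by blast
  have cX: "continuous_on {0..T} X" using X by (rule DERIV_continuous_on)
  define sg where "sg t = y t (X t) - c (u t (X t)) * p t (X t)" for t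
  have csg: "continuous_on {0..T} sg"
    unfolding sg_def
    using continuous_on_along[OF cu cX] continuous_on_along[OF cy cX] continuous_on_along[OF cp cX]
    by (intro continuous_on_diff continuous_on_mult ccu)
  have S: "integral {0..T} (\<lambda>t. (sg t)\<^sup>2) \<le> S0"
    unfolding sg_def S0_def by (rule transversal_bound[OF X y0]) (simp_all add: X0 p0)
  define I where "I t = integral {0..t} (\<lambda>s. (sg s)\<^sup>2)" for t
  have I: "(I has_real_derivative (sg t)\<^sup>2) (at t within {0..T})" if "t \<in> {0..T}" for t
    unfolding I_def[abs_def] using csg that by (intro integral_has_real_derivative continuous_intros)
  have IT: "I t \<le> S0" if "t \<in> {0..T}" for t
  proof -
    have "I t \<le> I T" unfolding I_def
      by (rule integral_subset_le)
         (use that csg in \<open>auto intro!: integrable_continuous_real continuous_intros elim: continuous_on_subset\<close>)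
    with S show ?thesis by (simp add: I_def)
  qed
  \<comment> \<open>Along X the time derivative of u is u_t - c u_x = (y + w) - c p = \<sigma> +
    w.\<close>
  define \<phi> where "\<phi> t = u t (X t)" for t
  have \<phi>: "(\<phi> has_real_derivative sg t + w t (X t)) (at t within {0..T})" if t: "t \<in> {0..T}" for t
    unfolding \<phi>_def[abs_def]
    using has_real_derivative_along[where g=u, OF u_t[OF t] u_x cp X[OF t] t] by (simp add: sg_def algebra_simps)
  have sgw: "\<bar>sg t + w t (X t)\<bar> \<le> \<theta> * (sg t)\<^sup>2 + (1 / (4 * \<theta>) + 1)" if t: "t \<in> {0..T}" for t
  proof -
    \<comment> \<open>Young's inequality: \<theta> trades the integral of \<sigma>^2 against elapsed
      time.\<close>
    have "0 \<le> (2 * \<theta> * \<bar>sg t\<bar> - 1)\<^sup>2" by simp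
    also have "\<dots> = 4 * \<theta> * (\<theta> * (sg t)\<^sup>2 + 1 / (4 * \<theta>) - \<bar>sg t\<bar>)"
      using \<theta> by (simp add: power2_diff power_mult_distrib field_simps power2_eq_square)
    finally have "\<bar>sg t\<bar> \<le> \<theta> * (sg t)\<^sup>2 + 1 / (4 * \<theta>)" using \<theta> by (simp add: zero_le_mult_iff)
    then show ?thesis using w(1)[OF t, of "X t"] by linarith
  qed
  have \<phi>_near: "\<bar>\<phi> t - ustar\<bar> \<le> \<eta>" if t: "t \<in> {0..T}" for t
  proof -
    have mono: "k * \<phi> 0 + \<theta> * I 0 + (1 / (4 * \<theta>) + 1) * 0 \<le> k * \<phi> t + \<theta> * I t + (1 / (4 * \<theta>) + 1) * t"
      if "\<bar>k\<bar> = 1" for k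
    proof (rule has_real_derivative_nonneg_le[where T=T and f="\<lambda>t. k * \<phi> t + \<theta> * I t + (1 / (4 * \<theta>) + 1) * t"
         and f'="\<lambda>t. k * (sg t + w t (X t)) + \<theta> * (sg t)\<^sup>2 + (1 / (4 * \<theta>) + 1)", OF _ _ t])
      fix s assume s: "s \<in> {0..T}"
      show "((\<lambda>t. k * \<phi> t + \<theta> * I t + (1 / (4 * \<theta>) + 1) * t) has_real_derivative
          k * (sg s + w s (X s)) + \<theta> * (sg s)\<^sup>2 + (1 / (4 * \<theta>) + 1)) (at s within {0..T})"
        using s by (auto intro!: derivative_eq_intros \<phi> I)
      have "\<bar>k * (sg s + w s (X s))\<bar> = \<bar>sg s + w s (X s)\<bar>" using that by (simp add: abs_mult)
      with sgw[OF s] show "0 \<le> k * (sg s + w s (X s)) + \<theta> * (sg s)\<^sup>2 + (1 / (4 * \<theta>) + 1)" by linarith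
    qed
    have "I 0 = 0" by (simp add: I_def)
    then have "\<bar>\<phi> t - \<phi> 0\<bar> \<le> \<theta> * I t + (1 / (4 * \<theta>) + 1) * t"
      using mono[of 1] mono[of "- 1"] unfolding abs_le_iff by simp
    also have "\<theta> * I t \<le> \<theta> * S0" using IT[OF t] \<theta> by (intro mult_left_mono) auto
    also have "(1 / (4 * \<theta>) + 1) * t \<le> (1 / (4 * \<theta>) + 1) * T" using t \<theta> by (intro mult_left_mono) auto
    also have "\<dots> = T / (4 * \<theta>) + T" by (simp add: algebra_simps)
    finally show ?thesis using \<theta> by (simp add: \<phi>_def X0 u0)
  qed
  define C d where "C t = c (\<phi> t)" and "d t = c' (\<phi> t)" for t
  \<comment> \<open>The factor \<open>e\<close> is the sign of c' near \<open>ustar\<close>; it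
    makes the coefficient of r^2 positive in both cases.\<close>
  define r where "r t = e * (y t (X t) + C t * p t (X t))" for t
  define r' where "r' t = e * (d t * (y t (X t) + w t (X t)) * p t (X t) + C t * wx t (X t))" for t
  have e2: "e * e = 1" using e by (metis abs_mult_self_eq mult_1)
  show False
  proof (rule riccati_blow_up[where r=r and r'=r' and sg=sg and a="m / (8 * c2)" and b=b and T=T
        and k="3 * q / 2" and k'="2 * q\<^sup>2 * c2 / m + q + c2" and ?S0.0=S0])
    show "0 \<le> 3 * q / 2" "0 \<le> 2 * q\<^sup>2 * c2 / m + q + c2" "0 < m / (8 * c2)"
      using c1 c3 c2 m by (auto simp: q_def)
    show "b + 3 * q / 2 * S0 + (2 * q\<^sup>2 * c2 / m + q + c2) * T \<le> r 0"
    proof -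
      \<comment> \<open>The lower bound \<open>c1\<close> can replace C(0) only because the signed
        slope is nonnegative.\<close>
      have "e * p 0 0 \<ge> 0"
      proof -
        have "0 \<le> S0" unfolding S0_def using c1 by simp
        then have "0 \<le> b + 3 * q / 2 * S0 + (2 * q\<^sup>2 * c2 / m + q + c2) * T"
          using c1 c3 c2 m b T by (auto simp: q_def intro!: add_nonneg_nonneg mult_nonneg_nonneg)
        with large have "0 \<le> c1 * (e * p 0 0)" by linarith
        then show ?thesis using c1 by (simp add: zero_le_mult_iff)
      qed
      then have "c1 * (e * p 0 0) \<le> C 0 * (e * p 0 0)" using c by (intro mult_right_mono) (auto simp: C_def)
      also have "\<dots> = r 0" by (simp add: r_def X0 y0)
      finally show ?thesis using large by linarith
    qed
    fix t assume t: "t \<in> {0..T}"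
    have "((\<lambda>t. y t (X t)) has_real_derivative (C t)\<^sup>2 * px t (X t) + C t * d t * (p t (X t))\<^sup>2 + yx t (X t) * - C t)
        (at t within {0..T})"
      unfolding C_def d_def \<phi>_def by (rule has_real_derivative_along[OF y_t[OF t] y_x cyx X[OF t] t])
    moreover have "((\<lambda>t. p t (X t)) has_real_derivative yx t (X t) + wx t (X t) + px t (X t) * - C t)
        (at t within {0..T})"
      unfolding C_def \<phi>_def by (rule has_real_derivative_along[OF p_t[OF t] p_x cpx X[OF t] t])
    moreover have "(C has_real_derivative d t * (sg t + w t (X t))) (at t within {0..T})"
      unfolding C_def[abs_def] d_def by (rule DERIV_chain2[OF dc \<phi>[OF t]])
    ultimately have "(r has_real_derivative e * ((C t)\<^sup>2 * px t (X t) + C t * d t * (p t (X t))\<^sup>2 + yx t (X t) * - C t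
        + (d t * (sg t + w t (X t)) * p t (X t) + (yx t (X t) + wx t (X t) + px t (X t) * - C t) * C t)))
        (at t within {0..T})"
      unfolding r_def[abs_def] by (intro DERIV_cmult DERIV_add DERIV_mult)
    \<comment> \<open>The second derivatives \<open>px\<close> and \<open>yx\<close> cancel, since y
      + c p is followed along the left-going characteristic.\<close>
    then show "(r has_real_derivative r' t) (at t within {0..T})"
      by (simp add: r'_def sg_def C_def \<phi>_def algebra_simps power2_eq_square)
    have C: "C t > 0" "c1 \<le> C t" "C t \<le> c2" using c_pos c by (auto simp: C_def)
    have near': "m \<le> e * d t" unfolding d_def using \<phi>_near[OF t] by (rule near)
    have "e * d t \<le> \<bar>e * d t\<bar>" by simp
    also have "\<dots> \<le> c3" using c'[of "\<phi> t"] e by (simp add: abs_mult d_def)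
    finally have dc3: "e * d t \<le> c3" .
    have "m / (8 * c2) * (e * r t)\<^sup>2 - 3 * q / 2 * (sg t)\<^sup>2 - (2 * q\<^sup>2 * c2 / m + q + c2)
      \<le> (e * d t) * ((e * r t)\<^sup>2 - (sg t)\<^sup>2) / (4 * C t)
        + (e * d t) * w t (X t) * ((e * r t) - sg t) / (2 * C t) + e * C t * wx t (X t)"
      unfolding q_def by (rule riccati_coefficients[OF c1 C(2,3) m near' dc3 w(1)[OF t] w(2)[OF t] e])
    also have "(e * d t) * ((e * r t)\<^sup>2 - (sg t)\<^sup>2) / (4 * C t)
        + (e * d t) * w t (X t) * ((e * r t) - sg t) / (2 * C t) + e * C t * wx t (X t) = r' t"
    \<comment> \<open>With R = y + C p one has y = (R + \<sigma>)/2 and p = (R - \<sigma>)/(2 C), so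
      that y p becomes (R^2 - \<sigma>^2)/(4 C).\<close>
    proof -
      have er: "e * r t = y t (X t) + C t * p t (X t)"
        unfolding r_def by (simp add: mult.assoc[symmetric] e2)
      have sg: "sg t = y t (X t) - C t * p t (X t)" by (simp add: sg_def C_def \<phi>_def)
      show ?thesis unfolding er sg r'_def using C(1) by (simp add: field_simps power2_eq_square)
    qed
    also have "(e * r t)\<^sup>2 = (r t)\<^sup>2" using e2 by (simp add: power_mult_distrib power2_eq_square)
    finally show "m / (8 * c2) * (r t)\<^sup>2 - 3 * q / 2 * (sg t)\<^sup>2 - (2 * q\<^sup>2 * c2 / m + q + c2) \<le> r' t" .
  qed (use T b csg S in auto)
qed

end

section \<open>Steep initial data of bounded energy\<close>

text \<open>A class containing the data and closed under differentiation, so that all iterated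
  derivatives exist by induction. The frequency is pi rather than 2 pi: sin and cos then change sign
  under x + 1, and products of even degree are 1-periodic.\<close>

inductive trig_fun :: "(real \<Rightarrow> real) \<Rightarrow> bool" where
  const: "trig_fun (\<lambda>x. a)"
| sin: "trig_fun (\<lambda>x. sin (pi * x))"
| cos: "trig_fun (\<lambda>x. cos (pi * x))"
| add: "trig_fun f \<Longrightarrow> trig_fun h \<Longrightarrow> trig_fun (\<lambda>x. f x + h x)"
| mult: "trig_fun f \<Longrightarrow> trig_fun h \<Longrightarrow> trig_fun (\<lambda>x. f x * h x)"

lemma trig_fun_power: "trig_fun f \<Longrightarrow> trig_fun (\<lambda>x. f x ^ n)"
  by (induction n) (auto intro: trig_fun.intros)

lemma trig_fun_derivative:
  "trig_fun f \<Longrightarrow> \<exists>f'. trig_fun f' \<and> (\<forall>x. (f has_real_derivative f' x) (at x))"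
proof (induction rule: trig_fun.induct)
  case (const a)
  show ?case by (rule exI[of _ "\<lambda>x. 0"]) (auto intro: trig_fun.intros)
next
  case sin
  show ?case by (rule exI[of _ "\<lambda>x. pi * cos (pi * x)"])
      (auto intro!: trig_fun.intros derivative_eq_intros)
next
  case cos
  show ?case
    by (intro exI[of _ "\<lambda>x. - pi * sin (pi * x)"] conjI allI trig_fun.mult trig_fun.const trig_fun.sin)
      (auto intro!: derivative_eq_intros)
next
  case (add f h)
  then obtain f' h' where "trig_fun f'" "\<And>x. (f has_real_derivative f' x) (at x)"
    "trig_fun h'" "\<And>x. (h has_real_derivative h' x) (at x)" by blast
  then show ?case by (intro exI[of _ "\<lambda>x. f' x + h' x"])
      (auto intro!: trig_fun.intros derivative_eq_intros)
next
  case (mult f h)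
  then obtain f' h' where "trig_fun f'" "\<And>x. (f has_real_derivative f' x) (at x)"
    "trig_fun h'" "\<And>x. (h has_real_derivative h' x) (at x)" by blast
  then show ?case using mult.hyps by (intro exI[of _ "\<lambda>x. f' x * h x + f x * h' x"])
      (auto intro!: trig_fun.intros derivative_eq_intros)
qed

lemma trig_fun_smooth:
  assumes "trig_fun f" shows "smooth f"
proof -
  have "trig_fun ((deriv ^^ n) f)" for n
  proof (induction n)
    case (Suc n)
    then obtain f' where f': "trig_fun f'" "\<And>x. ((deriv ^^ n) f has_real_derivative f' x) (at x)"
      using trig_fun_derivative by blast
    then have "deriv ((deriv ^^ n) f) = f'" by (auto intro: DERIV_imp_deriv)
    with f'(1) show ?case by simp
  qed (simp add: assms)
  then show ?thesis
    unfolding smooth_def field_differentiable_def using trig_fun_derivative by blast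
qed

text \<open>Each of the n + 1 copies of q^n is at most q^i with i \<le> n, and the geometric sum
  times 1 - q is at most 1. This keeps the derivatives of the data bounded uniformly in
  \<open>n\<close>.\<close>

lemma Suc_mult_power_le:
  fixes q :: real
  assumes "0 \<le> q" "q \<le> 1"
  shows "real (Suc n) * (1 - q) * q ^ n \<le> 1"
proof -
  have "real (Suc n) * q ^ n = (\<Sum>i<Suc n. q ^ n)" by simp
  also have "\<dots> \<le> (\<Sum>i<Suc n. q ^ i)"
    by (intro sum_mono power_decreasing) (use assms in auto)
  finally have "(1 - q) * (real (Suc n) * q ^ n) \<le> (1 - q) * (\<Sum>i<Suc n. q ^ i)"
    using assms by (intro mult_left_mono) auto
  also have "\<dots> = 1 - q ^ Suc n" by (rule one_diff_power_eq[symmetric])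
  also have "\<dots> \<le> 1" using assms by simp
  finally show ?thesis by (simp add: mult_ac)
qed

text \<open>In the family \<open>v n\<close> below the slope at \<open>0\<close> is always \<open>A\<close>, while elsewhere the derivative tends
  boundedly to \<open>0\<close>.\<close>

lemma steep_datum:
  "\<exists>u0 u0'. torus_smooth u0 \<and> (\<forall>x. (u0 has_real_derivative u0' x) (at x)) \<and>
     u0 0 = a \<and> u0' 0 = A \<and> integral {0..1} (\<lambda>x. (u0' x)\<^sup>2) \<le> 1"
proof -
  \<comment> \<open>\<open>A / pi\<close> normalises the slope at 0 to \<open>A\<close>; the odd
    power of cos makes the product with sin 1-periodic and, for large \<open>n\<close>, concentrates
    the profile near the integers.\<close>
  define v where "v n x = a + A / pi * (sin (pi * x) * cos (pi * x) ^ (2 * n + 1))" for n :: nat and x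
  define q where "q x = (cos (pi * x))\<^sup>2" for x
  define v' where "v' n x = A * (q x ^ (n + 1) - real (2 * n + 1) * (1 - q x) * q x ^ n)" for n :: nat and x
  have q01: "0 \<le> q x" "q x \<le> 1" for x by (auto simp: q_def abs_square_le_1)
  have deriv_v: "(v n has_real_derivative v' n x) (at x)" for n x
  proof -
    have s: "sin (pi * x) * sin (pi * x) = 1 - q x" 
      using sin_squared_eq[of "pi * x"] by (simp add: q_def power2_eq_square)
    have p: "cos (pi * x) ^ (2 * n) = q x ^ n" "cos (pi * x) ^ (2 * n + 1) = cos (pi * x) * q x ^ n"
      by (simp_all add: q_def power_mult)
    have "((\<lambda>x. cos (pi * x) ^ Suc (2 * n)) has_real_derivative
        (1 + real (2 * n)) * ((- sin (pi * x) * pi) * cos (pi * x) ^ (2 * n))) (at x)"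
      by (intro DERIV_power_Suc) (auto intro!: derivative_eq_intros)
    moreover have "((\<lambda>x. sin (pi * x)) has_real_derivative cos (pi * x) * pi) (at x)"
      by (auto intro!: derivative_eq_intros)
    ultimately have "((\<lambda>x. a + A / pi * (sin (pi * x) * cos (pi * x) ^ Suc (2 * n))) has_real_derivative
        0 + A / pi * (cos (pi * x) * pi * cos (pi * x) ^ Suc (2 * n)
        + (1 + real (2 * n)) * ((- sin (pi * x) * pi) * cos (pi * x) ^ (2 * n)) * sin (pi * x))) (at x)"
      by (intro DERIV_add DERIV_const DERIV_cmult DERIV_mult)
    then have "(v n has_real_derivative A / pi * (cos (pi * x) * pi * cos (pi * x) ^ (2 * n + 1)
        + (1 + real (2 * n)) * ((- sin (pi * x) * pi) * cos (pi * x) ^ (2 * n)) * sin (pi * x))) (at x)"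
      unfolding v_def[abs_def] Suc_eq_plus1 by simp
    also have "A / pi * (cos (pi * x) * pi * cos (pi * x) ^ (2 * n + 1)
        + (1 + real (2 * n)) * ((- sin (pi * x) * pi) * cos (pi * x) ^ (2 * n)) * sin (pi * x)) =
        A * (cos (pi * x) * cos (pi * x) * q x ^ n - real (2 * n + 1) * (sin (pi * x) * sin (pi * x)) * q x ^ n)"
      unfolding p by (simp add: field_simps)
    also have "\<dots> = v' n x" unfolding s v'_def by (simp add: q_def power2_eq_square)
    finally show ?thesis .
  qed
  have cv': "continuous_on S (v' n)" for n S
    unfolding v'_def q_def by (intro continuous_intros)
  have bound: "\<bar>v' n x\<bar> \<le> 2 * \<bar>A\<bar>" for n x
  proof -
    have "real (2 * n + 1) * (1 - q x) * q x ^ n \<le> 2 * (real (Suc n) * (1 - q x) * q x ^ n)"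
      using q01[of x] mult_right_mono[of "real (2 * n + 1)" "2 * real (Suc n)" "(1 - q x) * q x ^ n"]
      by (simp only: mult.assoc) auto
    also have "\<dots> \<le> 2" using Suc_mult_power_le[OF q01, of n x] by (simp add: mult.assoc)
    finally have 1: "real (2 * n + 1) * (1 - q x) * q x ^ n \<le> 2" .
    have 2: "0 \<le> real (2 * n + 1) * (1 - q x) * q x ^ n" using q01[of x] by simp
    have "q x ^ (n + 1) \<le> 1" "0 \<le> q x ^ (n + 1)" using q01[of x] power_le_one[of "q x" "n + 1"] by (simp_all del: power_Suc add: zero_le_power)
    with 1 2 have "\<bar>q x ^ (n + 1) - real (2 * n + 1) * (1 - q x) * q x ^ n\<bar> \<le> 2" by linarith
    then have "\<bar>A\<bar> * \<bar>q x ^ (n + 1) - real (2 * n + 1) * (1 - q x) * q x ^ n\<bar> \<le> \<bar>A\<bar> * 2"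
      by (intro mult_left_mono) auto
    then show ?thesis by (simp add: v'_def abs_mult mult.commute)
  qed
  \<comment> \<open>The pointwise limit of the squared derivatives is nonzero only at 0 and 1, so by
    dominated convergence with a constant majorant their integrals tend to 0.\<close>
  define g where "g x = (if x = 0 \<or> x = 1 then A\<^sup>2 else 0)" for x :: real
  have lim: "(\<lambda>n. (v' n x)\<^sup>2) \<longlonglongrightarrow> g x" if "x \<in> {0..1}" for x
  proof (cases "x = 0 \<or> x = 1")
    case True
    then have "q x = 1" by (auto simp: q_def)
    then show ?thesis using True by (simp add: v'_def g_def)
  next
    case False
    with that have x: "0 < x" "x < 1" by auto
    have "sin (pi * x) > 0" using x by (intro sin_gt_zero) auto
    then have "(sin (pi * x))\<^sup>2 > 0" by simp
    then have "q x < 1" using sin_cos_squared_add[of "pi * x"] unfolding q_def by linarith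
    then have nq: "norm (q x) < 1" using q01[of x] by simp
    have 1: "(\<lambda>n. q x ^ (n + 1)) \<longlonglongrightarrow> 0"
      using LIMSEQ_power_zero[OF nq] by (rule LIMSEQ_ignore_initial_segment)
    have 2: "(\<lambda>n. real n * q x ^ n) \<longlonglongrightarrow> 0" using powser_times_n_limit_0[OF nq] by simp
    have "(\<lambda>n. A * (q x ^ (n + 1) - (1 - q x) * (2 * (real n * q x ^ n) + q x ^ n))) \<longlonglongrightarrow>
        A * (0 - (1 - q x) * (2 * 0 + 0))"
      by (intro tendsto_intros 1 2 LIMSEQ_power_zero nq)
    also have "(\<lambda>n. A * (q x ^ (n + 1) - (1 - q x) * (2 * (real n * q x ^ n) + q x ^ n))) = (\<lambda>n. v' n x)"
      by (auto simp: v'_def fun_eq_iff algebra_simps)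
    finally have "(\<lambda>n. v' n x) \<longlonglongrightarrow> 0" by simp
    then have "(\<lambda>n. (v' n x)\<^sup>2) \<longlonglongrightarrow> 0\<^sup>2" by (intro tendsto_power)
    then show ?thesis using False by (simp add: g_def)
  qed
  have "(\<lambda>n. integral {0..1} (\<lambda>x. (v' n x)\<^sup>2)) \<longlonglongrightarrow> integral {0..1} g"
  proof (rule dominated_convergence(2))
    show "(\<lambda>x. (v' n x)\<^sup>2) integrable_on {0..1}" for n
      by (intro integrable_continuous_real continuous_intros cv')
    show "(\<lambda>x. (2 * \<bar>A\<bar>)\<^sup>2) integrable_on {0..1::real}" by (intro integrable_continuous_real continuous_intros)
    show "norm ((v' n x)\<^sup>2) \<le> (2 * \<bar>A\<bar>)\<^sup>2" for n x
      using power_mono[OF bound[of n x], of 2] by simp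
  qed (use lim in auto)
  moreover have "(g has_integral 0) {0..1}"
    by (rule has_integral_spike_finite[of "{0, 1}" _ _ "\<lambda>x. 0"]) (auto simp: g_def)
  then have "integral {0..1} g = 0" by (rule integral_unique)
  ultimately have "\<forall>\<^sub>F n in sequentially. integral {0..1} (\<lambda>x. (v' n x)\<^sup>2) < 1"
    by (intro order_tendstoD(2)[where y=0]) auto
  then obtain n where n: "integral {0..1} (\<lambda>x. (v' n x)\<^sup>2) < 1"
    by (auto simp: eventually_sequentially)
  show ?thesis
  proof (rule exI[of _ "v n"], rule exI[of _ "v' n"], intro conjI allI)
    have "trig_fun (v n)" unfolding v_def[abs_def] by (intro trig_fun.intros trig_fun_power)
    then show "torus_smooth (v n)"
      unfolding torus_smooth_def periodic1_def
      by (auto intro!: trig_fun_smooth simp: v_def distrib_left)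
    show "v n 0 = a" "v' n 0 = A" by (simp_all add: v_def v'_def q_def)
  qed (use n deriv_v in auto)
qed

section \<open>Regular solutions are classical\<close>

lemma sobolev_path_continuous_subset:
  "sobolev_path_continuous r I f \<Longrightarrow> K \<subseteq> I \<Longrightarrow> sobolev_path_continuous r K f"
  unfolding sobolev_path_continuous_def by (blast intro: tendsto_within_subset)

lemma sobolev_path_deriv_subset:
  "sobolev_path_deriv r I f f' \<Longrightarrow> K \<subseteq> I \<Longrightarrow> sobolev_path_deriv r K f f'"
  unfolding sobolev_path_deriv_def by (blast intro: tendsto_within_subset)

lemma smooth_has_deriv:
  assumes "smooth c"
  shows "(c has_real_derivative deriv c z) (at z)" and "continuous_on UNIV (deriv c)"
proof -
  have d: "(deriv ^^ n) c field_differentiable at x" for n x using assms by (simp add: smooth_def)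
  show "(c has_real_derivative deriv c z) (at z)"
    using d[of 0 z] by (simp add: DERIV_deriv_iff_field_differentiable)
  show "continuous_on UNIV (deriv c)"
    using d[of 1] by (auto intro!: continuous_at_imp_continuous_on field_differentiable_imp_continuous_at)
qed

text \<open>The bound s > 3/2 acts at three levels: s + 1 > 5/2 gives two continuous x-derivatives
  of u, s > 3/2 gives one of u_t, and s - 1 > 1/2 makes point evaluation bounded on H^(s-1), so that
  the equation holds pointwise. Then y is the time integral of a continuous function, hence C^1 in
  time.\<close>

lemma classical_wave_path:
  fixes u ut N :: "real \<Rightarrow> real \<Rightarrow> real"
  assumes T: "0 < T" "T \<le> 1" and s: "s > 3 / 2" and smc: "smooth c"
    and c1: "c1 > 0" and c3: "c3 > 0" and c: "\<And>z. c1 \<le> c z \<and> c z \<le> c2" and c': "\<And>z. \<bar>deriv c z\<bar> \<le> c3"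
    and uC: "\<And>t. t \<in> {0..T} \<Longrightarrow> torus_C (u t)"
    and u: "sobolev_path_continuous (s + 1) {0..T} u"
    and uut: "sobolev_path_deriv s {0..T} u ut"
    and ut: "sobolev_path_continuous s {0..T} ut"
    and eq: "\<And>t. t \<in> {0..T} \<Longrightarrow> \<exists>J. has_sobolev_integral (s - 1) (\<lambda>r. wave_op c (u r)) J t \<and>
        (AE x in lborel. ut t x = J x + N t x)"
    and N: "sobolev_path_continuous (s + 1) {0..T} N"
    and N1: "\<And>t x. t \<in> {0..T} \<Longrightarrow> \<bar>rep_deriv 0 (N t) x\<bar> \<le> 1" "\<And>t x. t \<in> {0..T} \<Longrightarrow> \<bar>rep_deriv 1 (N t) x\<bar> \<le> 1"
  defines "y \<equiv> \<lambda>t x. rep_deriv 0 (ut t) x - rep_deriv 0 (N t) x"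
    and "yx \<equiv> \<lambda>t x. rep_deriv 1 (ut t) x - rep_deriv 1 (N t) x"
  shows "wave_path c (deriv c) c1 c2 c3 T u (\<lambda>t. rep_deriv 1 (u t)) y (\<lambda>t. rep_deriv 0 (N t))
      (\<lambda>t. rep_deriv 2 (u t)) yx (\<lambda>t. rep_deriv 1 (N t))" (is ?wave)
    and "y 0 x = 0"
    and "\<And>t x. t \<in> {0..T} \<Longrightarrow> (u t has_real_derivative rep_deriv 1 (u t) x) (at x)"
proof -
  note cd = smooth_has_deriv[OF smc]
  have su: "sobolev (s + 1) (u t)" "sobolev (s + 1) (N t)" "sobolev s (ut t)" if "t \<in> {0..T}" for t
    using u N ut that by (auto simp: sobolev_path_continuous_def)
  have u0: "u t = rep_deriv 0 (u t)" if "t \<in> {0..T}" for t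
    using rep_deriv_eq[OF uC[OF that] su(1)[OF that]] s by simp
  have ux: "(u t has_real_derivative rep_deriv 1 (u t) x) (at x)" if "t \<in> {0..T}" for t x
    using rep_deriv_has_derivative[OF su(1)[OF that], of 0 x] s u0[OF that] by simp
  then show "\<And>t x. t \<in> {0..T} \<Longrightarrow> (u t has_real_derivative rep_deriv 1 (u t) x) (at x)" .
  have px: "(rep_deriv 1 (u t) has_real_derivative rep_deriv 2 (u t) x) (at x)" if "t \<in> {0..T}" for t x
    using rep_deriv_has_derivative[OF su(1)[OF that], of 1 x] s by (simp add: numeral_2_eq_2)
  have yx: "(y t has_real_derivative yx t x) (at x)" if "t \<in> {0..T}" for t x
    unfolding y_def yx_def
    using rep_deriv_has_derivative[OF su(3)[OF that], of 0 x] rep_deriv_has_derivative[OF su(2)[OF that], of 0 x] s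
    by (intro DERIV_diff) auto
  have cu: "continuous_on ({0..T} \<times> UNIV) (\<lambda>(t, x). u t x)"
  proof -
    have "continuous_on ({0..T} \<times> UNIV) (\<lambda>(t, x). rep_deriv 0 (u t) x)"
      by (rule path_continuous_rep_deriv[OF u]) (use s in auto)
    moreover have "(case v of (t, x) \<Rightarrow> u t x) = (case v of (t, x) \<Rightarrow> rep_deriv 0 (u t) x)" if "v \<in> {0..T} \<times> UNIV" for v
      using that u0 by auto
    ultimately show ?thesis by (simp cong: continuous_on_cong)
  qed
  have cp: "continuous_on ({0..T} \<times> UNIV) (\<lambda>(t, x). rep_deriv 1 (u t) x)"
    by (rule path_continuous_rep_deriv[OF u]) (use s in auto)
  have cpx: "continuous_on ({0..T} \<times> UNIV) (\<lambda>(t, x). rep_deriv 2 (u t) x)"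
    by (rule path_continuous_rep_deriv[OF u]) (use s in auto)
  have cw: "continuous_on ({0..T} \<times> UNIV) (\<lambda>(t, x). rep_deriv 0 (N t) x)"
    by (rule path_continuous_rep_deriv[OF N]) (use s in auto)
  have cwx: "continuous_on ({0..T} \<times> UNIV) (\<lambda>(t, x). rep_deriv 1 (N t) x)"
    by (rule path_continuous_rep_deriv[OF N]) (use s in auto)
  have cv: "continuous_on ({0..T} \<times> UNIV) (\<lambda>(t, x). rep_deriv 0 (ut t) x)"
    by (rule path_continuous_rep_deriv[OF ut]) (use s in auto)
  have cvx: "continuous_on ({0..T} \<times> UNIV) (\<lambda>(t, x). rep_deriv 1 (ut t) x)"
    by (rule path_continuous_rep_deriv[OF ut]) (use s in auto)
  define g where "g t x = (c (u t x))\<^sup>2 * rep_deriv 2 (u t) x + c (u t x) * deriv c (u t x) * (rep_deriv 1 (u t) x)\<^sup>2" for t x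
  have cc: "continuous_on UNIV c" using cd(1) by (auto intro: DERIV_continuous_on DERIV_subset)
  have cg: "continuous_on ({0..T} \<times> UNIV) (\<lambda>(t, x). g t x)"
    unfolding g_def split_def
    by (intro continuous_intros continuous_on_compose2[OF cc] continuous_on_compose2[OF cd(2)]
         cu[unfolded split_def] cp[unfolded split_def] cpx[unfolded split_def] subset_UNIV)
  have wave: "wave_op c (u t) = g t" if t: "t \<in> {0..T}" for t
  proof
    fix x
    have "deriv (u t) = rep_deriv 1 (u t)" using ux[OF t] by (auto intro: DERIV_imp_deriv)
    moreover have "((\<lambda>y. c (u t y) * rep_deriv 1 (u t) y) has_real_derivative
        deriv c (u t x) * rep_deriv 1 (u t) x * rep_deriv 1 (u t) x + rep_deriv 2 (u t) x * c (u t x)) (at x)"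
      by (intro DERIV_mult DERIV_chain2[OF cd(1)] ux px t)
    then have "deriv (\<lambda>y. c (u t y) * rep_deriv 1 (u t) y) x =
        deriv c (u t x) * rep_deriv 1 (u t) x * rep_deriv 1 (u t) x + rep_deriv 2 (u t) x * c (u t x)" by (rule DERIV_imp_deriv)
    ultimately show "wave_op c (u t) x = g t x"
      by (simp add: wave_op_def g_def power2_eq_square algebra_simps)
  qed
  have gC: "torus_C (g t)" if t: "t \<in> {0..T}" for t
    using uC[OF t] continuous_on_slice[OF cg t, of UNIV]
    by (simp add: torus_C_def periodic1_def g_def[abs_def] rep_deriv_periodic)
  have yI: "((\<lambda>a. g a x) has_integral y t x) {0..t}" if t: "t \<in> {0..T}" for t x
  proof -
    obtain J where J: "has_sobolev_integral (s - 1) (\<lambda>r. wave_op c (u r)) J t"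
      and ae: "AE x in lborel. ut t x = J x + N t x" using eq[OF t] by blast
    have Js: "sobolev (s - 1) J" and ws: "\<And>a. a \<in> {0..t} \<Longrightarrow> sobolev (s - 1) (wave_op c (u a))"
      using J by (auto simp: has_sobolev_integral_def)
    have L2: "torus_L2 J" "torus_L2 (N t)" "torus_L2 (ut t)" using Js su[OF t] sobolev_L2 by blast+
    \<comment> \<open>The equation holds almost everywhere only; equal Fourier coefficients identify
      the representatives at every point.\<close>
    have "fcoeff J = fcoeff (\<lambda>x. ut t x - N t x)"
    proof (rule fcoeff_cong_AE[OF L2(1)])
      show "torus_L2 (\<lambda>x. ut t x - N t x)" unfolding lincomb_diff by (rule torus_L2_lincomb[OF L2(3,2)])
      show "AE x in lborel. J x = ut t x - N t x" using ae by eventually_elim simp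
    qed
    also have "\<dots> = (\<lambda>n. fcoeff (ut t) n - fcoeff (N t) n)" by (rule fcoeff_diff[OF L2(3,2)])
    finally have "rep_deriv 0 J x = y t x"
      using summable_coeffs[OF su(3)[OF t], of 0] summable_coeffs[OF su(2)[OF t], of 0] s
      by (simp add: rep_deriv_def y_def fourier_sum_diff)
    moreover have "((\<lambda>a. rep_deriv 0 (wave_op c (u a)) x) has_integral rep_deriv 0 J x) {0..t}"
      by (rule sobolev_integral_rep_deriv[OF J]) (use s in auto)
    moreover have "rep_deriv 0 (wave_op c (u a)) x = g a x" if a: "a \<in> {0..t}" for a
    proof -
      have a': "a \<in> {0..T}" using a t by auto
      have "wave_op c (u a) = rep_deriv 0 (wave_op c (u a))"
        by (rule rep_deriv_eq[OF _ ws[OF a]]) (use gC[OF a'] wave[OF a'] s in auto)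
      then show ?thesis using wave[OF a'] by simp
    qed
    ultimately show ?thesis by (metis (no_types, lifting) has_integral_eq)
  qed
  \<comment> \<open>The integral over \<open>{0..0}\<close> vanishes, and the zero initial velocity
    is already built into the equation.\<close>
  show "y 0 x = 0"
    using has_integral_unique[OF yI[of 0 x]] T has_integral_refl(2)[of "\<lambda>a. g a x" 0] by auto
  have yt: "((\<lambda>s. y s x) has_real_derivative g t x) (at t within {0..T})" if t: "t \<in> {0..T}" for t x
  proof -
    have "continuous_on {0..T} ((\<lambda>(t, x). g t x) \<circ> (\<lambda>t. (t, x)))"
      by (intro continuous_on_compose continuous_intros continuous_on_subset[OF cg]) auto
    then have "((\<lambda>t. integral {0..t} (\<lambda>a. g a x)) has_real_derivative g t x) (at t within {0..T})"
      by (intro integral_has_real_derivative t) (simp add: o_def)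
    then show ?thesis
      by (rule has_field_derivative_transform_within[OF _ zero_less_one t]) (use yI in \<open>auto simp: integral_unique\<close>)
  qed
  have ut_: "((\<lambda>s. rep_deriv j (u s) x) has_real_derivative rep_deriv j (ut t) x) (at t within {0..T})"
    if "t \<in> {0..T}" "s > real j + 1 / 2" for t x j
    by (rule path_derivative_rep_deriv[OF uut that(2,1)])
  show ?wave
  proof
    show "((\<lambda>s. u s x) has_real_derivative y t x + rep_deriv 0 (N t) x) (at t within {0..T})" if t: "t \<in> {0..T}" for t x
    proof -
      have "((\<lambda>s. rep_deriv 0 (u s) x) has_real_derivative rep_deriv 0 (ut t) x) (at t within {0..T})"
        using ut_[OF t, of 0] s by simp
      then show ?thesis
        by (rule has_field_derivative_transform_within[OF _ zero_less_one t, THEN DERIV_cong])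
          (use u0 in \<open>auto simp: y_def\<close>)
    qed
    show "((\<lambda>s. rep_deriv 1 (u s) x) has_real_derivative yx t x + rep_deriv 1 (N t) x) (at t within {0..T})" if t: "t \<in> {0..T}" for t x
      using ut_[OF t, of 1] s by (simp add: yx_def)
    show "((\<lambda>s. y s x) has_real_derivative (c (u t x))\<^sup>2 * rep_deriv 2 (u t) x + c (u t x) * deriv c (u t x) * (rep_deriv 1 (u t) x)\<^sup>2)
        (at t within {0..T})" if t: "t \<in> {0..T}" for t x
      using yt[OF t, of x] by (simp add: g_def)
    show "continuous_on ({0..T} \<times> UNIV) (\<lambda>(t, x). y t x)" "continuous_on ({0..T} \<times> UNIV) (\<lambda>(t, x). yx t x)"
      using cv cw cvx cwx unfolding y_def yx_def split_def by (auto intro: continuous_on_diff)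
    show "u t (x + 1) = u t x" if "t \<in> {0..T}" for t x
      using uC[OF that] by (simp add: torus_C_def periodic1_def)
    show "y t (x + 1) = y t x" for t x by (simp add: y_def rep_deriv_periodic)
  qed (use T c1 c3 c c' cd cu cp cpx cw cwx ux px yx N1 rep_deriv_periodic in auto)
qed

section \<open>Small noise\<close>

lemma cmod_fcoeff_le:
  assumes "sobolev r f" "r \<ge> 0"
  shows "cmod (fcoeff f n) \<le> sobolev_norm r f"
proof -
  have s: "summable (\<lambda>n. bracket n powr r * (cmod (fcoeff f n))\<^sup>2)" using assms(1) by (simp add: sobolev_iff)
  have "1 * (cmod (fcoeff f n))\<^sup>2 \<le> bracket n powr r * (cmod (fcoeff f n))\<^sup>2"
    using bracket_ge_1[of n] assms(2) by (intro mult_right_mono ge_one_powr_ge_zero) auto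
  also have "\<dots> = (\<Sum>i\<in>{n}. bracket i powr r * (cmod (fcoeff f i))\<^sup>2)" by simp
  also have "\<dots> \<le> (\<Sum>n. bracket n powr r * (cmod (fcoeff f n))\<^sup>2)"
    by (rule sum_le_suminf[OF s]) auto
  finally show ?thesis unfolding sobolev_norm_eq[OF assms(1)] by (intro real_le_rsqrt) simp
qed

lemma fcoeff_tendsto:
  assumes "((\<lambda>i. sobolev_norm r (\<lambda>x. f i x - h x)) \<longlongrightarrow> 0) G"
    and "\<forall>\<^sub>F i in G. sobolev r (f i)" "sobolev r h" "r \<ge> 0"
  shows "((\<lambda>i. fcoeff (f i) m) \<longlongrightarrow> fcoeff h m) G"
proof -
  have "((\<lambda>i. fcoeff (f i) m - fcoeff h m) \<longlongrightarrow> 0) G"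
  proof (rule Lim_null_comparison[OF _ assms(1)])
    show "\<forall>\<^sub>F i in G. norm (fcoeff (f i) m - fcoeff h m) \<le> sobolev_norm r (\<lambda>x. f i x - h x)"
      using assms(2)
    proof eventually_elim
      case (elim i)
      show ?case
        using cmod_fcoeff_le[OF sobolev_diff[OF elim assms(3)] assms(4), of m]
        by (simp add: fcoeff_diff[OF sobolev_L2[OF elim] sobolev_L2[OF assms(3)]])
    qed
  qed
  from tendsto_add[OF this tendsto_const[of "fcoeff h m"]] show ?thesis by simp
qed

text \<open>On the regular event the noise series converges in H^(s+1), hence coefficient by
  coefficient. Writing the coefficients as limits of finite sums in the \<open>\<beta> k t\<close>
  exposes them as random variables.\<close>

lemma fcoeff_noise_lim:
  assumes Om: "regular_noise_event M \<Phi> g \<beta> s \<Omega>s" and \<omega>: "\<omega> \<in> \<Omega>s" and t: "t \<ge> 0" and s: "s > 0"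
    and sig: "\<And>k. sobolev (s + 1) (\<Phi> (g k))"
  shows "sobolev (s + 1) (noise \<Phi> g \<beta> t \<omega>)"
    and "lim (\<lambda>n. \<Sum>k<n. of_real (\<beta> k t \<omega>) * fcoeff (\<Phi> (g k)) m) = fcoeff (noise \<Phi> g \<beta> t \<omega>) m"
proof -
  have "sobolev_path_continuous (s + 1) {0..t + 1} (\<lambda>t. noise \<Phi> g \<beta> t \<omega>)"
    using Om \<omega> t by (auto simp: regular_noise_event_def)
  then show N: "sobolev (s + 1) (noise \<Phi> g \<beta> t \<omega>)"
    using t by (auto simp: sobolev_path_continuous_def)
  define f where "f n x = (\<Sum>k<n. \<beta> k t \<omega> * \<Phi> (g k) x)" for n :: nat and x
  have f: "sobolev (s + 1) (f n)" for n
    unfolding f_def[abs_def] by (intro sobolev_sum sig) auto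
  have fcf: "fcoeff (f n) m = (\<Sum>k<n. of_real (\<beta> k t \<omega>) * fcoeff (\<Phi> (g k)) m)" for n
  proof (induction n)
    case 0
    show ?case using fcoeff_zero by (simp add: f_def[abs_def])
  next
    case (Suc n)
    have "f (Suc n) = (\<lambda>x. 1 * f n x + \<beta> n t \<omega> * \<Phi> (g n) x)" by (auto simp: f_def)
    then have "fcoeff (f (Suc n)) m = fcoeff (f n) m + of_real (\<beta> n t \<omega>) * fcoeff (\<Phi> (g n)) m"
      by (simp only: fcoeff_lincomb[OF sobolev_L2[OF f] sobolev_L2[OF sig]]) simp
    with Suc show ?case by simp
  qed
  have "(\<lambda>n. sobolev_norm (s + 1) (\<lambda>x. f n x - noise \<Phi> g \<beta> t \<omega> x)) \<longlonglongrightarrow> 0"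
    using Om \<omega> t by (auto simp: regular_noise_event_def f_def mult.commute)
  then have "(\<lambda>n. fcoeff (f n) m) \<longlonglongrightarrow> fcoeff (noise \<Phi> g \<beta> t \<omega>) m"
    by (rule fcoeff_tendsto) (use f N s in auto)
  then show "lim (\<lambda>n. \<Sum>k<n. of_real (\<beta> k t \<omega>) * fcoeff (\<Phi> (g k)) m) = fcoeff (noise \<Phi> g \<beta> t \<omega>) m"
    unfolding fcf by (rule limI)
qed

text \<open>Restricting to rational times makes this a measurable condition; the weights bound the noise and its
  space derivative.\<close>

definition small_noise :: "nat \<Rightarrow> (real \<Rightarrow> nat \<Rightarrow> complex) \<Rightarrow> bool" where
  "small_noise n a \<longleftrightarrow> (\<forall>q::rat. \<bar>of_rat q\<bar> \<le> 1 / real (Suc n) \<longrightarrow>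
     (\<forall>m. (\<Sum>i<m. (1 + \<bar>freq i\<bar>) * cmod (a \<bar>of_rat q\<bar> i)) \<le> 1))"

text \<open>Each partial sum involves finitely many coefficients and is continuous in time, so a
  value above 1 would persist at a nearby rational time in the window.\<close>

lemma small_noise_all_times:
  assumes N: "sobolev_path_continuous r {0..1 / real (Suc n)} N" and r: "r \<ge> 0"
    and small: "small_noise n (\<lambda>t i. fcoeff (N t) i)" and t: "t \<in> {0..1 / real (Suc n)}"
  shows "(\<Sum>i<m. (1 + \<bar>freq i\<bar>) * cmod (fcoeff (N t) i)) \<le> 1"
proof -
  define T where "T = 1 / real (Suc n)"
  define h where "h t = (\<Sum>i<m. (1 + \<bar>freq i\<bar>) * cmod (fcoeff (N t) i))" for t
  have T: "T > 0" by (simp add: T_def)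
  have "((\<lambda>t'. fcoeff (N t') i) \<longlongrightarrow> fcoeff (N t) i) (at t within {0..T})" for i
  proof (rule fcoeff_tendsto[where r=r])
    show "\<forall>\<^sub>F t' in at t within {0..T}. sobolev r (N t')"
      using N by (auto simp: eventually_at_filter sobolev_path_continuous_def T_def intro!: always_eventually)
  qed (use N t r in \<open>auto simp: sobolev_path_continuous_def T_def\<close>)
  then have h: "(h \<longlongrightarrow> h t) (at t within {0..T})"
    unfolding h_def by (intro tendsto_intros)
  show ?thesis
  proof (rule ccontr)
    assume "\<not> ?thesis"
    then have gt: "h t > 1" by (simp add: h_def)
    from order_tendstoD(1)[OF h gt] obtain d where d: "d > 0"
      "\<And>t'. t' \<in> {0..T} \<Longrightarrow> t' \<noteq> t \<Longrightarrow> dist t' t < d \<Longrightarrow> h t' > 1"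
      by (auto simp: eventually_at)
    have "max 0 (t - d) < min T (t + d)" using t d T by (auto simp: T_def)
    then obtain q where q: "max 0 (t - d) < real_of_rat q" "real_of_rat q < min T (t + d)"
      using of_rat_dense by blast
    then have "h (real_of_rat q) > 1"
      using d(2)[of "real_of_rat q"] gt by (cases "real_of_rat q = t") (auto simp: dist_real_def)
    moreover have "\<bar>real_of_rat q\<bar> \<le> 1 / real (Suc n)" using q unfolding T_def by linarith
    then have "h \<bar>real_of_rat q\<bar> \<le> 1"
      using small unfolding small_noise_def h_def by blast
    ultimately show False using q by simp
  qed
qed

lemma small_noise_bounds:
  assumes "sobolev r f" "r > 3 / 2" "\<And>m. (\<Sum>i<m. (1 + \<bar>freq i\<bar>) * cmod (fcoeff f i)) \<le> 1"
  shows "\<bar>rep_deriv 0 f x\<bar> \<le> 1" "\<bar>rep_deriv 1 f x\<bar> \<le> 1"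
proof -
  have "\<bar>rep_deriv j f x\<bar> \<le> 1" if j: "j = 0 \<or> j = 1" for j
  proof -
    have s: "summable (\<lambda>n. cmod ((deriv_coeff ^^ j) (fcoeff f) n))"
      by (rule summable_coeffs[OF assms(1)]) (use assms(2) j in auto)
    have "(\<Sum>i<m. cmod ((deriv_coeff ^^ j) (fcoeff f) i)) \<le> (\<Sum>i<m. (1 + \<bar>freq i\<bar>) * cmod (fcoeff f i))" for m
      unfolding cmod_deriv_coeff_pow using j by (intro sum_mono mult_right_mono) auto
    with assms(3) have "(\<Sum>i<m. cmod ((deriv_coeff ^^ j) (fcoeff f) i)) \<le> 1" for m by (meson order_trans)
    then have "(\<Sum>i. cmod ((deriv_coeff ^^ j) (fcoeff f) i)) \<le> 1" by (rule suminf_le_const[OF s])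
    with abs_fourier_sum_le[OF s, of x] show ?thesis by (simp add: rep_deriv_def)
  qed
  then show "\<bar>rep_deriv 0 f x\<bar> \<le> 1" "\<bar>rep_deriv 1 f x\<bar> \<le> 1" by auto
qed

text \<open>The path starts at 0 and is continuous in H^r; by the embedding with j = 0 and j = 1 the
  weighted coefficient sums are at most a multiple of the norm.\<close>

lemma eventually_small_noise:
  assumes N: "sobolev_path_continuous r {0..1} N" and r: "r > 3 / 2" and N0: "N 0 = (\<lambda>x. 0)"
  shows "\<exists>n. small_noise n (\<lambda>t i. fcoeff (N t) i)"
proof -
  obtain C0 where C0: "\<And>f. sobolev r f \<Longrightarrow> summable (\<lambda>n. cmod ((deriv_coeff ^^ 0) (fcoeff f) n)) \<and>
     (\<Sum>n. cmod ((deriv_coeff ^^ 0) (fcoeff f) n)) \<le> C0 * sobolev_norm r f"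
    using sobolev_embedding[of 0 r] r by auto
  obtain C1 where C1: "\<And>f. sobolev r f \<Longrightarrow> summable (\<lambda>n. cmod ((deriv_coeff ^^ 1) (fcoeff f) n)) \<and>
     (\<Sum>n. cmod ((deriv_coeff ^^ 1) (fcoeff f) n)) \<le> C1 * sobolev_norm r f"
    using sobolev_embedding[of 1 r] r by auto
  have N': "sobolev r (N t)" if "t \<in> {0..1}" for t
    using N that by (auto simp: sobolev_path_continuous_def)
  have le: "(\<Sum>i<m. (1 + \<bar>freq i\<bar>) * cmod (fcoeff (N t) i)) \<le> (C0 + C1) * sobolev_norm r (N t)"
    if "t \<in> {0..1}" for t m
  proof -
    note c0 = C0[OF N'[OF that]] and c1 = C1[OF N'[OF that]]
    have "(\<Sum>i<m. (1 + \<bar>freq i\<bar>) * cmod (fcoeff (N t) i)) =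
      (\<Sum>i<m. cmod ((deriv_coeff ^^ 0) (fcoeff (N t)) i)) + (\<Sum>i<m. cmod ((deriv_coeff ^^ 1) (fcoeff (N t)) i))"
      unfolding cmod_deriv_coeff_pow by (simp add: sum.distrib[symmetric] algebra_simps)
    also have "\<dots> \<le> (\<Sum>n. cmod ((deriv_coeff ^^ 0) (fcoeff (N t)) n)) + (\<Sum>n. cmod ((deriv_coeff ^^ 1) (fcoeff (N t)) n))"
      using c0 c1 by (intro add_mono sum_le_suminf) auto
    also have "\<dots> \<le> C0 * sobolev_norm r (N t) + C1 * sobolev_norm r (N t)" using c0 c1 by linarith
    finally show ?thesis by (simp add: algebra_simps)
  qed
  have "((\<lambda>t. sobolev_norm r (\<lambda>x. N t x - N 0 x)) \<longlongrightarrow> 0) (at 0 within {0..1})"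
    using N by (auto simp: sobolev_path_continuous_def)
  then have "((\<lambda>t. sobolev_norm r (N t)) \<longlongrightarrow> 0) (at 0 within {0..1})" by (simp add: N0)
  from tendsto_mult_left[OF this, of "C0 + C1"]
  have "\<forall>\<^sub>F t in at 0 within {0..1}. (C0 + C1) * sobolev_norm r (N t) < 1"
    by (intro order_tendstoD(2)[where y=0]) auto
  then obtain d where d: "d > 0"
    "\<And>t. t \<in> {0..1} \<Longrightarrow> t \<noteq> 0 \<Longrightarrow> dist t 0 < d \<Longrightarrow> (C0 + C1) * sobolev_norm r (N t) < 1"
    by (auto simp: eventually_at)
  obtain n where n: "1 / real (Suc n) < d" using nat_approx_posE[OF d(1)] by (auto simp: inverse_eq_divide)
  have "small_noise n (\<lambda>t i. fcoeff (N t) i)" unfolding small_noise_def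
  proof (intro allI impI)
    fix q :: rat and m assume q: "\<bar>of_rat q\<bar> \<le> 1 / real (Suc n)"
    let ?t = "\<bar>of_rat q\<bar> :: real"
    have t: "?t \<in> {0..1}"
      unfolding atLeastAtMost_iff by (intro conjI abs_ge_zero order_trans[OF q]) simp
    show "(\<Sum>i<m. (1 + \<bar>freq i\<bar>) * cmod (fcoeff (N ?t) i)) \<le> 1"
    \<comment> \<open>The limit at 0 says nothing about time 0 itself, which is covered by
      \<open>N0\<close>.\<close>
    proof (cases "?t = 0")
      case True
      then show ?thesis by (simp add: N0 fcoeff_zero)
    next
      case False
      have "(C0 + C1) * sobolev_norm r (N ?t) < 1" using d(2)[OF t False] q n by (simp add: dist_real_def)
      with le[OF t, of m] show ?thesis by linarith
    qed
  qed
  then show ?thesis by blast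
qed

lemma small_noise_mono:
  assumes "n \<le> n'" "small_noise n a" shows "small_noise n' a"
proof -
  have "1 / real (Suc n') \<le> 1 / real (Suc n)" using assms(1) by (intro divide_left_mono) auto
  with assms(2) show ?thesis unfolding small_noise_def by (meson order_trans)
qed

text \<open>For almost every path some window works, and the events for growing \<open>n\<close>
  increase, so continuity from below gives a single \<open>n\<close> at the cost of probability
  \<open>e\<close>. The event depends on the noise only, so the datum may be chosen after
  it.\<close>

lemma small_noise_event:
  assumes fps: "filtered_prob_space M F" and cw: "cylindrical_wiener M F g J \<beta> W"
    and Om: "regular_noise_event M \<Phi> g \<beta> s \<Omega>s" and s: "s > 3 / 2"
    and sig: "\<And>k. sobolev (s + 1) (\<Phi> (g k))" and e: "e > 0"
  shows "\<exists>n A. A \<in> sets M \<and> A \<subseteq> \<Omega>s \<and> measure M A \<ge> 1 - e \<and>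
    (\<forall>\<omega>\<in>A. small_noise n (\<lambda>t i. fcoeff (noise \<Phi> g \<beta> t \<omega>) i))"
proof -
  interpret prob_space M using fps by (simp add: filtered_prob_space_def)
  \<comment> \<open>A limit of random variables, defined at every sample point and measurable as
    such; it is compared with the noise on the regular event only.\<close>
  define Z where "Z t i \<omega> = lim (\<lambda>n. \<Sum>k<n. of_real (\<beta> k t \<omega>) * fcoeff (\<Phi> (g k)) i)" for t i \<omega>
  have ZN: "Z t i \<omega> = fcoeff (noise \<Phi> g \<beta> t \<omega>) i" if "t \<ge> 0" "\<omega> \<in> \<Omega>s" for t i \<omega>
    unfolding Z_def by (rule fcoeff_noise_lim(2)[OF Om that(2,1) _ sig]) (use s in simp)
  have small_ZN: "small_noise n (\<lambda>t i. Z t i \<omega>) \<longleftrightarrow> small_noise n (\<lambda>t i. fcoeff (noise \<Phi> g \<beta> t \<omega>) i)"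
    if "\<omega> \<in> \<Omega>s" for n \<omega>
    unfolding small_noise_def by (simp only: ZN[OF abs_ge_zero that])
  have wp: "wiener_process M F (\<beta> k)" for k using cw by (simp add: cylindrical_wiener_def)
  have \<beta>m: "\<beta> k t \<in> borel_measurable M" if "t \<ge> 0" for k t
  proof (rule measurable_from_subalg)
    show "subalgebra M (F (ennreal t))"
      using fps by (auto simp: filtered_prob_space_def subalgebra_def filtration_def)
    show "\<beta> k t \<in> borel_measurable (F (ennreal t))" using wp[of k] that by (simp add: wiener_process_def)
  qed
  have [measurable]: "Z \<bar>t\<bar> i \<in> borel_measurable M" for t i
    unfolding Z_def[abs_def] by (intro borel_measurable_lim_metric borel_measurable_sum borel_measurable_times
        borel_measurable_const measurable_compose[OF \<beta>m borel_measurable_of_real]) auto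
  have Os[measurable]: "\<Omega>s \<in> sets M" using Om by (simp add: regular_noise_event_def)
  define E where "E n = {\<omega> \<in> space M. \<omega> \<in> \<Omega>s \<and> small_noise n (\<lambda>t i. Z t i \<omega>)}" for n
  have E[measurable]: "E n \<in> sets M" for n
    unfolding E_def small_noise_def by measurable
  have inc: "incseq E" unfolding incseq_def E_def using small_noise_mono by blast
  have "AE \<omega> in M. \<omega> \<in> \<Omega>s" using Om AE_prob_1 by (simp add: regular_noise_event_def)
  moreover have "AE \<omega> in M. \<forall>k. \<beta> k 0 \<omega> = 0"
    unfolding AE_all_countable using wp by (simp add: wiener_process_def)
  ultimately have "AE \<omega> in M. \<omega> \<in> (\<Union>n. E n)" using AE_space
  proof eventually_elim
    case (elim \<omega>)
    have "\<exists>n. small_noise n (\<lambda>t i. fcoeff (noise \<Phi> g \<beta> t \<omega>) i)"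
    proof (rule eventually_small_noise[where r="s + 1"])
      show "sobolev_path_continuous (s + 1) {0..1} (\<lambda>t. noise \<Phi> g \<beta> t \<omega>)"
        using Om elim(1) by (auto simp: regular_noise_event_def)
      show "noise \<Phi> g \<beta> 0 \<omega> = (\<lambda>x. 0)" using elim(2) by (simp add: noise_def[abs_def])
    qed (use s in simp)
    then have "\<exists>n. small_noise n (\<lambda>t i. Z t i \<omega>)" using small_ZN[OF elim(1)] by simp
    then show ?case using elim by (auto simp: E_def)
  qed
  then have "prob (\<Union>n. E n) = 1" by (subst prob_eq_1) auto
  moreover have "(\<lambda>n. prob (E n)) \<longlonglongrightarrow> prob (\<Union>n. E n)"
    by (rule finite_Lim_measure_incseq[OF _ inc]) auto
  ultimately have "\<forall>\<^sub>F n in sequentially. prob (E n) > 1 - e" using e by (intro order_tendstoD(1)[where y=1]) auto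
  then obtain n where "prob (E n) > 1 - e" by (auto simp: eventually_sequentially)
  moreover have "\<forall>\<omega>\<in>E n. small_noise n (\<lambda>t i. fcoeff (noise \<Phi> g \<beta> t \<omega>) i)"
    using small_ZN by (auto simp: E_def)
  moreover have "E n \<subseteq> \<Omega>s" by (auto simp: E_def)
  ultimately show ?thesis by (intro exI[of _ n] exI[of _ "E n"]) auto
qed

section \<open>Blow-up\<close>

text \<open>The constants are fixed in the order \<eta>, S0, \<theta>, T, b, L, and none depends on
  the path of the noise; therefore one datum excludes every classical path on [0,T] at once.\<close>

lemma blow_up_datum:
  fixes ustar :: real
  assumes smc: "smooth c" and c1: "c1 > 0" and c3: "c3 > 0" and c: "\<And>z. c1 \<le> c z \<and> c z \<le> c2"
    and c': "\<And>z. \<bar>deriv c z\<bar> \<le> c3" and star: "deriv c ustar \<noteq> 0" and T0: "T0 > 0"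
  shows "\<exists>T u0 u0'. 0 < T \<and> T \<le> T0 \<and> T \<le> 1 \<and> torus_smooth u0 \<and>
    (\<forall>x. (u0 has_real_derivative u0' x) (at x)) \<and>
    (\<forall>u p y w px yx wx. wave_path c (deriv c) c1 c2 c3 T u p y w px yx wx \<longrightarrow>
      (\<forall>x. y 0 x = 0) \<longrightarrow> u 0 = u0 \<longrightarrow> p 0 \<noteq> u0')"
proof -
  define e where "e = sgn (deriv c ustar)"
  \<comment> \<open>Half of the derivative at \<open>ustar\<close> survives, with its sign, in a
    neighbourhood by continuity.\<close>
  define m where "m = \<bar>deriv c ustar\<bar> / 2"
  have e: "\<bar>e\<bar> = 1" and m: "m > 0" using star by (auto simp: e_def m_def abs_sgn_eq)
  have e2: "e * e = 1" using e by (metis abs_mult_self_eq mult_1)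
  have c2: "c2 > 0" using c[of 0] c1 by linarith
  have "isCont (deriv c) ustar"
    using smooth_has_deriv(2)[OF smc] by (simp add: continuous_on_eq_continuous_at)
  then obtain d where d: "d > 0" "\<And>z. \<bar>z - ustar\<bar> < d \<Longrightarrow> \<bar>deriv c z - deriv c ustar\<bar> < m"
    using m unfolding continuous_at_eps_delta dist_real_def by blast
  define \<eta> where "\<eta> = d / 2"
  have \<eta>: "\<eta> > 0" using d by (simp add: \<eta>_def)
  have near: "m \<le> e * deriv c z" if "\<bar>z - ustar\<bar> \<le> \<eta>" for z
    using d(2)[of z] that d(1) star unfolding e_def m_def \<eta>_def
    by (cases "deriv c ustar > 0") (auto simp: sgn_if abs_if split: if_splits)
  define S0 where "S0 = 2 / c1 * exp (wave_path.growth c1 c2 c3) * (c2\<^sup>2 + 1)"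
  have "c2\<^sup>2 + 1 > 0" by (simp add: add_nonneg_pos)
  then have S0: "S0 > 0" using c1 by (simp add: S0_def)
  define q where "q = c3 / (2 * c1)"
  define \<theta> where "\<theta> = \<eta> / (3 * S0)"
  have \<theta>: "\<theta> > 0" "\<theta> * S0 \<le> \<eta> / 3" using S0 \<eta> by (auto simp: \<theta>_def field_simps)
  \<comment> \<open>The last entry is the condition T / (4 \<theta>) \<le> \<eta> / 3 solved for
    T.\<close>
  define T where "T = Min {1, T0, \<eta> / 3, 4 * \<theta> * \<eta> / 3}"
  have T: "T > 0" "T \<le> 1" "T \<le> T0" "T \<le> \<eta> / 3" "T \<le> 4 * \<theta> * \<eta> / 3"
    using T0 \<eta> \<theta> by (auto simp: T_def)
  have T\<theta>: "T / (4 * \<theta>) \<le> \<eta> / 3" using T(5) \<theta> by (simp add: field_simps)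
  \<comment> \<open>Chosen so that \<open>m / (8 * c2) * b * T\<close> equals 2.\<close>
  define b where "b = 16 * c2 / (m * T)"
  have b: "b > 0" "m / (8 * c2) * b * T > 1" using m T c2 by (auto simp: b_def field_simps)
  \<comment> \<open>The slope threshold of \<open>wave_path.blow_up\<close>, divided by the lower
    bound \<open>c1\<close> of the wave speed.\<close>
  define L where "L = (b + 3 * q / 2 * S0 + (2 * q\<^sup>2 * c2 / m + q + c2) * T) / c1"
  obtain u0 u0' where u0: "torus_smooth u0" "\<And>x. (u0 has_real_derivative u0' x) (at x)"
    "u0 0 = ustar" "u0' 0 = e * L" "integral {0..1} (\<lambda>x. (u0' x)\<^sup>2) \<le> 1"
    using steep_datum[of ustar "e * L"] by blast
  show ?thesis
  proof (rule exI[of _ T], rule exI[of _ u0], rule exI[of _ u0'],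
      intro conjI T(1-3) u0(1) allI impI notI u0(2)[rule_format])
    fix u p y w px yx wx
    assume wave: "wave_path c (deriv c) c1 c2 c3 T u p y w px yx wx"
      and y0: "\<forall>x. y 0 x = 0" and u: "u 0 = u0" and p: "p 0 = u0'"
    show False
    proof (rule wave_path.blow_up[OF wave e m near y0[rule_format]])
      show "integral {0..1} (\<lambda>z. (p 0 z)\<^sup>2) \<le> 1" "u 0 0 = ustar" using u0 u p by simp_all
      have "c1 * (e * p 0 0) = c1 * L" using p u0(4) e2 by (simp add: mult.assoc[symmetric])
      then show "b + 3 * (c3 / (2 * c1)) / 2 * (2 / c1 * exp (wave_path.growth c1 c2 c3) * (c2\<^sup>2 + 1))
          + (2 * (c3 / (2 * c1))\<^sup>2 * c2 / m + c3 / (2 * c1) + c2) * T \<le> c1 * (e * p 0 0)"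
        using c1 by (simp add: L_def S0_def q_def)
    qed (use \<theta> T T\<theta> b in \<open>auto simp: S0_def\<close>)
  qed
qed

theorem theorem2p3:
  fixes M :: "'a measure" and F :: "ennreal \<Rightarrow> 'a measure"
    and g :: "nat \<Rightarrow> 'u::{real_inner, complete_space}"
    and J :: "'u \<Rightarrow> 'v::{real_inner, complete_space}"
    and \<beta> :: "nat \<Rightarrow> real \<Rightarrow> 'a \<Rightarrow> real" and W :: "real \<Rightarrow> 'a \<Rightarrow> 'v"
    and \<Phi> :: "'u \<Rightarrow> real \<Rightarrow> real" and \<Omega>s :: "'a set"
    and c :: "real \<Rightarrow> real" and s c1 c2 c3 \<gamma> \<epsilon> ustar :: real
  assumes "filtered_prob_space M F"
    and "orthonormal_basis g"
    and "hilbert_schmidt_injection g J"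
    and "cylindrical_wiener M F g J \<beta> W"
    and "linear_into_L2 \<Phi>"
    and "\<And>k. torus_C (\<Phi> (g k))"
    and "\<And>k. torus_W1inf (\<Phi> (g k))"
    and "summable (\<lambda>k. (W1inf_norm (\<Phi> (g k)))\<^sup>2)"
    and "s > 3 / 2"
    and "smooth c"
    and "c1 > 0" and "c2 > 0" and "c3 > 0"
    and "\<And>z. c1 \<le> c z \<and> c z \<le> c2"
    and "\<And>z. \<bar>deriv c z\<bar> \<le> c3"
    and "\<And>k. sobolev (s + 1) (\<Phi> (g k))"
    and "summable (\<lambda>k. (sobolev_norm (s + 1) (\<Phi> (g k)))\<^sup>2)"
    and "regular_noise_event M \<Phi> g \<beta> s \<Omega>s"
    and "deriv c ustar \<noteq> 0"
    and "\<gamma> > 1 / 3" and "\<epsilon> > 0"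
  shows "\<exists>u0. torus_smooth u0 \<and>
           (\<forall>u ut \<tau>. regular_solution M F \<Omega>s s c (noise \<Phi> g \<beta>) u0 (\<lambda>_. 0) u ut \<tau> \<longrightarrow>
              measure M {\<omega> \<in> space M. \<tau> \<omega> \<le> ennreal (\<epsilon> powr \<gamma>)} \<ge> 1 - \<epsilon>)"
proof -
  note fps = assms(1) and cw = assms(4) and s = assms(9) and smc = assms(10) and c1 = assms(11)
    and c3 = assms(13) and c = assms(14) and c' = assms(15) and sig = assms(16) and Om = assms(18)
    and star = assms(19) and \<epsilon> = assms(21)
  interpret prob_space M using fps by (simp add: filtered_prob_space_def)
  obtain n A where A: "A \<in> sets M" "A \<subseteq> \<Omega>s" "prob A \<ge> 1 - \<epsilon>"
    and small: "\<forall>\<omega>\<in>A. small_noise n (\<lambda>t i. fcoeff (noise \<Phi> g \<beta> t \<omega>) i)"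
    using small_noise_event[OF fps cw Om s sig \<epsilon>] by blast
  \<comment> \<open>\<open>T\<close> has to fit into the window of small noise and must not exceed
    \<epsilon>^\<gamma>.\<close>
  have "min (1 / real (Suc n)) (\<epsilon> powr \<gamma>) > 0" using \<epsilon> by simp
  from blow_up_datum[OF smc c1 c3 c c' star this]
  obtain T u0 u0' where T: "0 < T" "T \<le> min (1 / real (Suc n)) (\<epsilon> powr \<gamma>)" "T \<le> 1"
    and u0: "torus_smooth u0" "\<And>x. (u0 has_real_derivative u0' x) (at x)"
    and no_path: "\<forall>u p y w px yx wx. wave_path c (deriv c) c1 c2 c3 T u p y w px yx wx \<longrightarrow>
      (\<forall>x. y 0 x = 0) \<longrightarrow> u 0 = u0 \<longrightarrow> p 0 \<noteq> u0'" by blast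
  show ?thesis
  proof (intro exI[of _ u0] conjI u0(1) allI impI)
    fix u ut \<tau>
    assume sol: "regular_solution M F \<Omega>s s c (noise \<Phi> g \<beta>) u0 (\<lambda>_. 0) u ut \<tau>"
    let ?N = "noise \<Phi> g \<beta>"
    let ?B = "{\<omega> \<in> space M. \<tau> \<omega> \<le> ennreal (\<epsilon> powr \<gamma>)}"
    have "AE \<omega> in M. (\<forall>t\<in>lifetime (\<tau> \<omega>). torus_C (u t \<omega>)) \<and>
        sobolev_path_continuous (s + 1) (lifetime (\<tau> \<omega>)) (\<lambda>t. u t \<omega>) \<and>
        sobolev_path_deriv s (lifetime (\<tau> \<omega>)) (\<lambda>t. u t \<omega>) (\<lambda>t. ut t \<omega>) \<and>
        sobolev_path_continuous s (lifetime (\<tau> \<omega>)) (\<lambda>t. ut t \<omega>)"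
      and "AE \<omega> in M. u 0 \<omega> = u0"
      and "AE \<omega> in M. \<forall>t\<in>lifetime (\<tau> \<omega>). equation_at s c (\<lambda>_. 0) ?N u ut t \<omega>"
      and stop: "stopping_time F \<tau>"
      using sol unfolding regular_solution_def by blast+
    then have "AE \<omega> in M. \<omega> \<in> A \<longrightarrow> \<omega> \<in> ?B" using AE_space
    proof eventually_elim
      case (elim \<omega>)
      show ?case
      proof (rule classical)
        note \<omega> = elim(5)
        assume "\<omega> \<notin> ?B"
        with elim(4) have late: "ennreal (\<epsilon> powr \<gamma>) < \<tau> \<omega>" by auto
        have sub: "{0..T} \<subseteq> lifetime (\<tau> \<omega>)"
        proof
          fix t assume t: "t \<in> {0..T}"
          then have "ennreal t \<le> ennreal (\<epsilon> powr \<gamma>)" using T(2) by (intro ennreal_leI) auto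
          from le_less_trans[OF this late] t show "t \<in> lifetime (\<tau> \<omega>)" by (auto simp: lifetime_def)
        qed
        have N: "sobolev_path_continuous (s + 1) {0..1 / real (Suc n)} (\<lambda>t. ?N t \<omega>)"
          using Om A(2) \<omega> unfolding regular_noise_event_def by auto
        have NT: "sobolev_path_continuous (s + 1) {0..T} (\<lambda>t. ?N t \<omega>)"
          by (rule sobolev_path_continuous_subset[OF N]) (use T(2) in auto)
        have N1: "\<bar>rep_deriv 0 (?N t \<omega>) x\<bar> \<le> 1" "\<bar>rep_deriv 1 (?N t \<omega>) x\<bar> \<le> 1" if t: "t \<in> {0..T}" for t x
        proof -
          have t': "t \<in> {0..1 / real (Suc n)}" using t T(2) by auto
          have "sobolev (s + 1) (?N t \<omega>)" using N t' by (auto simp: sobolev_path_continuous_def)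
          moreover have "(\<Sum>i<m. (1 + \<bar>freq i\<bar>) * cmod (fcoeff (?N t \<omega>) i)) \<le> 1" for m
            by (rule small_noise_all_times[OF N _ small[rule_format, OF \<omega>] t']) (use s in simp)
          ultimately show "\<bar>rep_deriv 0 (?N t \<omega>) x\<bar> \<le> 1" "\<bar>rep_deriv 1 (?N t \<omega>) x\<bar> \<le> 1"
            using small_noise_bounds[of "s + 1" "?N t \<omega>" x] s by auto
        qed
        have eq: "\<exists>J. has_sobolev_integral (s - 1) (\<lambda>r. wave_op c (u r \<omega>)) J t \<and>
            (AE x in lborel. ut t \<omega> x = J x + ?N t \<omega> x)" if "t \<in> {0..T}" for t
          using elim(3) sub that unfolding equation_at_def by auto
        have uC: "torus_C (u t \<omega>)" if "t \<in> {0..T}" for t using elim(1) sub that by blast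
        note wave = classical_wave_path[OF T(1,3) s smc c1 c3 c c' uC
            sobolev_path_continuous_subset[OF conjunct1[OF conjunct2[OF elim(1)]] sub]
            sobolev_path_deriv_subset[OF conjunct1[OF conjunct2[OF conjunct2[OF elim(1)]]] sub]
            sobolev_path_continuous_subset[OF conjunct2[OF conjunct2[OF conjunct2[OF elim(1)]]] sub]
            eq NT N1]
        have "rep_deriv 1 (u 0 \<omega>) = u0'"
          using wave(3)[of 0] u0(2) elim(2) T(1) by (auto intro: DERIV_unique)
        moreover have "rep_deriv 1 (u 0 \<omega>) \<noteq> u0'"
          by (rule no_path[rule_format, OF wave(1)]) (assumption | rule wave(2) elim(2))+
        ultimately show ?thesis by contradiction
      qed
    qed
    \<comment> \<open>Monotonicity of the measure needs a measurable target, since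
      \<open>measure\<close> defaults to 0 outside the \<sigma>-algebra; the stopping time property
      at time \<epsilon>^\<gamma> provides it.\<close>
    moreover have "?B \<in> sets M"
    proof -
      let ?F = "F (ennreal (\<epsilon> powr \<gamma>))"
      have fil: "filtration (space M) F" and sub: "sets ?F \<subseteq> sets M"
        using fps unfolding filtered_prob_space_def by blast+
      have "{\<omega> \<in> space ?F. \<tau> \<omega> \<le> ennreal (\<epsilon> powr \<gamma>)} \<in> sets ?F"
        using stopping_timeD[OF stop] by (simp add: pred_def)
      then have "?B \<in> sets ?F" unfolding filtration.space_F[OF fil] .
      with sub show ?thesis by (rule subsetD)
    qed
    ultimately have "prob A \<le> prob ?B" by (rule finite_measure_mono_AE)
    with A(3) show "1 - \<epsilon> \<le> prob ?B" by linarith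
  qed
qed

end
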